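(* Let $\Omega\subseteq\mathbb{H}^n$ be an open set, let $T$ be a closed positive $2k$-current on $\Omega$, and let $u$ be a locally bounded plurisubharmonic function on $\Omega$ (with $k+1\le n$). Then the $(2k+2)$-current $\triangle u\wedge T:=\triangle(uT)$ is also a closed positive current. Moreover, for $u_1,\dots,u_p\in PSH(\Omega)\cap L^\infty_{loc}(\Omega)$ with $k+p\le n$, the current defined inductively by $$\triangle u_1\wedge\dots\wedge\triangle u_p\wedge T:=\triangle(u_1\triangle u_2\wedge\dots\wedge\triangle u_p\wedge T)$$ is a closed positive current.
   Context: Points of $\mathbb{H}^n\cong\mathbb{R}^{4n}$ are $q=(q_0,\dots,q_{n-1})$, $q_l=x_{4l}+\mathbf{i}x_{4l+1}+\mathbf{j}x_{4l+2}+\mathbf{k}x_{4l+3}$. Define (here $\mathbf{i}$ is the imaginary unit of $\mathbb{C}$), for $l=0,\dots,n-1$: $\nabla_{(2l)0}=\partial_{x_{4l}}+\mathbf{i}\partial_{x_{4l+1}}$, $\nabla_{(2l)1}=-\partial_{x_{4l+2}}-\mathbf{i}\partial_{x_{4l+3}}$, $\nabla_{(2l+1)0}=\partial_{x_{4l+2}}-\mathbf{i}\partial_{x_{4l+3}}$, $\nabla_{(2l+1)1}=\partial_{x_{4l}}-\mathbf{i}\partial_{x_{4l+1}}$. Let $\{\omega^0,\dots,\omega^{2n-1}\}$ be a fixed basis of $\mathbb{C}^{2n}$, $\omega^I=\omega^{i_1}\wedge\dots\wedge\omega^{i_p}$, $\Omega_{2n}=\omega^0\wedge\omega^1\wedge\dots\wedge\omega^{2n-1}$.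 For smooth $F=\sum_I f_I\omega^I$ put $d_\alpha F=\sum_{k,I}\nabla_{k\alpha}f_I\,\omega^k\wedge\omega^I$ ($\alpha=0,1$) and $\triangle F=d_0d_1F$. An upper semicontinuous function $u:\Omega\to[-\infty,\infty)$ is plurisubharmonic ($u\in PSH(\Omega)$) if its restriction to each right quaternionic line $\{a+b\lambda:\lambda\in\mathbb{H}\}$ (intersected with $\Omega$) is subharmonic. Strong positivity: for $a=a^0+\mathbf{i}a^1+\mathbf{j}a^2+\mathbf{k}a^3\in\mathbb{H}$ put $\tau(a)=\begin{pmatrix}a^0-\mathbf{i}a^1&-a^2+\mathbf{i}a^3\\ a^2+\mathbf{i}a^3&a^0+\mathbf{i}a^1\end{pmatrix}$, extended blockwise to quaternionic matrices. For a right $\mathbb{H}$-linear $\eta:\mathbb{H}^n\to\mathbb{H}$ (a $1\times n$ quaternionic matrix) put $\eta^*\widetilde\omega^p=\sum_{j=0}^{2n-1}\tau(\eta)_{pj}\omega^j$, $p=0,1$. Elementary strongly positive elements of $\wedge^{2k}\mathbb{C}^{2n}$ are those of the form $\eta_1^*\widetilde\omega^0\wedge\eta_1^*\widetilde\omega^1\wedge\dots\wedge\eta_k^*\widetilde\omega^0\wedge\eta_k^*\widetilde\omega^1$ with $\eta_1,\dots,\eta_k$ linearly independent right $\mathbb{H}$-linear maps; $SP^{2k}\mathbb{C}^{2n}$ is the convex cone they generate (for $k=0$: $[0,\infty)$). Currents: a $p$-current on $\Omega$ is an element of the dual of $\mathcal{D}^{2n-p}(\Omega)=C_0^\infty(\Omega,\wedge^{2n-p}\mathbb{C}^{2n})$.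 For a current $F$, $(d_\alpha F)(\eta):=-F(d_\alpha\eta)$ and $(\triangle F)(\eta):=F(\triangle\eta)$ for test forms $\eta$. $F$ is closed if $d_0F=d_1F=0$. A $2k$-current $T$ is positive if $T(\eta)\ge0$ for every $\eta\in C_0^\infty(\Omega,SP^{2n-2k}\mathbb{C}^{2n})$. A positive $2k$-current has complex Radon measure coefficients: $T=\sum_I T_I\omega^I$ (sum over increasing multi-indices $I$ of length $2k$ in $\{0,\dots,2n-1\}$), meaning $T(\varphi)=\sum_I\varepsilon_I T_I(\varphi_{\widehat I})$ for $\varphi=\sum\varphi_{\widehat I}\omega^{\widehat I}$, where $\widehat I$ is the increasing complement of $I$ and $\varepsilon_I=\pm1$ satisfies $\varepsilon_I\omega^I\wedge\omega^{\widehat I}=\Omega_{2n}$. For a locally bounded plurisubharmonic function $u$, $uT:=\sum_I uT_I\,\omega^I$. *)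

theory Defs
  imports "HOL-Analysis.Analysis"
begin

section \<open>Quaternionic coordinates\<close>

text \<open>
  \<open>q :: quat\<close> is \<open>q $ 1 + i (q $ 2) + j (q $ 3) + k (q $ 4)\<close>.  Quaternionic \<open>n\<close>-space is
  \<open>quat ^ 'n\<close> with \<open>n = CARD('n)\<close>; the linear order of \<open>'n\<close> identifies it with
  \<open>{0, ..., n - 1}\<close>, and the real coordinate \<open>x\<^bsub>4l+m\<^esub>\<close> is \<open>q $ l $ (m + 1)\<close>.
\<close>

type_synonym quat = "real ^ 4"
type_synonym 'n hspace = "quat ^ 'n"

definition qmul :: "quat \<Rightarrow> quat \<Rightarrow> quat" where
  "qmul p q = vector
     [p $ 1 * q $ 1 - p $ 2 * q $ 2 - p $ 3 * q $ 3 - p $ 4 * q $ 4,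
      p $ 1 * q $ 2 + p $ 2 * q $ 1 + p $ 3 * q $ 4 - p $ 4 * q $ 3,
      p $ 1 * q $ 3 - p $ 2 * q $ 4 + p $ 3 * q $ 1 + p $ 4 * q $ 2,
      p $ 1 * q $ 4 + p $ 2 * q $ 3 - p $ 3 * q $ 2 + p $ 4 * q $ 1]"

definition right_line :: "'n::finite hspace \<Rightarrow> 'n hspace \<Rightarrow> quat \<Rightarrow> 'n hspace" where
  "right_line a b q = (\<chi> l. a $ l + qmul (b $ l) q)"


section \<open>Exterior algebra\<close>

text \<open>
  The basis vectors of \<open>\<complex>\<^sup>2\<^sup>n\<close> are indexed by \<open>'n \<times> 2\<close>: \<open>(l, 0)\<close> and \<open>(l, 1)\<close> stand for
  the indices \<open>2l\<close> and \<open>2l + 1\<close>, as made explicit by \<open>idx_pos\<close> (note that \<open>2\<close> is the type with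
  the two elements \<open>0\<close> and \<open>1\<close>).  A multi-index is a set of indices, to be read in increasing
  order of \<open>idx_pos\<close>, and an element of the exterior algebra is the vector of its coefficients
  with respect to the \<open>\<omega> I\<close>.
\<close>

type_synonym 'n idx = "'n \<times> 2"
type_synonym 'n ext = "complex ^ ('n idx set)"

definition idx_pos :: "'n::{finite,linorder} idx \<Rightarrow> nat" where
  "idx_pos j = 2 * card {m. m < fst j} + (if snd j = 0 then 0 else 1)"

text \<open>The sign of the permutation that sorts \<open>I\<close> followed by \<open>J\<close>, for disjoint \<open>I\<close> and \<open>J\<close>.\<close>

definition shuffle_sign :: "'n::{finite,linorder} idx set \<Rightarrow> 'n idx set \<Rightarrow> complex" where
  "shuffle_sign I J = (- 1) ^ card {(i, j). i \<in> I \<and> j \<in> J \<and> idx_pos j < idx_pos i}"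

definition \<omega> :: "'n::{finite,linorder} idx set \<Rightarrow> 'n ext" where
  "\<omega> I = axis I 1"

definition wedge :: "'n::{finite,linorder} ext \<Rightarrow> 'n ext \<Rightarrow> 'n ext"  (infixr \<open>\<and>\<^sub>w\<close> 70) where
  "a \<and>\<^sub>w b = (\<chi> K. \<Sum>I\<in>Pow K. shuffle_sign I (K - I) * a $ I * b $ (K - I))"

definition ext_power :: "nat \<Rightarrow> 'n::{finite,linorder} ext set" where
  "ext_power p = {a. \<forall>I. a $ I \<noteq> 0 \<longrightarrow> card I = p}"


section \<open>Strong positivity\<close>

definition \<tau> :: "quat \<Rightarrow> complex ^ 2 ^ 2" where
  "\<tau> a = (\<chi> p s.
     if p = 0 then (if s = 0 then Complex (a $ 1) (- (a $ 2)) else Complex (- (a $ 3)) (a $ 4))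
     else (if s = 0 then Complex (a $ 3) (a $ 4) else Complex (a $ 1) (a $ 2)))"

text \<open>
  A right linear map to the quaternions is given by its row \<open>\<eta> :: 'n hspace\<close>, acting by
  \<open>q \<mapsto> \<Sum>l. qmul (\<eta> $ l) (q $ l)\<close>; the right linear maps form a left quaternionic vector space.
\<close>

definition pullback :: "'n::{finite,linorder} hspace \<Rightarrow> 2 \<Rightarrow> 'n ext" where
  "pullback \<eta> p = (\<Sum>j\<in>UNIV. \<tau> (\<eta> $ fst j) $ p $ snd j *s \<omega> {j})"

definition left_independent :: "'n::finite hspace list \<Rightarrow> bool" where
  "left_independent \<eta>s \<longleftrightarrow>
     (\<forall>c :: nat \<Rightarrow> quat. (\<forall>l. (\<Sum>i<length \<eta>s. qmul (c i) (\<eta>s ! i $ l)) = 0)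
        \<longrightarrow> (\<forall>i<length \<eta>s. c i = 0))"

definition elementary_SP :: "nat \<Rightarrow> 'n::{finite,linorder} ext set" where
  "elementary_SP k =
     {foldr (\<lambda>\<eta> a. pullback \<eta> 0 \<and>\<^sub>w pullback \<eta> 1 \<and>\<^sub>w a) \<eta>s (\<omega> {}) | \<eta>s.
        length \<eta>s = k \<and> left_independent \<eta>s}"

definition SP :: "nat \<Rightarrow> 'n::{finite,linorder} ext set" where
  "SP k = convex_cone hull elementary_SP k"


section \<open>Smooth forms and the operators \<open>d\<^sub>0\<close>, \<open>d\<^sub>1\<close> and \<open>\<triangle>\<close>\<close>

definition dir_deriv :: "'a \<Rightarrow> ('a \<Rightarrow> 'b) \<Rightarrow> 'a::real_normed_vector \<Rightarrow> 'b::real_normed_vector" where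
  "dir_deriv v f x = frechet_derivative f (at x) v"

definition iter_deriv ::
    "'a list \<Rightarrow> ('a \<Rightarrow> 'b) \<Rightarrow> 'a::real_normed_vector \<Rightarrow> 'b::real_normed_vector" where
  "iter_deriv vs f = foldr dir_deriv vs f"

definition smooth :: "('a::euclidean_space \<Rightarrow> 'b::real_normed_vector) \<Rightarrow> bool" where
  "smooth f \<longleftrightarrow> (\<forall>vs x. set vs \<subseteq> Basis \<longrightarrow> iter_deriv vs f differentiable (at x))"

definition partial :: "'n::finite \<Rightarrow> 4 \<Rightarrow> ('n hspace \<Rightarrow> complex) \<Rightarrow> 'n hspace \<Rightarrow> complex" where
  "partial l m = dir_deriv (axis l (axis m 1))"

definition nabla ::
    "'n::{finite,linorder} idx \<Rightarrow> 2 \<Rightarrow> ('n hspace \<Rightarrow> complex) \<Rightarrow> 'n hspace \<Rightarrow> complex" where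
  "nabla j \<alpha> f x = (let l = fst j in
     if snd j = 0
     then (if \<alpha> = 0 then partial l 1 f x + \<i> * partial l 2 f x
           else - partial l 3 f x - \<i> * partial l 4 f x)
     else (if \<alpha> = 0 then partial l 3 f x - \<i> * partial l 4 f x
           else partial l 1 f x - \<i> * partial l 2 f x))"

definition ext_d ::
    "2 \<Rightarrow> ('n hspace \<Rightarrow> 'n ext) \<Rightarrow> 'n hspace \<Rightarrow> 'n::{finite,linorder} ext" where
  "ext_d \<alpha> F x = (\<Sum>j\<in>UNIV. \<Sum>I\<in>UNIV. nabla j \<alpha> (\<lambda>y. F y $ I) x *s (\<omega> {j} \<and>\<^sub>w \<omega> I))"

definition lap ::
    "('n hspace \<Rightarrow> 'n ext) \<Rightarrow> 'n hspace \<Rightarrow> 'n::{finite,linorder} ext" where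
  "lap F = ext_d 0 (ext_d 1 F)"

text \<open>Test forms on \<open>\<Omega>\<close> of degree \<open>m\<close>, extended by zero to the whole space.\<close>

definition test_forms ::
    "'n hspace set \<Rightarrow> nat \<Rightarrow> ('n::{finite,linorder} hspace \<Rightarrow> 'n ext) set" where
  "test_forms \<Omega> m =
     {\<phi>. smooth \<phi> \<and> (\<forall>x. \<phi> x \<in> ext_power m) \<and>
         (\<exists>K. compact K \<and> K \<subseteq> \<Omega> \<and> (\<forall>x. x \<notin> K \<longrightarrow> \<phi> x = 0))}"


section \<open>Currents\<close>

text \<open>
  Only the values of a functional on test forms of the complementary degree are relevant.
  The last clause of \<open>current\<close> is continuity in the usual inductive limit topology: on test
  forms supported in a fixed compact set the functional is bounded by some \<open>C\<^sup>N\<close> norm.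
\<close>

type_synonym 'n functional = "('n hspace \<Rightarrow> 'n ext) \<Rightarrow> complex"

definition current ::
    "'n hspace set \<Rightarrow> nat \<Rightarrow> 'n::{finite,linorder} functional \<Rightarrow> bool" where
  "current \<Omega> p T \<longleftrightarrow> p \<le> 2 * CARD('n) \<and>
     (let \<D> = test_forms \<Omega> (2 * CARD('n) - p) in
       (\<forall>\<phi>\<in>\<D>. \<forall>\<psi>\<in>\<D>. T (\<lambda>x. \<phi> x + \<psi> x) = T \<phi> + T \<psi>) \<and>
       (\<forall>\<phi>\<in>\<D>. \<forall>c. T (\<lambda>x. c *s \<phi> x) = c * T \<phi>) \<and>
       (\<forall>K. compact K \<and> K \<subseteq> \<Omega> \<longrightarrow> (\<exists>C N. \<forall>\<phi>\<in>\<D>. \<forall>M.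
          (\<forall>x. x \<notin> K \<longrightarrow> \<phi> x = 0) \<and>
          (\<forall>vs x. set vs \<subseteq> Basis \<and> length vs \<le> N \<longrightarrow> norm (iter_deriv vs \<phi> x) \<le> M)
          \<longrightarrow> norm (T \<phi>) \<le> C * M)))"

definition d_current :: "2 \<Rightarrow> 'n::{finite,linorder} functional \<Rightarrow> 'n functional" where
  "d_current \<alpha> T \<eta> = - T (ext_d \<alpha> \<eta>)"

definition lap_current :: "'n::{finite,linorder} functional \<Rightarrow> 'n functional" where
  "lap_current T \<eta> = T (lap \<eta>)"

text \<open>
  \<open>d_current \<alpha> T\<close> is a \<open>(p + 1)\<close>-current; for \<open>p = 2n\<close> there are no test forms to consider and
  closedness holds trivially, which is why the degree \<open>m\<close> is not written as a subtraction.
\<close>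

definition closed_current ::
    "'n hspace set \<Rightarrow> nat \<Rightarrow> 'n::{finite,linorder} functional \<Rightarrow> bool" where
  "closed_current \<Omega> p T \<longleftrightarrow>
     (\<forall>\<alpha> m. p + 1 + m = 2 * CARD('n) \<longrightarrow> (\<forall>\<eta>\<in>test_forms \<Omega> m. d_current \<alpha> T \<eta> = 0))"

definition positive_current ::
    "'n hspace set \<Rightarrow> nat \<Rightarrow> 'n::{finite,linorder} functional \<Rightarrow> bool" where
  "positive_current \<Omega> k T \<longleftrightarrow>
     (\<forall>\<eta>\<in>test_forms \<Omega> (2 * CARD('n) - 2 * k).
        (\<forall>x. \<eta> x \<in> SP (CARD('n) - k)) \<longrightarrow> T \<eta> \<in> nonneg_Reals)"

definition closed_positive_current ::
    "'n hspace set \<Rightarrow> nat \<Rightarrow> 'n::{finite,linorder} functional \<Rightarrow> bool" where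
  "closed_positive_current \<Omega> k T \<longleftrightarrow>
     current \<Omega> (2 * k) T \<and> closed_current \<Omega> (2 * k) T \<and> positive_current \<Omega> k T"


section \<open>Measure coefficients and the product of a function and a current\<close>

definition radon_measure_on :: "'a::euclidean_space set \<Rightarrow> 'a measure \<Rightarrow> bool" where
  "radon_measure_on \<Omega> \<mu> \<longleftrightarrow>
     sets \<mu> = sets (restrict_space borel \<Omega>) \<and>
     (\<forall>K. compact K \<and> K \<subseteq> \<Omega> \<longrightarrow> emeasure \<mu> K < \<infinity>)"

text \<open>
  A complex Radon measure need not have finite total variation, so it is not a set function on
  all Borel sets; \<open>(a, b, c, e)\<close> represents \<open>a - b + i (c - e)\<close>.
\<close>

type_synonym 'a cmeasure = "'a measure \<times> 'a measure \<times> 'a measure \<times> 'a measure"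

definition complex_radon_measure_on :: "'a::euclidean_space set \<Rightarrow> 'a cmeasure \<Rightarrow> bool" where
  "complex_radon_measure_on \<Omega> \<mu> \<longleftrightarrow> (case \<mu> of (a, b, c, e) \<Rightarrow>
     radon_measure_on \<Omega> a \<and> radon_measure_on \<Omega> b \<and>
     radon_measure_on \<Omega> c \<and> radon_measure_on \<Omega> e)"

definition cmeasure_integral :: "'a cmeasure \<Rightarrow> ('a \<Rightarrow> complex) \<Rightarrow> complex" where
  "cmeasure_integral \<mu> f = (case \<mu> of (a, b, c, e) \<Rightarrow>
     (LINT x|a. f x) - (LINT x|b. f x) + \<i> * ((LINT x|c. f x) - (LINT x|e. f x)))"

text \<open>
  The pairing of \<open>\<Sum>I. \<mu> I \<omega>\<^sup>I\<close> with \<open>\<phi>\<close>.  The complement of \<open>I\<close> is \<open>- I\<close>, and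
  \<open>shuffle_sign I (- I)\<close> is the coefficient of \<open>\<omega> UNIV\<close> in \<open>\<omega> I \<and>\<^sub>w \<omega> (- I)\<close>.
\<close>

definition pairing ::
    "nat \<Rightarrow> ('n idx set \<Rightarrow> 'n hspace cmeasure) \<Rightarrow> 'n::{finite,linorder} functional" where
  "pairing p \<mu> \<phi> =
     (\<Sum>I | card I = p. shuffle_sign I (- I) * cmeasure_integral (\<mu> I) (\<lambda>x. \<phi> x $ (- I)))"

definition has_coefficients ::
    "'n hspace set \<Rightarrow> nat \<Rightarrow> 'n functional \<Rightarrow>
     ('n::{finite,linorder} idx set \<Rightarrow> 'n hspace cmeasure) \<Rightarrow> bool" where
  "has_coefficients \<Omega> p T \<mu> \<longleftrightarrow>
     (\<forall>I. card I = p \<longrightarrow> complex_radon_measure_on \<Omega> (\<mu> I)) \<and>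
     (\<forall>\<phi>\<in>test_forms \<Omega> (2 * CARD('n) - p). T \<phi> = pairing p \<mu> \<phi>)"

text \<open>
  The measures \<open>T\<^sub>I\<close> are determined by \<open>T\<close> (only their representation by four positive measures
  is not), so the choice below does not affect the product \<open>u T\<close>.  For locally bounded \<open>u\<close> only
  finite values of \<open>u\<close> occur.
\<close>

definition mult_current ::
    "'n hspace set \<Rightarrow> nat \<Rightarrow> ('n hspace \<Rightarrow> ereal) \<Rightarrow>
     'n::{finite,linorder} functional \<Rightarrow> 'n functional" where
  "mult_current \<Omega> p u T \<phi> =
     pairing p (SOME \<mu>. has_coefficients \<Omega> p T \<mu>) (\<lambda>x. of_real (real_of_ereal (u x)) *s \<phi> x)"

text \<open>
  \<open>lap_wedge \<Omega> k [u\<^sub>1, \<dots>, u\<^sub>p] T\<close> is \<open>\<triangle>u\<^sub>1 \<and> \<dots> \<and> \<triangle>u\<^sub>p \<and> T\<close> for a \<open>2k\<close>-current \<open>T\<close>.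
\<close>

primrec lap_wedge ::
    "'n hspace set \<Rightarrow> nat \<Rightarrow> ('n hspace \<Rightarrow> ereal) list \<Rightarrow>
     'n::{finite,linorder} functional \<Rightarrow> 'n functional" where
  "lap_wedge \<Omega> k [] T = T"
| "lap_wedge \<Omega> k (u # us) T =
     lap_current (mult_current \<Omega> (2 * (k + length us)) u (lap_wedge \<Omega> k us T))"


section \<open>Plurisubharmonic functions\<close>

definition usc_on :: "'a::topological_space set \<Rightarrow> ('a \<Rightarrow> ereal) \<Rightarrow> bool" where
  "usc_on S u \<longleftrightarrow> (\<forall>x\<in>S. \<forall>c. u x < c \<longrightarrow> (\<forall>\<^sub>F y in at x within S. u y < c))"

text \<open>For functions bounded above on \<open>A\<close> the subtraction is never \<open>\<infinity> - \<infinity>\<close>.\<close>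

definition ereal_integral_on :: "'a::euclidean_space set \<Rightarrow> ('a \<Rightarrow> ereal) \<Rightarrow> ereal" where
  "ereal_integral_on A f =
     enn2ereal (\<integral>\<^sup>+x\<in>A. e2ennreal (f x) \<partial>lborel) -
     enn2ereal (\<integral>\<^sup>+x\<in>A. e2ennreal (- f x) \<partial>lborel)"

text \<open>
  Upper semicontinuity and the sub-mean value inequality on balls.  The function that is
  identically \<open>-\<infinity>\<close> is admitted, as it may arise by restricting a plurisubharmonic function.
\<close>

definition subharmonic_on :: "'a::euclidean_space set \<Rightarrow> ('a \<Rightarrow> ereal) \<Rightarrow> bool" where
  "subharmonic_on D v \<longleftrightarrow> usc_on D v \<and> (\<forall>x\<in>D. v x < \<infinity>) \<and>
     (\<forall>x r. 0 < r \<and> cball x r \<subseteq> D \<longrightarrow>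
        ereal (measure lborel (cball x r)) * v x \<le> ereal_integral_on (cball x r) v)"

definition PSH :: "'n::finite hspace set \<Rightarrow> ('n hspace \<Rightarrow> ereal) set" where
  "PSH \<Omega> = {u. usc_on \<Omega> u \<and> (\<forall>x\<in>\<Omega>. u x < \<infinity>) \<and>
     (\<forall>a b. b \<noteq> 0 \<longrightarrow>
        subharmonic_on {q. right_line a b q \<in> \<Omega>} (\<lambda>q. u (right_line a b q)))}"

definition locally_bounded_on :: "'a::metric_space set \<Rightarrow> ('a \<Rightarrow> ereal) \<Rightarrow> bool" where
  "locally_bounded_on \<Omega> u \<longleftrightarrow>
     (\<forall>x\<in>\<Omega>. \<exists>e>0. \<exists>M::real. \<forall>y\<in>\<Omega> \<inter> ball x e. \<bar>u y\<bar> \<le> ereal M)"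

definition Linf_loc :: "'a::euclidean_space set \<Rightarrow> ('a \<Rightarrow> ereal) set" where
  "Linf_loc \<Omega> = {u. u \<in> borel_measurable (lebesgue_on \<Omega>) \<and>
     (\<forall>K. compact K \<and> K \<subseteq> \<Omega> \<longrightarrow> (\<exists>M::real. AE x in lebesgue_on K. \<bar>u x\<bar> \<le> ereal M))}"

end

theory Submission
  imports Defs "HOL-Computational_Algebra.Polynomial"
begin

text \<open>
  For smooth \<open>g\<close>, closedness of \<open>T\<close> and integration by parts give \<open>\<triangle>(g T) = \<triangle>g \<and> T\<close>.
  Here \<open>\<triangle>g\<close> depends only on the averages of the real Hessian of \<open>g\<close> over the quaternionic lines;
  if they are nonnegative, Lagrange reduction writes \<open>\<triangle>g\<close> pointwise as a sum of elements
  \<open>\<eta>\<^sup>*\<omega>\<^sup>0 \<and> \<eta>\<^sup>*\<omega>\<^sup>1\<close>, so \<open>\<triangle>g \<and> T\<close> is positive.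

  A locally bounded plurisubharmonic \<open>u\<close> is, on a compact set, the pointwise bounded limit of smooth
  functions with this property: averaging \<open>u\<close> over small balls in the coordinate lines makes it
  continuous, and mollification makes it smooth.  Averages over different lines commute, so both steps
  preserve the sub-mean value inequality.  As the coefficients of \<open>T\<close> are Radon measures (by the Riesz
  representation theorem, strongly positive elements being a spanning set), dominated convergence
  carries positivity over to \<open>\<triangle>(u T)\<close>; closedness holds because \<open>\<triangle>\<close> annihilates \<open>d\<^sub>\<alpha>\<close>-exact forms.
\<close>

section \<open>Smooth functions\<close>

text \<open>The coefficients of \<open>T\<close> may be singular with respect to Lebesgue measure,
  so dominated convergence needs approximants of \<open>u\<close> that converge at every point of
  the compact set, not almost everywhere. Averages over balls in lines have this property: the
  sub-mean value inequality keeps them above \<open>u\<close>, and upper semicontinuity brings them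
  below every number larger than \<open>u x\<close>. Averaging once over each coordinate line gives
  uniform continuity, because translating a ball changes little volume; a mollification with a fine
  enough kernel is then uniformly close, whatever its shape. The real Hessian of an approximant need
  not be positive semidefinite; only its averages over quaternionic lines are known to be
  nonnegative. They suffice because right multiplication of both arguments by \<open>q\<close>
  transforms the pair of one-forms attached to a direction by the matrix \<open>\<tau> q\<close>,
  and a symmetric form only sees its determinant, the real number \<open>q \<bullet> q\<close>. So
  averaging over \<open>q\<close> makes the form semidefinite and multiplies the resulting 2-form by
  a positive constant.\<close>

lemma iter_deriv_simps [simp]:
  "iter_deriv [] f = f"
  "iter_deriv (v # vs) f = dir_deriv v (iter_deriv vs f)"
  by (simp_all add: iter_deriv_def)

lemma iter_deriv_append: "iter_deriv (vs @ ws) f = iter_deriv vs (iter_deriv ws f)"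
  by (simp add: iter_deriv_def)

lemma dir_deriv_eq:
  "(f has_derivative f') (at x) \<Longrightarrow> dir_deriv v f x = f' v"
  by (metis dir_deriv_def frechet_derivative_at)

lemma has_derivative_dir_deriv:
  "f differentiable (at x) \<Longrightarrow> (f has_derivative (\<lambda>v. dir_deriv v f x)) (at x)"
  unfolding dir_deriv_def using frechet_derivative_works by (metis (no_types, lifting) ext)

text \<open>A class of differentiable functions that is closed under partial derivatives contains
  all iterated derivatives of its members. Choosing the class well, for example sums of products,
  replaces formulas for higher derivatives by one application of the product or chain rule.\<close>

lemma smooth_coinduct:
  assumes "P f"
    and "\<And>g x. P g \<Longrightarrow> g differentiable (at x)"
    and "\<And>g e. P g \<Longrightarrow> e \<in> Basis \<Longrightarrow> P (dir_deriv e g)"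
  shows "smooth f"
proof -
  have "P (iter_deriv vs f)" if "set vs \<subseteq> Basis" for vs
    using that by (induction vs) (use assms in auto)
  then show ?thesis
    using assms(2) by (auto simp: smooth_def)
qed

lemma smooth_differentiable: "smooth f \<Longrightarrow> f differentiable (at x)"
  unfolding smooth_def by (metis empty_subsetI iter_deriv_simps(1) list.set(1))

lemma smooth_has_derivative: "smooth f \<Longrightarrow> (f has_derivative (\<lambda>v. dir_deriv v f x)) (at x)"
  by (simp add: has_derivative_dir_deriv smooth_differentiable)

lemma smooth_continuous_on: "smooth f \<Longrightarrow> continuous_on A f"
  by (meson continuous_at_imp_continuous_on differentiable_imp_continuous_within smooth_differentiable)

lemma smooth_iter_deriv:
  assumes "smooth f" "set ws \<subseteq> Basis" shows "smooth (iter_deriv ws f)"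
  unfolding smooth_def
proof (intro allI impI)
  fix vs :: "'a list" and x
  assume "set vs \<subseteq> Basis"
  then have "iter_deriv (vs @ ws) f differentiable at x"
    using assms unfolding smooth_def by (metis le_sup_iff set_append)
  then show "iter_deriv vs (iter_deriv ws f) differentiable at x"
    by (simp add: iter_deriv_append)
qed

lemma smooth_dir_deriv_Basis:
  assumes "smooth f" "e \<in> Basis" shows "smooth (dir_deriv e f)"
  using smooth_iter_deriv[of f "[e]"] assms by simp

lemma
  assumes "smooth f"
  shows dir_deriv_scaleR: "dir_deriv (c *\<^sub>R v) f x = c *\<^sub>R dir_deriv v f x"
    and dir_deriv_vector_sum: "dir_deriv (sum g I) f x = (\<Sum>i\<in>I. dir_deriv (g i) f x)"
proof -
  have "linear (\<lambda>v. dir_deriv v f x)"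
    using smooth_has_derivative[OF assms] has_derivative_linear by blast
  then show "dir_deriv (c *\<^sub>R v) f x = c *\<^sub>R dir_deriv v f x"
      "dir_deriv (sum g I) f x = (\<Sum>i\<in>I. dir_deriv (g i) f x)"
    using linear_scale linear_sum by blast+
qed

lemma smooth_const [intro, simp]: "smooth (\<lambda>x::'a::euclidean_space. c::'b::real_normed_vector)"
proof (rule smooth_coinduct[where P = "\<lambda>f. \<exists>c. f = (\<lambda>x. c)"])
  show "\<exists>c. dir_deriv e g = (\<lambda>x. c)" if "\<exists>c. g = (\<lambda>x. c)" for g :: "'a \<Rightarrow> 'b" and e
  proof -
    from that obtain c where "g = (\<lambda>x. c)" ..
    then have "dir_deriv e g = (\<lambda>x. 0)" by (intro ext) (simp add: dir_deriv_def)
    then show ?thesis by (rule exI)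
  qed
qed auto

lemma dir_deriv_add:
  assumes "f differentiable (at x)" "g differentiable (at x)"
  shows "dir_deriv e (\<lambda>x. f x + g x) x = dir_deriv e f x + dir_deriv e g x"
  by (intro dir_deriv_eq has_derivative_add has_derivative_dir_deriv assms)

lemma smooth_add [intro]:
  fixes f :: "'a::euclidean_space \<Rightarrow> 'b::real_normed_vector"
  assumes "smooth f" "smooth g" shows "smooth (\<lambda>x. f x + g x)"
proof (rule smooth_coinduct[where P = "\<lambda>h. \<exists>f g. smooth f \<and> smooth g \<and> h = (\<lambda>x. f x + g x)"])
  show "\<exists>f' g'. smooth f' \<and> smooth g' \<and> dir_deriv e h = (\<lambda>x. f' x + g' x)"
    if h: "\<exists>f g. smooth f \<and> smooth g \<and> h = (\<lambda>x. f x + g x)" and e: "e \<in> Basis" for h :: "'a \<Rightarrow> 'b" and e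
  proof -
    obtain f g where f: "smooth f" "smooth g" "h = (\<lambda>x. f x + g x)" using h by (elim exE conjE)
    have "dir_deriv e h = (\<lambda>x. dir_deriv e f x + dir_deriv e g x)"
      unfolding f by (intro ext dir_deriv_add smooth_differentiable f)
    then show ?thesis using f(1,2) e smooth_dir_deriv_Basis by blast
  qed
  show "h differentiable (at x)" if h: "\<exists>f g. smooth f \<and> smooth g \<and> h = (\<lambda>x. f x + g x)"
    for h :: "'a \<Rightarrow> 'b" and x
  proof -
    obtain f g where f: "smooth f" "smooth g" "h = (\<lambda>x. f x + g x)" using h by (elim exE conjE)
    show ?thesis unfolding f by (intro differentiable_add smooth_differentiable f)
  qed
  show "\<exists>f' g'. smooth f' \<and> smooth g' \<and> (\<lambda>x. f x + g x) = (\<lambda>x. f' x + g' x)"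
    using assms by (intro exI[of _ f] exI[of _ g] conjI refl)
qed

lemma smooth_sum [intro]:
  "(\<And>i. i \<in> I \<Longrightarrow> smooth (f i)) \<Longrightarrow> smooth (\<lambda>x. \<Sum>i\<in>I. f i x)"
  by (induction I rule: infinite_finite_induct) (simp_all add: smooth_add)

lemma dir_deriv_linear_compose:
  assumes "bounded_linear L" "f differentiable (at x)"
  shows "dir_deriv e (\<lambda>x. L (f x)) x = L (dir_deriv e f x)"
  by (intro dir_deriv_eq bounded_linear.has_derivative[OF assms(1)] has_derivative_dir_deriv assms)

lemma smooth_linear_compose:
  fixes L :: "'b::real_normed_vector \<Rightarrow> 'c::real_normed_vector" and f :: "'a::euclidean_space \<Rightarrow> 'b"
  assumes L: "bounded_linear L" and "smooth f" shows "smooth (\<lambda>x. L (f x))"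
proof (rule smooth_coinduct[where P = "\<lambda>h. \<exists>f. smooth f \<and> h = (\<lambda>x. L (f x))"])
  show "g differentiable (at x)" if g: "\<exists>f. smooth f \<and> g = (\<lambda>x. L (f x))" for g :: "'a \<Rightarrow> 'c" and x
  proof -
    obtain f where f: "smooth f" "g = (\<lambda>x. L (f x))" using g by (elim exE conjE)
    show ?thesis unfolding f
      by (rule differentiableI[OF bounded_linear.has_derivative[OF L smooth_has_derivative[OF f(1)]]])
  qed
  show "\<exists>f. smooth f \<and> dir_deriv e g = (\<lambda>x. L (f x))"
    if g: "\<exists>f. smooth f \<and> g = (\<lambda>x. L (f x))" and e: "e \<in> Basis" for g :: "'a \<Rightarrow> 'c" and e
  proof -
    obtain f where f: "smooth f" "g = (\<lambda>x. L (f x))" using g by (elim exE conjE)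
    have "dir_deriv e g = (\<lambda>x. L (dir_deriv e f x))"
      unfolding f by (intro ext dir_deriv_linear_compose L smooth_differentiable f)
    then show ?thesis using f(1) e smooth_dir_deriv_Basis by blast
  qed
  show "\<exists>f'. smooth f' \<and> (\<lambda>x. L (f x)) = (\<lambda>x. L (f' x))"
    using assms by (intro exI[of _ f] conjI refl)
qed

lemma smooth_linear:
  fixes L :: "'a::euclidean_space \<Rightarrow> 'b::real_normed_vector"
  assumes "bounded_linear L" shows "smooth L"
proof (rule smooth_coinduct[where P = "\<lambda>h. h = L \<or> (\<exists>c. h = (\<lambda>x. c))"])
  fix h :: "'a \<Rightarrow> 'b" and e
  assume h: "h = L \<or> (\<exists>c. h = (\<lambda>x. c))"
  have "dir_deriv e L = (\<lambda>x. L e)"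
    by (intro ext dir_deriv_eq bounded_linear_imp_has_derivative assms)
  moreover have "dir_deriv e (\<lambda>x::'a. c) = (\<lambda>x. 0)" for c :: 'b
    by (intro ext) (simp add: dir_deriv_def)
  ultimately show "dir_deriv e h = L \<or> (\<exists>c. dir_deriv e h = (\<lambda>x. c))"
    using h by auto
qed (use assms bounded_linear_imp_differentiable in auto)

text \<open>The product rule turns a product into a sum of two products, so finite sums of products
  are the invariant class for \<open>smooth_coinduct\<close>.\<close>

inductive prod_sum ::
    "('b::real_normed_vector \<Rightarrow> 'c::real_normed_vector \<Rightarrow> 'd::real_normed_vector) \<Rightarrow>
      ('a::euclidean_space \<Rightarrow> 'd) \<Rightarrow> bool"
  for p :: "'b::real_normed_vector \<Rightarrow> 'c::real_normed_vector \<Rightarrow> 'd::real_normed_vector" where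
  "smooth f \<Longrightarrow> smooth g \<Longrightarrow> prod_sum p (\<lambda>x. p (f x) (g x))"
| "prod_sum p f \<Longrightarrow> prod_sum p g \<Longrightarrow> prod_sum p (\<lambda>x. f x + g x)"

lemma dir_deriv_bilinear:
  assumes "bounded_bilinear p" "f differentiable (at x)" "g differentiable (at x)"
  shows "dir_deriv e (\<lambda>x. p (f x) (g x)) x = p (f x) (dir_deriv e g x) + p (dir_deriv e f x) (g x)"
  by (intro dir_deriv_eq bounded_bilinear.FDERIV[OF assms(1)] has_derivative_dir_deriv assms)

lemma smooth_bilinear:
  fixes p :: "'b::real_normed_vector \<Rightarrow> 'c::real_normed_vector \<Rightarrow> 'd::real_normed_vector"
    and f :: "'a::euclidean_space \<Rightarrow> 'b"
  assumes p: "bounded_bilinear p" and "smooth f" "smooth g"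
  shows "smooth (\<lambda>x. p (f x) (g x))"
proof -
  have diff: "h differentiable (at x)" if "prod_sum p h" for h :: "'a \<Rightarrow> 'd" and x
    using that
  proof induction
    case (1 f g)
    then show ?case
      by (intro differentiableI[OF bounded_bilinear.FDERIV[OF p smooth_has_derivative smooth_has_derivative]])
  next
    case (2 f g)
    then show ?case by (intro differentiable_add)
  qed
  have step: "prod_sum p (dir_deriv e h)" if "prod_sum p h" "e \<in> Basis" for h :: "'a \<Rightarrow> 'd" and e
    using that
  proof induction
    case (1 f g)
    have "dir_deriv e (\<lambda>x. p (f x) (g x)) = (\<lambda>x. p (f x) (dir_deriv e g x) + p (dir_deriv e f x) (g x))"
      by (intro ext dir_deriv_bilinear p smooth_differentiable 1)
    moreover have "prod_sum p \<dots>"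
      by (rule prod_sum.intros(2); rule prod_sum.intros(1)) (use 1 smooth_dir_deriv_Basis in auto)
    ultimately show ?case by simp
  next
    case (2 f g)
    have "dir_deriv e (\<lambda>x. f x + g x) = (\<lambda>x. dir_deriv e f x + dir_deriv e g x)"
      by (intro ext dir_deriv_add diff 2)
    moreover have "prod_sum p \<dots>"
      by (rule prod_sum.intros(2)) (use 2 in auto)
    ultimately show ?case by simp
  qed
  have "prod_sum p (\<lambda>x. p (f x) (g x))"
    using assms by (intro prod_sum.intros)
  then show ?thesis
    by (rule smooth_coinduct[where P = "prod_sum p"]) (erule diff | erule (1) step)+
qed

lemma smooth_mult [intro]: "smooth f \<Longrightarrow> smooth g \<Longrightarrow> smooth (\<lambda>x. f x * g x :: 'b::real_normed_algebra)"
  by (rule smooth_bilinear[OF bounded_bilinear_mult])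

lemma smooth_scaleR [intro]: "smooth f \<Longrightarrow> smooth g \<Longrightarrow> smooth (\<lambda>x. f x *\<^sub>R g x)"
  by (rule smooth_bilinear[OF bounded_bilinear_scaleR])

lemma smooth_minus [intro]: "smooth f \<Longrightarrow> smooth (\<lambda>x. - f x)"
  by (rule smooth_linear_compose[OF bounded_linear_minus[OF bounded_linear_ident]])

lemma smooth_diff [intro]: "smooth f \<Longrightarrow> smooth g \<Longrightarrow> smooth (\<lambda>x. f x - g x)"
  using smooth_add[OF _ smooth_minus] by fastforce

text \<open>The definition of \<open>smooth\<close> speaks of basis directions; linearity in the
  direction extends it to all vectors.\<close>

lemma smooth_dir_deriv:
  assumes "smooth f" shows "smooth (dir_deriv v f)"
proof -
  have "dir_deriv v f x = (\<Sum>e\<in>Basis. (v \<bullet> e) *\<^sub>R dir_deriv e f x)" for x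
  proof -
    have "dir_deriv v f x = dir_deriv (\<Sum>e\<in>Basis. (v \<bullet> e) *\<^sub>R e) f x"
      by (simp add: euclidean_representation)
    then show ?thesis
      by (simp only: dir_deriv_vector_sum[OF assms] dir_deriv_scaleR[OF assms])
  qed
  then have "dir_deriv v f = (\<lambda>x. \<Sum>e\<in>Basis. (v \<bullet> e) *\<^sub>R dir_deriv e f x)" by blast
  then show ?thesis
    using smooth_dir_deriv_Basis[OF assms] by (auto intro!: smooth_sum smooth_scaleR)
qed

text \<open>By the chain rule the derivative of a composite carries an extra smooth factor. Allowing
  such a factor \<open>g\<close>, and sums, gives a class stable under differentiation.\<close>

inductive comp_sum :: "('a::euclidean_space \<Rightarrow> real) \<Rightarrow> ('a \<Rightarrow> real) \<Rightarrow> bool"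
  for f where
  "smooth \<phi> \<Longrightarrow> smooth g \<Longrightarrow> comp_sum f (\<lambda>x. \<phi> (f x) * g x)"
| "comp_sum f h \<Longrightarrow> comp_sum f k \<Longrightarrow> comp_sum f (\<lambda>x. h x + k x)"

lemma smooth_compose:
  fixes f :: "'a::euclidean_space \<Rightarrow> real" and \<phi> :: "real \<Rightarrow> real"
  assumes \<phi>: "smooth \<phi>" and f: "smooth f" shows "smooth (\<lambda>x. \<phi> (f x))"
proof -
  have D: "((\<lambda>x. \<phi> (f x)) has_derivative (\<lambda>v. dir_deriv 1 \<phi> (f x) * dir_deriv v f x)) (at x)"
    if "smooth \<phi>" for \<phi> :: "real \<Rightarrow> real" and x
  proof -
    have lin: "dir_deriv v \<phi> (f x) = dir_deriv 1 \<phi> (f x) * v" for v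
      using dir_deriv_scaleR[OF that, of v 1] by (simp add: mult.commute)
    show ?thesis
      using diff_chain_at[OF smooth_has_derivative[OF f, of x] smooth_has_derivative[OF that, of "f x"]]
      by (simp add: o_def lin[of "dir_deriv v f x" for v])
  qed
  have E: "((\<lambda>x. \<phi> (f x) * g x) has_derivative
      (\<lambda>v. \<phi> (f x) * dir_deriv v g x + dir_deriv 1 \<phi> (f x) * dir_deriv v f x * g x)) (at x)"
    if "smooth \<phi>" "smooth g" for \<phi> :: "real \<Rightarrow> real" and g x
    by (rule has_derivative_mult[OF D[OF that(1)] smooth_has_derivative[OF that(2)]])
  have diff: "h differentiable (at x)" if "comp_sum f h" for h x
    using that
  proof induction
    case (1 \<phi> g)
    then show ?case by (intro differentiableI[OF E])
  next
    case (2 h k)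
    then show ?case by (intro differentiable_add)
  qed
  have step: "comp_sum f (dir_deriv e h)" if "comp_sum f h" for h e
    using that
  proof induction
    case (1 \<phi> g)
    have "dir_deriv e (\<lambda>x. \<phi> (f x) * g x) =
      (\<lambda>x. \<phi> (f x) * dir_deriv e g x + dir_deriv 1 \<phi> (f x) * (dir_deriv e f x * g x))"
      using dir_deriv_eq[OF E[OF 1]] by (auto simp: mult.assoc)
    moreover have "comp_sum f \<dots>"
      by (rule comp_sum.intros(2); rule comp_sum.intros(1)) (use 1 f smooth_dir_deriv in auto)
    ultimately show ?case by simp
  next
    case (2 h k)
    have "dir_deriv e (\<lambda>x. h x + k x) = (\<lambda>x. dir_deriv e h x + dir_deriv e k x)"
      by (intro ext dir_deriv_add diff 2)
    moreover have "comp_sum f \<dots>"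
      by (rule comp_sum.intros(2)) (use 2 in auto)
    ultimately show ?case by simp
  qed
  have "comp_sum f (\<lambda>x. \<phi> (f x) * 1)"
    using assms by (intro comp_sum.intros) auto
  then have "comp_sum f (\<lambda>x. \<phi> (f x))" by simp
  then show ?thesis
    by (rule smooth_coinduct[where P = "comp_sum f"]) (erule diff step)+
qed

section \<open>Second differences and symmetry of mixed derivatives\<close>

lemma dir_deriv_real_line:
  fixes f :: "'a::euclidean_space \<Rightarrow> real"
  assumes "smooth f"
  shows "((\<lambda>t. f (x + t *\<^sub>R v)) has_real_derivative dir_deriv v f (x + t *\<^sub>R v)) (at t)"
proof -
  have "((\<lambda>t. f (x + t *\<^sub>R v)) has_derivative (\<lambda>s. dir_deriv (s *\<^sub>R v) f (x + t *\<^sub>R v))) (at t)"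
    by (rule has_derivative_compose[of "\<lambda>t. x + t *\<^sub>R v", OF _ smooth_has_derivative[OF assms]])
      (auto intro!: derivative_eq_intros)
  moreover have "dir_deriv (s *\<^sub>R v) f (x + t *\<^sub>R v) = dir_deriv v f (x + t *\<^sub>R v) * s" for s
    by (simp add: dir_deriv_scaleR[OF assms])
  ultimately show ?thesis by (simp add: has_field_derivative_def)
qed

text \<open>The mean value theorem is used twice: along \<open>v\<close> for the increment of
  \<open>f\<close> in direction \<open>w\<close>, and along \<open>w\<close> for the resulting
  derivative \<open>dir_deriv v f\<close>. With \<open>v = w\<close> the same formula controls the
  second difference quotients in \<open>hess_average_nonneg\<close>.\<close>

lemma second_difference:
  fixes f :: "'a::euclidean_space \<Rightarrow> real"
  assumes f: "smooth f" and s: "s > 0"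
  obtains a b where "0 < a" "a < s" "0 < b" "b < s"
    "f (x + s *\<^sub>R v + s *\<^sub>R w) - f (x + s *\<^sub>R v) - f (x + s *\<^sub>R w) + f x
      = s\<^sup>2 * dir_deriv w (dir_deriv v f) (x + a *\<^sub>R v + b *\<^sub>R w)"
proof -
  define \<phi> where "\<phi> t = f ((x + s *\<^sub>R w) + t *\<^sub>R v) - f (x + t *\<^sub>R v)" for t
  have D\<phi>: "(\<phi> has_real_derivative
    (dir_deriv v f ((x + s *\<^sub>R w) + t *\<^sub>R v) - dir_deriv v f (x + t *\<^sub>R v))) (at t)" for t
    unfolding \<phi>_def by (intro DERIV_diff dir_deriv_real_line f)
  obtain a where a: "0 < a" "a < s"
    "\<phi> s - \<phi> 0 = (s - 0) * (dir_deriv v f ((x + s *\<^sub>R w) + a *\<^sub>R v) - dir_deriv v f (x + a *\<^sub>R v))"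
    using MVT2[OF s D\<phi>] by auto
  define \<psi> where "\<psi> t = dir_deriv v f (x + a *\<^sub>R v + t *\<^sub>R w)" for t
  have D\<psi>: "(\<psi> has_real_derivative dir_deriv w (dir_deriv v f) (x + a *\<^sub>R v + t *\<^sub>R w)) (at t)" for t
    unfolding \<psi>_def by (intro dir_deriv_real_line smooth_dir_deriv f)
  obtain b where b: "0 < b" "b < s"
    "\<psi> s - \<psi> 0 = (s - 0) * dir_deriv w (dir_deriv v f) (x + a *\<^sub>R v + b *\<^sub>R w)"
    using MVT2[OF s D\<psi>] by auto
  have "\<phi> s - \<phi> 0 = s * (\<psi> s - \<psi> 0)"
    using a(3) by (simp add: \<psi>_def algebra_simps)
  then have "\<phi> s - \<phi> 0 = s\<^sup>2 * dir_deriv w (dir_deriv v f) (x + a *\<^sub>R v + b *\<^sub>R w)"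
    using b(3) by (simp add: power2_eq_square)
  then show ?thesis using that[of a b] a b by (simp add: \<phi>_def algebra_simps)
qed

text \<open>The second difference does not change when \<open>v\<close> and \<open>w\<close> are
  exchanged, while its limit after division by the squared step is one mixed derivative or the
  other, depending on the order in which the mean value theorem is applied.\<close>

lemma dir_deriv_commute_real:
  fixes f :: "'a::euclidean_space \<Rightarrow> real"
  assumes f: "smooth f"
  shows "dir_deriv v (dir_deriv w f) x = dir_deriv w (dir_deriv v f) x"
proof -
  define d where "d n = 1 / real (Suc n)" for n
  have d: "d n > 0" for n by (simp add: d_def)
  define \<Delta> where "\<Delta> v w n = (f (x + d n *\<^sub>R v + d n *\<^sub>R w) - f (x + d n *\<^sub>R v) - f (x + d n *\<^sub>R w) + f x) / (d n)\<^sup>2"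
    for v w n
  have lim: "\<Delta> v w \<longlonglongrightarrow> dir_deriv w (dir_deriv v f) x" for v w
  proof -
    have "\<exists>a b. 0 < a \<and> a < d n \<and> 0 < b \<and> b < d n \<and> \<Delta> v w n = dir_deriv w (dir_deriv v f) (x + a *\<^sub>R v + b *\<^sub>R w)" for n
    proof -
      obtain a b where "0 < a" "a < d n" "0 < b" "b < d n"
        "f (x + d n *\<^sub>R v + d n *\<^sub>R w) - f (x + d n *\<^sub>R v) - f (x + d n *\<^sub>R w) + f x
          = (d n)\<^sup>2 * dir_deriv w (dir_deriv v f) (x + a *\<^sub>R v + b *\<^sub>R w)"
        using second_difference[OF f d] by metis
      then show ?thesis using d[of n] unfolding \<Delta>_def by (intro exI[of _ a] exI[of _ b]) auto
    qed
    then obtain a b where ab: "\<And>n. 0 < a n \<and> a n < d n \<and> 0 < b n \<and> b n < d n"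
      and eq: "\<And>n. \<Delta> v w n = dir_deriv w (dir_deriv v f) (x + a n *\<^sub>R v + b n *\<^sub>R w)"
      by metis
    have d0: "d \<longlonglongrightarrow> 0"
      unfolding d_def by (rule LIMSEQ_Suc[OF lim_1_over_n])
    have "a \<longlonglongrightarrow> 0" "b \<longlonglongrightarrow> 0"
      by (rule tendsto_sandwich[OF _ _ tendsto_const d0]; use ab in \<open>auto intro!: always_eventually less_imp_le\<close>)+
    then have "(\<lambda>n. x + a n *\<^sub>R v + b n *\<^sub>R w) \<longlonglongrightarrow> x"
      by (auto intro!: tendsto_eq_intros)
    then have "(\<lambda>n. dir_deriv w (dir_deriv v f) (x + a n *\<^sub>R v + b n *\<^sub>R w)) \<longlonglongrightarrow> dir_deriv w (dir_deriv v f) x"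
      using smooth_continuous_on[OF smooth_dir_deriv[OF smooth_dir_deriv[OF f]], of UNIV]
      by (auto simp: continuous_on_eq_continuous_at intro: isCont_tendsto_compose)
    moreover have "\<Delta> v w = (\<lambda>n. dir_deriv w (dir_deriv v f) (x + a n *\<^sub>R v + b n *\<^sub>R w))"
      by (intro ext eq)
    ultimately show ?thesis by simp
  qed
  have "\<Delta> w v = \<Delta> v w"
    by (intro ext) (simp add: \<Delta>_def algebra_simps)
  then show ?thesis
    using lim[of v w] lim[of w v] LIMSEQ_unique by metis
qed

lemma dir_deriv_commute:
  fixes f :: "'a::euclidean_space \<Rightarrow> 'b::euclidean_space"
  assumes f: "smooth f"
  shows "dir_deriv v (dir_deriv w f) x = dir_deriv w (dir_deriv v f) x"
proof (rule euclidean_eqI)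
  fix b :: 'b
  have L: "bounded_linear (\<lambda>y. y \<bullet> b)" by (rule bounded_linear_inner_left)
  have *: "dir_deriv v (dir_deriv w f) x \<bullet> b = dir_deriv v (dir_deriv w (\<lambda>x. f x \<bullet> b)) x" for v w
  proof -
    have "dir_deriv w (\<lambda>x. f x \<bullet> b) = (\<lambda>x. dir_deriv w f x \<bullet> b)"
      by (intro ext dir_deriv_linear_compose[OF L] smooth_differentiable f)
    then show ?thesis
      by (simp add: dir_deriv_linear_compose[OF L] smooth_differentiable smooth_dir_deriv f)
  qed
  show "dir_deriv v (dir_deriv w f) x \<bullet> b = dir_deriv w (dir_deriv v f) x \<bullet> b"
    unfolding * by (rule dir_deriv_commute_real) (rule smooth_linear_compose[OF L f])
qed

section \<open>Bump functions\<close>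

text \<open>Letting \<open>p\<close> range over all polynomials makes the family stable under
  differentiation: with \<open>s = 1/t\<close>, the derivative replaces \<open>p\<close> by
  \<open>s^2 (p - p')\<close>.\<close>

definition flat_exp :: "real poly \<Rightarrow> real \<Rightarrow> real" where
  "flat_exp p t = (if t \<le> 0 then 0 else poly p (1 / t) * exp (- (1 / t)))"

lemma poly_exp_tendsto_0: "((\<lambda>y. poly p y * exp (- y)) \<longlongrightarrow> 0) (at_top :: real filter)"
proof -
  have "((\<lambda>y. \<Sum>i\<le>degree p. coeff p i * (y ^ i / exp y)) \<longlongrightarrow> (\<Sum>i\<le>degree p. coeff p i * 0)) at_top"
    by (intro tendsto_sum tendsto_mult tendsto_const tendsto_power_div_exp_0)
  moreover have "(\<lambda>y. \<Sum>i\<le>degree p. coeff p i * (y ^ i / exp y)) = (\<lambda>y. poly p y * exp (- y))"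
    by (auto simp: poly_altdef exp_minus divide_inverse sum_distrib_right mult.assoc)
  ultimately show ?thesis by simp
qed

lemma flat_exp_deriv:
  "(flat_exp p has_real_derivative flat_exp ([:0, 0, 1:] * (p - pderiv p)) t) (at t)"
proof -
  consider "t < 0" | "t = 0" | "t > 0" by linarith
  then show ?thesis
  proof cases
    case 1
    have "((\<lambda>_. 0) has_real_derivative 0) (at t)" by simp
    then have "(flat_exp p has_real_derivative 0) (at t)"
      by (rule has_field_derivative_transform_within_open[where S = "{..<0}"])
        (use 1 in \<open>auto simp: flat_exp_def\<close>)
    then show ?thesis using 1 by (simp add: flat_exp_def)
  next
    case 2
    \<comment> \<open>The difference quotient at zero is \<open>s p(s) exp(-s)\<close> with
      \<open>s = 1/h\<close>; the factor \<open>s\<close> accounts for the polynomial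
      \<open>pCons 0 p\<close>.\<close>
    have "((\<lambda>h. poly (pCons 0 p) (inverse h) * exp (- inverse h)) \<longlongrightarrow> 0) (at_right (0::real))"
      using filterlim_compose[OF poly_exp_tendsto_0 filterlim_inverse_at_top_right] .
    then have R: "((\<lambda>h. (flat_exp p (0 + h) - flat_exp p 0) / h) \<longlongrightarrow> 0) (at_right 0)"
      by (rule Lim_transform_eventually)
        (auto simp: flat_exp_def eventually_at_right_field divide_inverse intro!: exI[of _ 1])
    have "((\<lambda>h. 0) \<longlongrightarrow> 0) (at_left (0::real))" by simp
    then have L: "((\<lambda>h. (flat_exp p (0 + h) - flat_exp p 0) / h) \<longlongrightarrow> 0) (at_left 0)"
      by (rule Lim_transform_eventually)
        (auto simp: flat_exp_def eventually_at_left_field intro!: exI[of _ "-1"])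
    show ?thesis
      using R L 2 by (auto simp: DERIV_def flat_exp_def filterlim_split_at)
  next
    case 3
    have "((\<lambda>t. poly p (1 / t) * exp (- (1 / t))) has_real_derivative
       flat_exp ([:0, 0, 1:] * (p - pderiv p)) t) (at t)"
      using 3 by (auto intro!: derivative_eq_intros poly_DERIV[THEN DERIV_chain2]
        simp: flat_exp_def field_simps power2_eq_square)
    then show ?thesis
      by (rule has_field_derivative_transform_within_open[where S = "{0<..}"])
        (use 3 in \<open>auto simp: flat_exp_def\<close>)
  qed
qed

lemma dir_deriv_real:
  "(f has_real_derivative f') (at t) \<Longrightarrow> dir_deriv 1 f t = f'"
  by (subst dir_deriv_eq[of _ "(*) f'"]) (auto simp: has_field_derivative_def)

lemma real_differentiableI:
  "(f has_real_derivative f') (at t) \<Longrightarrow> f differentiable (at t)"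
  by (auto simp: has_field_derivative_def intro: differentiableI)

lemma smooth_antiderivative:
  fixes f :: "real \<Rightarrow> real"
  assumes f: "\<And>t. (f has_real_derivative f' t) (at t)" and f': "smooth f'"
  shows "smooth f"
proof (rule smooth_coinduct[where P = "\<lambda>g. g = f \<or> smooth g"])
  fix g :: "real \<Rightarrow> real" and e assume g: "g = f \<or> smooth g" and e: "e \<in> (Basis :: real set)"
  have "dir_deriv 1 f = f'" by (intro ext dir_deriv_real f)
  then show "dir_deriv e g = f \<or> smooth (dir_deriv e g)"
    using g e f' smooth_dir_deriv by auto
qed (use real_differentiableI[OF f] in \<open>auto intro: smooth_differentiable\<close>)

lemma smooth_flat_exp: "smooth (flat_exp p)"
proof (rule smooth_coinduct[where P = "\<lambda>f. \<exists>p. f = flat_exp p"])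
  show "g differentiable (at x)" if "\<exists>p. g = flat_exp p" for g x
    using that real_differentiableI[OF flat_exp_deriv] by (elim exE) simp
  show "\<exists>p. dir_deriv e g = flat_exp p" if g: "\<exists>p. g = flat_exp p" and e: "e \<in> (Basis :: real set)" for g e
  proof -
    obtain p where p: "g = flat_exp p" using g by (elim exE)
    have "dir_deriv 1 g = flat_exp ([:0, 0, 1:] * (p - pderiv p))"
      unfolding p by (intro ext dir_deriv_real flat_exp_deriv)
    then show ?thesis using e by auto
  qed
qed auto

lemma smooth_step_exists:
  "\<exists>S :: real \<Rightarrow> real. smooth S \<and> mono S \<and> (\<forall>t\<le>0. S t = 0) \<and> (\<forall>t\<ge>1. S t = 1)"
proof -
  \<comment> \<open>\<open>g\<close> is positive exactly on the open unit interval, so its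
    normalised antiderivative is the required step.\<close>
  define g where "g t = flat_exp 1 t * flat_exp 1 (1 - t)" for t
  have g: "smooth g"
    unfolding g_def
    by (intro smooth_mult smooth_flat_exp smooth_compose[OF smooth_flat_exp] smooth_diff smooth_const
        smooth_linear bounded_linear_ident)
  have g_pos: "g t \<ge> 0" for t by (simp add: g_def flat_exp_def)
  have cont: "continuous_on A g" for A by (rule smooth_continuous_on[OF g])
  have int: "g integrable_on {a..b}" for a b
    by (intro integrable_continuous_interval cont)
  define G where "G t = integral {0..t} g" for t
  have G_left: "G t = 0" if "t \<le> 0" for t
    using that by (cases "t = 0") (auto simp: G_def)
  have G_add: "G b = G a + integral {a..b} g" if "0 \<le> a" "a \<le> b" for a b
    using Henstock_Kurzweil_Integration.integral_combine[OF that int] by (simp add: G_def)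
  have zero: "integral {a..b} g = 0" if "\<And>t. t \<in> {a..b} \<Longrightarrow> g t = 0" for a b
    using integral_cong[of "{a..b}" g "\<lambda>_. 0"] that by simp
  have deriv: "(G has_real_derivative g t) (at t)" for t
  proof -
    \<comment> \<open>Starting the integral left of both \<open>0\<close> and \<open>t\<close> makes
      \<open>t\<close> an interior point, also when \<open>t \<le> 0\<close>; the added piece
      contributes nothing because \<open>g\<close> vanishes there.\<close>
    define H where "H s = integral {-\<bar>t\<bar>-1..s} g" for s
    have H: "((\<lambda>s. H s) has_real_derivative g t) (at t within {-\<bar>t\<bar>-1..\<bar>t\<bar>+1})"
      unfolding H_def by (rule integral_has_real_derivative) (use cont in auto)
    have "(H has_real_derivative g t) (at t)"
      using H by (subst (asm) at_within_Icc_at) auto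
    then show ?thesis
    proof (rule has_field_derivative_transform_within_open[where S = "{-\<bar>t\<bar>-1<..}"])
      fix s assume s: "s \<in> {-\<bar>t\<bar>-1<..}"
      show "H s = G s"
      proof (cases "s \<le> 0")
        case True
        have "g r = 0" if "r \<in> {-\<bar>t\<bar>-1..s}" for r
          using that True by (auto simp: g_def flat_exp_def)
        then show ?thesis using True zero by (simp add: H_def G_left)
      next
        case False
        have "H s = integral {-\<bar>t\<bar>-1..0} g + integral {0..s} g"
          unfolding H_def
          by (rule Henstock_Kurzweil_Integration.integral_combine[symmetric]) (use False int in auto)
        moreover have "integral {-\<bar>t\<bar>-1..0} g = 0"
          by (rule zero) (auto simp: g_def flat_exp_def)
        ultimately show ?thesis by (simp add: G_def)
      qed
    qed auto
  qed
  have smG: "smooth G" using smooth_antiderivative[OF deriv g] .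
  have monoG: "mono G"
    by (rule monoI, rule DERIV_nonneg_imp_nondecreasing) (use deriv g_pos in blast)+
  have G1: "G t = G 1" if "t \<ge> 1" for t
  proof -
    have "g r = 0" if "r \<in> {1..t}" for r using that by (auto simp: g_def flat_exp_def)
    then show ?thesis using G_add[of 1 t] that zero[of 1 t] by auto
  qed
  \<comment> \<open>Otherwise the monotone function \<open>G\<close> would vanish to the left of
    \<open>1\<close>, and its derivative \<open>g\<close> would vanish at
    \<open>1/2\<close>.\<close>
  have "G 1 > 0"
  proof (rule ccontr)
    assume "\<not> G 1 > 0"
    then have G0: "G t = 0" if "t \<le> 1" for t
      using monoD[OF monoG, of 0 1] monoD[OF monoG, of t 1] monoD[OF monoG, of 0 t] G_left[of 0] G_left[of t] that
      by (cases "t \<le> 0") auto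
    have "((\<lambda>_. 0) has_real_derivative 0) (at (1/2))" by simp
    then have "(G has_real_derivative 0) (at (1/2))"
      by (rule has_field_derivative_transform_within_open[where S = "{..<1}"]) (use G0 in auto)
    then have "g (1/2) = 0" using deriv DERIV_unique by blast
    then show False by (simp add: g_def flat_exp_def)
  qed
  define S where "S t = (1 / G 1) * G t" for t
  have "smooth S"
    unfolding S_def by (rule smooth_mult[OF smooth_const smG])
  moreover have "mono S"
    unfolding S_def by (rule monoI, rule mult_left_mono) (use monoD[OF monoG] \<open>G 1 > 0\<close> in auto)
  moreover have "S t = 0" if "t \<le> 0" for t
    using G_left[OF that] by (simp add: S_def)
  moreover have "S t = 1" if "t \<ge> 1" for t
    using G1[OF that] \<open>G 1 > 0\<close> by (simp add: S_def)
  ultimately show ?thesis by blast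
qed

section \<open>Cutoff functions built from a smooth step\<close>

definition smooth_step :: "real \<Rightarrow> real" where
  "smooth_step = (SOME S. smooth S \<and> mono S \<and> (\<forall>t\<le>0. S t = 0) \<and> (\<forall>t\<ge>1. S t = 1))"

lemma smooth_step:
  "smooth smooth_step" "mono smooth_step"
  "t \<le> 0 \<Longrightarrow> smooth_step t = 0" "t \<ge> 1 \<Longrightarrow> smooth_step t = 1"
  using someI_ex[OF smooth_step_exists] unfolding smooth_step_def by auto

lemma smooth_step_bounds: "0 \<le> smooth_step t" "smooth_step t \<le> 1"
proof -
  show "0 \<le> smooth_step t"
    using monoD[OF smooth_step(2), of "min t 0" t] smooth_step(3)[of "min t 0"] by simp
  show "smooth_step t \<le> 1"
    using monoD[OF smooth_step(2), of t "max t 1"] smooth_step(4)[of "max t 1"] by simp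
qed

lemma smooth_inner_self: "smooth (\<lambda>x::'a::euclidean_space. (x - c) \<bullet> (x - c))"
  by (intro smooth_bilinear[OF bounded_bilinear_inner] smooth_diff smooth_const smooth_linear bounded_linear_ident)

text \<open>The parameter \<open>m\<close> is a steepness. For fixed \<open>m \<ge> 0\<close> and
  positive radius this is a cutoff supported in the ball; as \<open>m\<close> grows it increases to
  the indicator of the open ball, which is what makes balls measurable in the Caratheodory
  construction. The squared distance is used because it is smooth also at the centre.\<close>

definition ball_bump :: "'a::euclidean_space \<Rightarrow> real \<Rightarrow> real \<Rightarrow> 'a \<Rightarrow> real" where
  "ball_bump c r m x = smooth_step (m * (r\<^sup>2 - (x - c) \<bullet> (x - c)))"

lemma smooth_ball_bump: "smooth (ball_bump c r m)"
  unfolding ball_bump_def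
  by (intro smooth_compose[OF smooth_step(1)] smooth_mult smooth_diff smooth_const smooth_inner_self)

lemma ball_bump_bounds: "0 \<le> ball_bump c r m x" "ball_bump c r m x \<le> 1"
  by (simp_all add: ball_bump_def smooth_step_bounds)

lemma ball_bump_outside:
  assumes "r > 0" "m \<ge> 0" "x \<notin> ball c r" shows "ball_bump c r m x = 0"
proof -
  have "r \<le> norm (x - c)" using assms by (simp add: dist_norm norm_minus_commute)
  then have "r\<^sup>2 \<le> (x - c) \<bullet> (x - c)"
    using assms by (simp add: dot_square_norm power_mono)
  then show ?thesis
    using assms by (auto simp: ball_bump_def mult_nonneg_nonpos intro!: smooth_step)
qed

lemma ball_bump_inside:
  assumes "m * (r\<^sup>2 - (norm (x - c))\<^sup>2) \<ge> 1" shows "ball_bump c r m x = 1"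
  using assms by (simp add: ball_bump_def dot_square_norm smooth_step(4))

lemma ball_bump_mono:
  assumes "r > 0" "0 \<le> m" "m \<le> m'" shows "ball_bump c r m x \<le> ball_bump c r m' x"
proof (cases "x \<in> ball c r")
  case True
  then have "(x - c) \<bullet> (x - c) \<le> r\<^sup>2"
    by (auto simp: dot_square_norm dist_norm norm_minus_commute intro!: power_mono)
  then show ?thesis
    using assms by (auto simp: ball_bump_def intro!: monoD[OF smooth_step(2)] mult_right_mono)
qed (use assms in \<open>simp add: ball_bump_outside\<close>)

lemma ball_bump_tendsto:
  assumes "r > 0" shows "(\<lambda>n. ball_bump c r (real n) x) \<longlonglongrightarrow> indicator (ball c r) x"
proof (cases "x \<in> ball c r")
  case True
  then have "(norm (x - c))\<^sup>2 < r\<^sup>2"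
    using assms by (auto simp: dist_norm norm_minus_commute intro!: power_strict_mono)
  then obtain N where N: "real N * (r\<^sup>2 - (norm (x - c))\<^sup>2) > 1"
    using reals_Archimedean3[of "r\<^sup>2 - (norm (x - c))\<^sup>2"] by auto
  have "ball_bump c r (real n) x = 1" if "n \<ge> N" for n
  proof (rule ball_bump_inside)
    have "real N * (r\<^sup>2 - (norm (x - c))\<^sup>2) \<le> real n * (r\<^sup>2 - (norm (x - c))\<^sup>2)"
      using that \<open>_ < r\<^sup>2\<close> by (intro mult_right_mono) auto
    then show "1 \<le> real n * (r\<^sup>2 - (norm (x - c))\<^sup>2)" using N by simp
  qed
  then show ?thesis
    using True by (intro tendsto_eventually) (auto simp: eventually_sequentially)
qed (use assms in \<open>simp add: ball_bump_outside\<close>)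

lemma smooth_cutoff:
  fixes K :: "'a::euclidean_space set"
  assumes "compact K" "open U" "K \<subseteq> U"
  obtains \<psi> L where "smooth \<psi>" "compact L" "L \<subseteq> U" "\<And>x. x \<notin> L \<Longrightarrow> \<psi> x = (0::real)"
    "\<And>x. 0 \<le> \<psi> x" "\<And>x. \<psi> x \<le> 1" "\<And>x. x \<in> K \<Longrightarrow> \<psi> x = 1"
proof -
  have "\<exists>r>0. cball x (2 * r) \<subseteq> U" if "x \<in> K" for x
  proof -
    have "x \<in> U" using assms(3) that by (rule subsetD)
    then obtain e where "e > 0" "cball x e \<subseteq> U"
      using assms(2)[unfolded open_contains_cball] by auto
    then show ?thesis by (intro exI[of _ "e / 2"] conjI) simp_all
  qed
  then have "\<forall>x\<in>K. \<exists>r>0. cball x (2 * r) \<subseteq> U" by auto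
  from bchoice[OF this] obtain r where r: "\<forall>x\<in>K. r x > 0 \<and> cball x (2 * r x) \<subseteq> U" ..
  obtain D where D: "D \<subseteq> K" "finite D" "K \<subseteq> (\<Union>c\<in>D. ball c (r c))"
  proof (rule compactE_image[OF assms(1)])
    show "K \<subseteq> (\<Union>c\<in>K. ball c (r c))" using r by force
  qed auto
  \<comment> \<open>On the ball of radius \<open>r c\<close> the argument of the step is at least
    \<open>(4 - 1) (r c)^2 / (r c)^2 = 3\<close>, so the bump of radius \<open>2 r c\<close> equals
    one there.\<close>
  define b where "b c = ball_bump c (2 * r c) (1 / (r c)\<^sup>2)" for c
  \<comment> \<open>The sum may exceed one where balls overlap; the outer step brings it back to at
    most one while keeping the value one on \<open>K\<close>.\<close>
  define \<psi> where "\<psi> x = smooth_step (\<Sum>c\<in>D. b c x)" for x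
  define L where "L = (\<Union>c\<in>D. cball c (2 * r c))"
  have rD: "r c > 0" if "c \<in> D" for c using r D that by auto
  show ?thesis
  proof
    show "smooth \<psi>"
      unfolding \<psi>_def b_def by (intro smooth_compose[OF smooth_step(1)] smooth_sum smooth_ball_bump)
    show "compact L" "L \<subseteq> U"
      unfolding L_def using D r by (auto intro!: compact_UN)
    show "\<psi> x = 0" if "x \<notin> L" for x
    proof -
      have "b c x = 0" if c: "c \<in> D" for c
        unfolding b_def using \<open>x \<notin> L\<close> c rD[OF c] by (intro ball_bump_outside) (auto simp: L_def)
      then show ?thesis by (simp add: \<psi>_def smooth_step)
    qed
    show "\<psi> x = 1" if "x \<in> K" for x
    proof -
      obtain c where c: "c \<in> D" "x \<in> ball c (r c)" using D \<open>x \<in> K\<close> by blast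
      have "(norm (x - c))\<^sup>2 \<le> (r c)\<^sup>2"
        using c rD[OF c(1)] by (intro power_mono) (auto simp: dist_norm norm_minus_commute)
      then have "(2 * r c)\<^sup>2 - (norm (x - c))\<^sup>2 \<ge> (r c)\<^sup>2" using zero_le_power2[of "r c"] by (simp add: power_mult_distrib, linarith)
      then have "b c x = 1"
        unfolding b_def using rD[OF c(1)] by (intro ball_bump_inside) (simp add: field_simps)
      moreover have "b c x \<le> (\<Sum>c\<in>D. b c x)"
        by (rule member_le_sum) (use c D in \<open>auto simp: b_def ball_bump_bounds\<close>)
      ultimately show ?thesis by (simp add: \<psi>_def smooth_step)
    qed
  qed (simp_all add: \<psi>_def smooth_step_bounds)
qed

section \<open>Exterior algebra\<close>

lemma vector_4 [simp]:
  "(vector [a, b, c, d] :: 'a::zero ^ 4) $ 1 = a"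
  "(vector [a, b, c, d] :: 'a ^ 4) $ 2 = b"
  "(vector [a, b, c, d] :: 'a ^ 4) $ 3 = c"
  "(vector [a, b, c, d] :: 'a ^ 4) $ 4 = d"
  unfolding vector_def by auto

lemma idx_pos_inj: "idx_pos i = idx_pos j \<longleftrightarrow> i = (j :: 'n::{finite,linorder} idx)"
proof
  assume eq: "idx_pos i = idx_pos j"
  have s: "snd i = snd j"
  proof -
    have "even (idx_pos k) \<longleftrightarrow> snd k = 0" for k :: "'n idx" by (simp add: idx_pos_def)
    then have "snd i = 0 \<longleftrightarrow> snd j = 0" using eq by metis
    then show ?thesis using exhaust_2[of "snd i"] exhaust_2[of "snd j"] by auto
  qed
  have c: "card {m. m < fst i} = card {m. m < fst j}"
    using eq s by (simp add: idx_pos_def)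
  have "fst i = fst j"
  proof (rule ccontr)
    assume "fst i \<noteq> fst j"
    moreover have False if "a < b" "card {m. m < a} = card {m. m < b}" for a b :: 'n
      using that psubset_card_mono[of "{m. m < b}" "{m. m < a}"] by force
    ultimately show False using c by (metis linorder_neqE)
  qed
  then show "i = j" using s by (simp add: prod_eq_iff)
qed simp

text \<open>The sign of moving \<open>j\<close> from the front to its place among the elements of
  \<open>K\<close>, the only sign that left multiplication by a basis covector produces.\<close>

definition ins_sign :: "'n::{finite,linorder} idx \<Rightarrow> 'n idx set \<Rightarrow> complex" where
  "ins_sign j K = (- 1) ^ card {k \<in> K. idx_pos k < idx_pos j}"

lemma shuffle_sign_singleton: "shuffle_sign {j} K = ins_sign j K"
proof -
  have "{(i, k). i \<in> {j} \<and> k \<in> K \<and> idx_pos k < idx_pos i} = Pair j ` {k \<in> K. idx_pos k < idx_pos j}"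
    by auto
  then show ?thesis
    by (simp add: shuffle_sign_def ins_sign_def card_image inj_on_def)
qed

lemma ins_sign_Diff: "ins_sign j (K - {j}) = ins_sign j K"
  unfolding ins_sign_def by (metis (no_types, lifting) Diff_iff less_irrefl singletonD)

lemma ins_sign_remove:
  assumes "i \<in> K" "idx_pos i < idx_pos j"
  shows "ins_sign j (K - {i}) = - ins_sign j K"
proof -
  have "{k \<in> K. idx_pos k < idx_pos j} = insert i {k \<in> K - {i}. idx_pos k < idx_pos j}"
    using assms by auto
  then have "card {k \<in> K. idx_pos k < idx_pos j} = Suc (card {k \<in> K - {i}. idx_pos k < idx_pos j})"
    by simp
  then show ?thesis by (simp add: ins_sign_def)
qed

lemma ins_sign_remove_less:
  assumes "\<not> idx_pos i < idx_pos j"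
  shows "ins_sign j (K - {i}) = ins_sign j K"
proof -
  have "{k \<in> K. idx_pos k < idx_pos j} = {k \<in> K - {i}. idx_pos k < idx_pos j}"
    using assms by auto
  then show ?thesis by (simp add: ins_sign_def)
qed

lemma wedge_add_left: "(a + b) \<and>\<^sub>w c = a \<and>\<^sub>w c + b \<and>\<^sub>w c"
  by (simp add: wedge_def vec_eq_iff algebra_simps sum.distrib)

lemma wedge_add_right: "a \<and>\<^sub>w (b + c) = a \<and>\<^sub>w b + a \<and>\<^sub>w c"
  by (simp add: wedge_def vec_eq_iff algebra_simps sum.distrib)

lemma wedge_smult_left: "(r *s a) \<and>\<^sub>w b = r *s (a \<and>\<^sub>w b)"
  by (simp add: wedge_def vec_eq_iff sum_distrib_left algebra_simps)

lemma wedge_smult_right: "a \<and>\<^sub>w (r *s b) = r *s (a \<and>\<^sub>w b)"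
  by (simp add: wedge_def vec_eq_iff sum_distrib_left algebra_simps)

lemma scaleR_eq_smult: "r *\<^sub>R a = complex_of_real r *s (a :: complex ^ 'k)"
  unfolding vec_eq_iff vector_scaleR_component vector_smult_component
  by (simp add: scaleR_conv_of_real)

lemma wedge_zero [simp]: "0 \<and>\<^sub>w a = 0" "a \<and>\<^sub>w 0 = 0"
  by (simp_all add: wedge_def vec_eq_iff)

lemma wedge_minus: "(- a) \<and>\<^sub>w b = - (a \<and>\<^sub>w b)" "a \<and>\<^sub>w (- b) = - (a \<and>\<^sub>w b)"
  by (simp_all add: wedge_def vec_eq_iff sum_negf)

lemma bilinear_wedge: "bounded_bilinear ((\<and>\<^sub>w) :: 'n::{finite,linorder} ext \<Rightarrow> 'n ext \<Rightarrow> 'n ext)"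
  unfolding bilinear_conv_bounded_bilinear[symmetric] bilinear_def
  by (auto intro!: linearI simp: wedge_add_left wedge_add_right scaleR_eq_smult wedge_smult_left wedge_smult_right)

lemma bounded_linear_wedge: "bounded_linear (\<lambda>X. a \<and>\<^sub>w X)"
  by (rule bounded_bilinear.bounded_linear_right[OF bilinear_wedge])

lemma wedge_sum_left: "(\<Sum>i\<in>I. f i) \<and>\<^sub>w b = (\<Sum>i\<in>I. f i \<and>\<^sub>w b)"
  by (rule bounded_bilinear.sum_left[OF bilinear_wedge])

lemma wedge_sum_right: "b \<and>\<^sub>w (\<Sum>i\<in>I. f i) = (\<Sum>i\<in>I. b \<and>\<^sub>w f i)"
  by (rule bounded_bilinear.sum_right[OF bilinear_wedge])

text \<open>In the sum over subsets of \<open>K\<close> only the subset \<open>{j}\<close> meets the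
  support of \<open>\<omega> {j}\<close>. The anticommutation rules below rest on this coordinate
  form of left multiplication.\<close>

lemma wedge_basis_nth:
  "(\<omega> {j} \<and>\<^sub>w X) $ K = (if j \<in> K then ins_sign j K * X $ (K - {j}) else 0)"
proof -
  have "(\<omega> {j} \<and>\<^sub>w X) $ K = (\<Sum>I\<in>Pow K. if I = {j} then ins_sign j K * X $ (K - {j}) else 0)"
    unfolding wedge_def \<omega>_def axis_def vec_lambda_beta
    by (rule sum.cong) (simp_all add: shuffle_sign_singleton ins_sign_Diff)
  also have "\<dots> = (if j \<in> K then ins_sign j K * X $ (K - {j}) else 0)"
    by (subst sum.delta) auto
  finally show ?thesis .
qed

lemma wedge_basis_anticomm: "\<omega> {i} \<and>\<^sub>w (\<omega> {j} \<and>\<^sub>w X) = - (\<omega> {j} \<and>\<^sub>w (\<omega> {i} \<and>\<^sub>w X))"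
proof -
  \<comment> \<open>Removing the earlier index lowers the place of the later one by one, while
    removing the later index leaves the earlier one alone; hence exactly one sign changes.\<close>
  have "ins_sign i K * ins_sign j (K - {i}) = - (ins_sign j K * ins_sign i (K - {j}))"
    if "i \<in> K" "j \<in> K" "i \<noteq> j" for K
  proof -
    have "idx_pos i \<noteq> idx_pos j" using that(3) by (simp add: idx_pos_inj)
    then consider "idx_pos i < idx_pos j" | "idx_pos j < idx_pos i" by linarith
    then show ?thesis
      by cases (use that in \<open>simp_all add: ins_sign_remove ins_sign_remove_less\<close>)
  qed
  note sign = this
  show ?thesis
    unfolding vec_eq_iff
  proof
    fix K
    have *: "(\<omega> {i} \<and>\<^sub>w (\<omega> {j} \<and>\<^sub>w X)) $ K =
      (if i \<in> K \<and> j \<in> K \<and> i \<noteq> j then ins_sign i K * ins_sign j (K - {i}) * X $ (K - {i} - {j}) else 0)" for i j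
      unfolding wedge_basis_nth[of i] by (cases "i \<in> K"; cases "j \<in> K"; cases "i = j") (simp_all add: wedge_basis_nth)
    have "K - {i} - {j} = K - {j} - {i}" by blast
    then show "(\<omega> {i} \<and>\<^sub>w (\<omega> {j} \<and>\<^sub>w X)) $ K = (- (\<omega> {j} \<and>\<^sub>w (\<omega> {i} \<and>\<^sub>w X))) $ K"
      unfolding * vector_uminus_component using sign[of K] by (cases "i \<in> K"; cases "j \<in> K"; cases "i = j") simp_all
  qed
qed

lemma pullback_wedge: "pullback \<eta> p \<and>\<^sub>w X = (\<Sum>j\<in>UNIV. \<tau> (\<eta> $ fst j) $ p $ snd j *s (\<omega> {j} \<and>\<^sub>w X))"
  by (simp add: pullback_def wedge_sum_left wedge_smult_left)

lemma smult_sum_right: "c *s (\<Sum>i\<in>I. f i) = (\<Sum>i\<in>I. c *s (f i :: complex ^ 'k))"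
  by (simp add: vec_eq_iff sum_distrib_left)

lemma smult_sum_left: "(\<Sum>i\<in>I. f i) *s v = (\<Sum>i\<in>I. f i *s (v :: complex ^ 'k))"
  by (simp add: vec_eq_iff sum_distrib_right)

lemma pullback_wedge2:
  "pullback \<eta> p \<and>\<^sub>w (pullback \<zeta> q \<and>\<^sub>w X) = (\<Sum>i\<in>UNIV. \<Sum>j\<in>UNIV.
     (\<tau> (\<eta> $ fst i) $ p $ snd i * \<tau> (\<zeta> $ fst j) $ q $ snd j) *s (\<omega> {i} \<and>\<^sub>w (\<omega> {j} \<and>\<^sub>w X)))"
  by (simp add: pullback_wedge wedge_sum_right wedge_smult_right smult_sum_right vector_smult_assoc)
    (subst sum.swap, simp add: mult.commute)

lemma pullback_anticomm:
  "pullback \<eta> p \<and>\<^sub>w (pullback \<zeta> q \<and>\<^sub>w X) = - (pullback \<zeta> q \<and>\<^sub>w (pullback \<eta> p \<and>\<^sub>w X))"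
proof -
  let ?a = "\<lambda>j. \<tau> (\<eta> $ fst j) $ p $ snd j" and ?b = "\<lambda>j. \<tau> (\<zeta> $ fst j) $ q $ snd j"
  have "pullback \<eta> p \<and>\<^sub>w (pullback \<zeta> q \<and>\<^sub>w X)
      = (\<Sum>i\<in>UNIV. \<Sum>j\<in>UNIV. (?a i * ?b j) *s (\<omega> {i} \<and>\<^sub>w (\<omega> {j} \<and>\<^sub>w X)))"
    by (rule pullback_wedge2)
  also have "\<dots> = - (\<Sum>i\<in>UNIV. \<Sum>j\<in>UNIV. (?a i * ?b j) *s (\<omega> {j} \<and>\<^sub>w (\<omega> {i} \<and>\<^sub>w X)))"
    by (subst wedge_basis_anticomm) (simp add: sum_negf vector_smult_rneg)
  also have "(\<Sum>i\<in>UNIV. \<Sum>j\<in>UNIV. (?a i * ?b j) *s (\<omega> {j} \<and>\<^sub>w (\<omega> {i} \<and>\<^sub>w X)))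
      = (\<Sum>j\<in>UNIV. \<Sum>i\<in>UNIV. (?b j * ?a i) *s (\<omega> {j} \<and>\<^sub>w (\<omega> {i} \<and>\<^sub>w X)))"
    by (subst sum.swap) (simp add: mult.commute)
  also have "\<dots> = pullback \<zeta> q \<and>\<^sub>w (pullback \<eta> p \<and>\<^sub>w X)"
    by (rule pullback_wedge2[symmetric])
  finally show ?thesis .
qed

lemma eq_minus_self_imp_zero:
  fixes y :: "'a::real_vector"
  assumes "y = - y" shows "y = 0"
proof -
  have "y + y = 0" using assms by (simp only: eq_neg_iff_add_eq_0)
  then have "(2::real) *\<^sub>R y = 0" by (simp only: scaleR_2)
  then show ?thesis by simp
qed

lemma pullback_same: "pullback \<eta> p \<and>\<^sub>w (pullback \<eta> p \<and>\<^sub>w X) = 0"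
  by (rule eq_minus_self_imp_zero) (rule pullback_anticomm)

lemma linear_pullback: "linear (\<lambda>\<eta> :: 'n::{finite,linorder} hspace. pullback \<eta> p)"
proof (rule linearI)
  have \<tau>_add: "\<tau> (a + b) $ p $ s = \<tau> a $ p $ s + \<tau> b $ p $ s" for a b s
    by (simp add: \<tau>_def complex_eq_iff)
  have \<tau>_scale: "\<tau> (r *\<^sub>R a) $ p $ s = of_real r * \<tau> a $ p $ s" for a s and r :: real
    by (simp add: \<tau>_def complex_eq_iff)
  show "pullback (x + y) p = pullback x p + pullback y p" for x y :: "'n hspace"
    by (simp add: pullback_def \<tau>_add vector_sadd_rdistrib sum.distrib)
  show "pullback (r *\<^sub>R x) p = r *\<^sub>R pullback x p" for r and x :: "'n hspace"
    unfolding pullback_def scaleR_eq_smult smult_sum_right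
    by (simp add: \<tau>_scale vector_smult_assoc)
qed

lemma \<tau>_qmul: "\<tau> (qmul a b) $ p $ s = (\<Sum>r\<in>UNIV. \<tau> a $ p $ r * \<tau> b $ r $ s)"
proof -
  have "p = 0 \<or> p = 1" "s = 0 \<or> s = 1"
    using exhaust_2[of p] exhaust_2[of s] by auto
  then show ?thesis
    by (elim disjE) (simp_all add: sum_2 \<tau>_def qmul_def complex_eq_iff algebra_simps)
qed

lemma pullback_qmul:
  "pullback (\<chi> l. qmul q (\<eta> $ l)) p = (\<Sum>r\<in>UNIV. \<tau> q $ p $ r *s pullback \<eta> r)"
proof -
  have "pullback (\<chi> l. qmul q (\<eta> $ l)) p
     = (\<Sum>j\<in>UNIV. \<Sum>r\<in>UNIV. (\<tau> q $ p $ r * \<tau> (\<eta> $ fst j) $ r $ snd j) *s \<omega> {j})"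
    by (simp add: pullback_def \<tau>_qmul smult_sum_left)
  also have "\<dots> = (\<Sum>r\<in>UNIV. \<tau> q $ p $ r *s pullback \<eta> r)"
    by (subst sum.swap) (simp add: pullback_def smult_sum_right vector_smult_assoc)
  finally show ?thesis .
qed

section \<open>The one-forms that serve as symbols of \<open>ext_d\<close>\<close>

definition qcnj :: "quat \<Rightarrow> quat" where
  "qcnj q = vector [q $ 1, - (q $ 2), - (q $ 3), - (q $ 4)]"

definition hcnj :: "'n::finite hspace \<Rightarrow> 'n hspace" where
  "hcnj v = (\<chi> l. qcnj (v $ l))"

lemma linear_hcnj: "linear hcnj"
  by (rule linearI) (auto simp: hcnj_def qcnj_def vec_eq_iff forall_4)

text \<open>The symbol of \<open>ext_d \<alpha>\<close> in the real direction \<open>v\<close>. The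
  conjugate enters because in \<open>nabla\<close> with index \<open>(l, 0)\<close> and
  \<open>\<alpha> = 0\<close> the derivative along the quaternion \<open>i\<close> has coefficient
  \<open>+\<i>\<close>, whereas the corresponding entry of \<open>\<tau>\<close> is
  \<open>-\<i>\<close>.\<close>

abbreviation theta :: "2 \<Rightarrow> 'n::{finite,linorder} hspace \<Rightarrow> 'n ext" where
  "theta \<alpha> v \<equiv> pullback (hcnj v) \<alpha>"

lemma linear_theta: "linear (theta \<alpha>)"
  using linear_compose[OF linear_hcnj linear_pullback] by (simp add: o_def)

lemma sum_Basis_hspace:
  fixes G :: "'n::finite hspace \<Rightarrow> 'b::comm_monoid_add"
  shows "(\<Sum>a\<in>Basis. G a) = (\<Sum>l\<in>UNIV. \<Sum>m\<in>UNIV. G (axis l (axis m 1)))"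
proof -
  have B: "(Basis :: 'n hspace set) = (\<lambda>(l, m). axis l (axis m 1)) ` (UNIV \<times> UNIV)"
    by (auto simp: Basis_vec_def)
  have "inj (\<lambda>(l, m). axis l (axis m 1) :: 'n hspace)"
    by (auto simp: inj_on_def axis_eq_axis)
  then show ?thesis
    unfolding B by (simp add: sum.reindex sum.cartesian_product split_def)
qed

lemma ext_expand: "(\<Sum>I\<in>UNIV. (X $ I) *s \<omega> I) = (X :: 'n::{finite,linorder} ext)"
  unfolding \<omega>_def by (rule basis_expansion)

lemma \<tau>_0 [simp]: "\<tau> 0 = 0"
  by (simp add: \<tau>_def vec_eq_iff complex_eq_iff)

text \<open>For each choice of \<open>\<alpha>\<close> and of the parity of the index, the
  coefficients in \<open>nabla\<close> are one entry of \<open>\<tau>\<close> evaluated at the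
  conjugate quaternion units. This identifies the symbols of the differential operators with the
  pullbacks from which strong positivity is built.\<close>

lemma nabla_eq:
  fixes j :: "'n::{finite,linorder} idx"
  shows "nabla j \<alpha> f x = (\<Sum>a\<in>Basis. \<tau> (hcnj a $ fst j) $ \<alpha> $ snd j * dir_deriv a f x)"
proof -
  have "hcnj (axis l (axis m 1)) $ l' = (if l' = l then qcnj (axis m 1) else 0)" for l l' :: 'n and m
    by (auto simp: hcnj_def axis_def qcnj_def vec_eq_iff forall_4)
  then have inner: "(\<Sum>m\<in>UNIV. \<tau> (hcnj (axis l (axis m 1)) $ fst j) $ \<alpha> $ snd j * dir_deriv (axis l (axis m 1)) f x)
     = (if l = fst j then \<Sum>m\<in>UNIV. \<tau> (qcnj (axis m 1)) $ \<alpha> $ snd j * partial (fst j) m f x else 0)" for l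
    by (cases "l = fst j") (simp_all add: partial_def)
  have "(\<Sum>a\<in>Basis. \<tau> (hcnj a $ fst j) $ \<alpha> $ snd j * dir_deriv a f x)
      = (\<Sum>m\<in>UNIV. \<tau> (qcnj (axis m 1)) $ \<alpha> $ snd j * partial (fst j) m f x)"
    unfolding sum_Basis_hspace inner by simp
  also have "\<dots> = nabla j \<alpha> f x"
  proof -
    have "\<alpha> = 0 \<or> \<alpha> = 1" "snd j = 0 \<or> snd j = 1"
      using exhaust_2[of \<alpha>] exhaust_2[of "snd j"] by auto
    then show ?thesis
      by (elim disjE) (simp_all add: nabla_def sum_4 \<tau>_def qcnj_def axis_def complex_eq_iff Let_def)
  qed
  finally show ?thesis ..
qed

lemma bounded_linear_nth: "bounded_linear (\<lambda>X :: complex ^ 'k. X $ I)"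
  by (rule bounded_linear_vec_nth)

lemma ext_d_eq:
  assumes "F differentiable (at x)"
  shows "ext_d \<alpha> F x = (\<Sum>a\<in>Basis. theta \<alpha> a \<and>\<^sub>w dir_deriv a F x)"
proof -
  have D: "dir_deriv a (\<lambda>y. F y $ I) x = dir_deriv a F x $ I" for a I
    by (rule dir_deriv_linear_compose[OF bounded_linear_nth assms])
  let ?t = "\<lambda>a j. \<tau> (hcnj a $ fst j) $ \<alpha> $ snd j"
  have "ext_d \<alpha> F x
      = (\<Sum>j\<in>UNIV. \<Sum>I\<in>UNIV. \<Sum>a\<in>Basis. (?t a j * dir_deriv a F x $ I) *s (\<omega> {j} \<and>\<^sub>w \<omega> I))"
    unfolding ext_d_def nabla_eq D smult_sum_left ..
  also have "\<dots> = (\<Sum>j\<in>UNIV. \<Sum>a\<in>Basis. \<Sum>I\<in>UNIV. (?t a j * dir_deriv a F x $ I) *s (\<omega> {j} \<and>\<^sub>w \<omega> I))"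
    by (intro sum.cong refl sum.swap)
  also have "\<dots> = (\<Sum>a\<in>Basis. \<Sum>j\<in>UNIV. \<Sum>I\<in>UNIV. (?t a j * dir_deriv a F x $ I) *s (\<omega> {j} \<and>\<^sub>w \<omega> I))"
    by (rule sum.swap)
  also have "\<dots> = (\<Sum>a\<in>Basis. \<Sum>j\<in>UNIV. ?t a j *s (\<omega> {j} \<and>\<^sub>w (\<Sum>I\<in>UNIV. (dir_deriv a F x $ I) *s \<omega> I)))"
    by (simp add: wedge_sum_right wedge_smult_right smult_sum_right vector_smult_assoc)
  also have "\<dots> = (\<Sum>a\<in>Basis. theta \<alpha> a \<and>\<^sub>w dir_deriv a F x)"
    unfolding ext_expand pullback_wedge ..
  finally show ?thesis .
qed

section \<open>The operators \<open>ext_d\<close> and \<open>lap\<close> on test forms\<close>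

lemma dir_deriv_sum:
  assumes "\<And>i. i \<in> I \<Longrightarrow> f i differentiable (at x)"
  shows "dir_deriv v (\<lambda>x. \<Sum>i\<in>I. f i x) x = (\<Sum>i\<in>I. dir_deriv v (f i) x)"
  by (intro dir_deriv_eq has_derivative_sum has_derivative_dir_deriv assms)

lemma dir_deriv_scaleR_fun:
  assumes "f differentiable (at x)" "F differentiable (at x)"
  shows "dir_deriv v (\<lambda>x. f x *\<^sub>R F x) x = f x *\<^sub>R dir_deriv v F x + dir_deriv v f x *\<^sub>R F x"
  by (rule dir_deriv_bilinear[OF bounded_bilinear_scaleR assms])

lemma smooth_wedge: "smooth F \<Longrightarrow> smooth (\<lambda>x. a \<and>\<^sub>w F x)"
  by (rule smooth_linear_compose[OF bounded_linear_wedge])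

lemma dir_deriv_wedge:
  "F differentiable (at x) \<Longrightarrow> dir_deriv v (\<lambda>x. a \<and>\<^sub>w F x) x = a \<and>\<^sub>w dir_deriv v F x"
  by (rule dir_deriv_linear_compose[OF bounded_linear_wedge])

lemma ext_d_fun: "smooth F \<Longrightarrow> ext_d \<alpha> F = (\<lambda>x. \<Sum>a\<in>Basis. theta \<alpha> a \<and>\<^sub>w dir_deriv a F x)"
  by (intro ext ext_d_eq smooth_differentiable)

lemma smooth_ext_d: "smooth F \<Longrightarrow> smooth (ext_d \<alpha> F)"
  unfolding ext_d_fun by (intro smooth_sum smooth_wedge smooth_dir_deriv)

lemma smooth_lap: "smooth F \<Longrightarrow> smooth (lap F)"
  unfolding lap_def by (intro smooth_ext_d)

lemma ext_d_zero [simp]: "ext_d \<alpha> (\<lambda>x. 0) x = 0"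
  by (subst ext_d_eq) (simp_all add: dir_deriv_def)

lemma ext_d_ext_d:
  assumes "smooth F"
  shows "ext_d \<alpha> (ext_d \<beta> F) x =
    (\<Sum>a\<in>Basis. \<Sum>b\<in>Basis. theta \<alpha> a \<and>\<^sub>w (theta \<beta> b \<and>\<^sub>w dir_deriv a (dir_deriv b F) x))"
proof -
  have "dir_deriv a (ext_d \<beta> F) x = (\<Sum>b\<in>Basis. theta \<beta> b \<and>\<^sub>w dir_deriv a (dir_deriv b F) x)" for a
    unfolding ext_d_fun[OF assms]
    by (simp add: dir_deriv_sum dir_deriv_wedge smooth_differentiable smooth_wedge smooth_dir_deriv assms)
  then show ?thesis
    by (simp add: ext_d_eq smooth_differentiable smooth_ext_d assms wedge_sum_right)
qed

lemma lap_eq: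
  assumes "smooth F"
  shows "lap F x = (\<Sum>a\<in>Basis. \<Sum>b\<in>Basis. theta 0 a \<and>\<^sub>w (theta 1 b \<and>\<^sub>w dir_deriv a (dir_deriv b F) x))"
  unfolding lap_def by (rule ext_d_ext_d[OF assms])

lemma ext_d_anticomm:
  assumes "smooth F"
  shows "ext_d \<alpha> (ext_d \<beta> F) x = - ext_d \<beta> (ext_d \<alpha> F) x"
proof -
  have "ext_d \<alpha> (ext_d \<beta> F) x =
    (\<Sum>a\<in>Basis. \<Sum>b\<in>Basis. - (theta \<beta> b \<and>\<^sub>w (theta \<alpha> a \<and>\<^sub>w dir_deriv b (dir_deriv a F) x)))"
    unfolding ext_d_ext_d[OF assms]
    by (intro sum.cong refl) (subst pullback_anticomm, subst dir_deriv_commute[OF assms], simp)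
  also have "\<dots> = - (\<Sum>b\<in>Basis. \<Sum>a\<in>Basis. theta \<beta> b \<and>\<^sub>w (theta \<alpha> a \<and>\<^sub>w dir_deriv b (dir_deriv a F) x))"
    by (subst sum.swap) (simp add: sum_negf)
  finally show ?thesis unfolding ext_d_ext_d[OF assms] .
qed

lemma ext_d_square: "smooth F \<Longrightarrow> ext_d \<alpha> (ext_d \<alpha> F) x = 0"
  by (rule eq_minus_self_imp_zero) (rule ext_d_anticomm)

lemma lap_ext_d:
  assumes "smooth F" shows "lap (ext_d \<alpha> F) x = 0"
proof -
  have sq: "ext_d \<alpha> (ext_d \<alpha> F) = (\<lambda>x. 0)" for \<alpha>
    using ext_d_square[OF assms] by blast
  have "\<alpha> = 0 \<or> \<alpha> = 1" using exhaust_2[of \<alpha>] by auto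
  then show ?thesis
  proof
    assume "\<alpha> = 0"
    have "lap (ext_d \<alpha> F) x = - ext_d 1 (ext_d 0 (ext_d 0 F)) x"
      unfolding lap_def \<open>\<alpha> = 0\<close> by (rule ext_d_anticomm[OF smooth_ext_d[OF assms]])
    then show ?thesis by (simp add: sq)
  next
    assume "\<alpha> = 1"
    then show ?thesis by (simp add: lap_def sq)
  qed
qed

lemma ext_d_add:
  assumes "F differentiable (at x)" "G differentiable (at x)"
  shows "ext_d \<alpha> (\<lambda>x. F x + G x) x = ext_d \<alpha> F x + ext_d \<alpha> G x"
  using assms by (simp add: ext_d_eq dir_deriv_add wedge_add_right sum.distrib)

lemma ext_d_sum:
  assumes "\<And>i. i \<in> I \<Longrightarrow> F i differentiable (at x)"
  shows "ext_d \<alpha> (\<lambda>x. \<Sum>i\<in>I. F i x) x = (\<Sum>i\<in>I. ext_d \<alpha> (F i) x)"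
proof -
  have "ext_d \<alpha> (\<lambda>x. \<Sum>i\<in>I. F i x) x = (\<Sum>a\<in>Basis. \<Sum>i\<in>I. theta \<alpha> a \<and>\<^sub>w dir_deriv a (F i) x)"
    by (subst ext_d_eq, rule differentiableI[OF has_derivative_sum[OF has_derivative_dir_deriv[OF assms]]])
      (simp_all add: assms dir_deriv_sum wedge_sum_right)
  also have "\<dots> = (\<Sum>i\<in>I. \<Sum>a\<in>Basis. theta \<alpha> a \<and>\<^sub>w dir_deriv a (F i) x)"
    by (rule sum.swap)
  finally show ?thesis by (simp add: assms ext_d_eq)
qed

lemma ext_d_mult:
  assumes "smooth f" "smooth F"
  shows "ext_d \<alpha> (\<lambda>x. f x *\<^sub>R F x) x =
    (\<Sum>a\<in>Basis. dir_deriv a f x *\<^sub>R (theta \<alpha> a \<and>\<^sub>w F x)) + f x *\<^sub>R ext_d \<alpha> F x"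
proof -
  interpret bounded_bilinear "(\<and>\<^sub>w) :: 'a ext \<Rightarrow> 'a ext \<Rightarrow> 'a ext" by (rule bilinear_wedge)
  show ?thesis
    using assms
    by (simp add: ext_d_eq smooth_differentiable smooth_scaleR dir_deriv_scaleR_fun add_right scaleR_right
        sum.distrib scaleR_sum_right add.commute)
qed

text \<open>For \<open>H = hess g x\<close> this is the product of \<open>\<triangle>g\<close> at
  \<open>x\<close> with \<open>X\<close>. It is defined for an arbitrary \<open>H\<close>, on which
  it depends linearly, so that Hessians can be averaged and reduced to sums of squares.\<close>

definition hess_form :: "('n hspace \<Rightarrow> 'n hspace \<Rightarrow> real) \<Rightarrow> 'n::{finite,linorder} ext \<Rightarrow> 'n ext" where
  "hess_form H X = (\<Sum>a\<in>Basis. \<Sum>b\<in>Basis. H a b *\<^sub>R (theta 0 a \<and>\<^sub>w (theta 1 b \<and>\<^sub>w X)))"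

definition hess :: "('n::finite hspace \<Rightarrow> real) \<Rightarrow> 'n hspace \<Rightarrow> 'n hspace \<Rightarrow> 'n hspace \<Rightarrow> real" where
  "hess f x a b = dir_deriv a (dir_deriv b f) x"

text \<open>Apart from the Hessian term and \<open>f x *\<^sub>R lap F x\<close>, every term is
  exact, so a closed current annihilates it. The terms are distributed over the two sides without
  subtraction, which lets additivity of a current apply directly.\<close>

lemma lap_mult:
  fixes f :: "'n::{finite,linorder} hspace \<Rightarrow> real" and F :: "'n hspace \<Rightarrow> 'n ext"
  assumes f: "smooth f" and F: "smooth F"
  shows "hess_form (hess f x) (F x) + ext_d 0 (\<lambda>x. f x *\<^sub>R ext_d 1 F x) x
    = lap (\<lambda>x. f x *\<^sub>R F x) x + ext_d 1 (\<lambda>x. f x *\<^sub>R ext_d 0 F x) x + f x *\<^sub>R lap F x"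
proof -
  interpret w: bounded_bilinear "(\<and>\<^sub>w) :: 'n ext \<Rightarrow> 'n ext \<Rightarrow> 'n ext" by (rule bilinear_wedge)
  have sm: "smooth (\<lambda>x. dir_deriv b f x *\<^sub>R (theta 1 b \<and>\<^sub>w F x))" for b
    by (intro smooth_scaleR smooth_dir_deriv smooth_wedge f F)
  have "ext_d 1 (\<lambda>x. f x *\<^sub>R F x) = (\<lambda>x. (\<Sum>b\<in>Basis. dir_deriv b f x *\<^sub>R (theta 1 b \<and>\<^sub>w F x)) + f x *\<^sub>R ext_d 1 F x)"
    by (intro ext ext_d_mult f F)
  then have "lap (\<lambda>x. f x *\<^sub>R F x) x
     = ext_d 0 (\<lambda>x. (\<Sum>b\<in>Basis. dir_deriv b f x *\<^sub>R (theta 1 b \<and>\<^sub>w F x)) + f x *\<^sub>R ext_d 1 F x) x"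
    by (simp add: lap_def)
  also have "\<dots> = (\<Sum>b\<in>Basis. ext_d 0 (\<lambda>x. dir_deriv b f x *\<^sub>R (theta 1 b \<and>\<^sub>w F x)) x)
      + ext_d 0 (\<lambda>x. f x *\<^sub>R ext_d 1 F x) x"
  proof -
    have d: "(\<lambda>x. dir_deriv b f x *\<^sub>R (theta 1 b \<and>\<^sub>w F x)) differentiable (at x)" for b
      by (rule smooth_differentiable[OF sm])
    have d2: "(\<lambda>x. f x *\<^sub>R ext_d 1 F x) differentiable (at x)"
      by (intro smooth_differentiable smooth_scaleR smooth_ext_d f F)
    have d3: "(\<lambda>x. \<Sum>b\<in>Basis. dir_deriv b f x *\<^sub>R (theta 1 b \<and>\<^sub>w F x)) differentiable (at x)"
      by (intro smooth_differentiable smooth_sum sm)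
    show ?thesis
      by (simp only: ext_d_add[OF d3 d2] ext_d_sum[OF d])
  qed
  also have "(\<Sum>b\<in>Basis. ext_d 0 (\<lambda>x. dir_deriv b f x *\<^sub>R (theta 1 b \<and>\<^sub>w F x)) x)
      = hess_form (hess f x) (F x) - (\<Sum>b\<in>Basis. dir_deriv b f x *\<^sub>R (theta 1 b \<and>\<^sub>w ext_d 0 F x))"
  proof -
    have "ext_d 0 (\<lambda>x. theta 1 b \<and>\<^sub>w F x) x = - (theta 1 b \<and>\<^sub>w ext_d 0 F x)" for b
    proof -
      have "ext_d 0 (\<lambda>x. theta 1 b \<and>\<^sub>w F x) x = (\<Sum>a\<in>Basis. theta 0 a \<and>\<^sub>w (theta 1 b \<and>\<^sub>w dir_deriv a F x))"
        by (simp add: ext_d_eq smooth_differentiable smooth_wedge F dir_deriv_wedge)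
      also have "\<dots> = (\<Sum>a\<in>Basis. - (theta 1 b \<and>\<^sub>w (theta 0 a \<and>\<^sub>w dir_deriv a F x)))"
        by (intro sum.cong refl pullback_anticomm)
      also have "\<dots> = - (theta 1 b \<and>\<^sub>w ext_d 0 F x)"
        by (simp add: ext_d_eq smooth_differentiable F wedge_sum_right sum_negf)
      finally show ?thesis .
    qed
    then have "ext_d 0 (\<lambda>x. dir_deriv b f x *\<^sub>R (theta 1 b \<and>\<^sub>w F x)) x
       = (\<Sum>a\<in>Basis. hess f x a b *\<^sub>R (theta 0 a \<and>\<^sub>w (theta 1 b \<and>\<^sub>w F x)))
         - dir_deriv b f x *\<^sub>R (theta 1 b \<and>\<^sub>w ext_d 0 F x)" for b
      by (subst ext_d_mult) (simp_all add: smooth_dir_deriv smooth_wedge f F hess_def)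
    then show ?thesis
      by (simp add: hess_form_def sum_subtractf) (rule sum.swap)
  qed
  also have "(\<Sum>b\<in>Basis. dir_deriv b f x *\<^sub>R (theta 1 b \<and>\<^sub>w ext_d 0 F x))
     = ext_d 1 (\<lambda>x. f x *\<^sub>R ext_d 0 F x) x - f x *\<^sub>R ext_d 1 (ext_d 0 F) x"
    by (simp add: ext_d_mult f F smooth_ext_d)
  also have "ext_d 1 (ext_d 0 F) x = - lap F x"
    unfolding lap_def by (rule ext_d_anticomm[OF F])
  finally show ?thesis by simp
qed

lemma ext_power_sum: "(\<And>i. i \<in> I \<Longrightarrow> f i \<in> ext_power m) \<Longrightarrow> (\<Sum>i\<in>I. f i) \<in> ext_power m"
  unfolding ext_power_def by (auto, metis (mono_tags, lifting) sum.neutral)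

lemma ext_power_zero [simp]: "0 \<in> ext_power m"
  by (simp add: ext_power_def)

lemma ext_power_add: "X \<in> ext_power m \<Longrightarrow> Y \<in> ext_power m \<Longrightarrow> X + Y \<in> ext_power m"
  unfolding ext_power_def by (clarsimp, metis add.right_neutral)

lemma ext_power_smult: "X \<in> ext_power m \<Longrightarrow> c *s X \<in> ext_power m"
  by (auto simp: ext_power_def)

lemma ext_power_scaleR: "X \<in> ext_power m \<Longrightarrow> c *\<^sub>R X \<in> ext_power m"
  by (auto simp: ext_power_def)

lemma ext_power_wedge_basis:
  assumes "X \<in> ext_power m" shows "\<omega> {j} \<and>\<^sub>w X \<in> ext_power (Suc m)"
proof -
  have "card I = Suc m" if "(\<omega> {j} \<and>\<^sub>w X) $ I \<noteq> 0" for I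
  proof -
    have I: "j \<in> I" "X $ (I - {j}) \<noteq> 0"
      using that by (auto simp: wedge_basis_nth split: if_splits)
    then have "card (I - {j}) = m" using assms by (simp add: ext_power_def)
    then show ?thesis using I(1) by (metis card_Suc_Diff1 finite)
  qed
  then show ?thesis by (simp add: ext_power_def)
qed

lemma ext_power_pullback: "X \<in> ext_power m \<Longrightarrow> pullback \<eta> p \<and>\<^sub>w X \<in> ext_power (Suc m)"
  unfolding pullback_wedge by (intro ext_power_sum ext_power_smult ext_power_wedge_basis)

lemma ext_power_dir_deriv:
  fixes F :: "'n::{finite,linorder} hspace \<Rightarrow> 'n ext"
  assumes "\<And>x. F x \<in> ext_power m" "F differentiable (at x)"
  shows "dir_deriv a F x \<in> ext_power m"
proof -
  have "dir_deriv a F x $ I = 0" if "card I \<noteq> m" for I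
  proof -
    have "F y $ I = 0" for y using assms(1)[of y] that by (auto simp: ext_power_def)
    then have "dir_deriv a (\<lambda>y. F y $ I) x = 0" by (simp add: dir_deriv_def)
    then show ?thesis using dir_deriv_linear_compose[OF bounded_linear_nth assms(2), of a I] by simp
  qed
  then show ?thesis by (auto simp: ext_power_def)
qed

lemma dir_deriv_outside:
  assumes "closed K" "\<And>x. x \<notin> K \<Longrightarrow> F x = 0" "x \<notin> K" shows "dir_deriv a F x = 0"
proof -
  have "((\<lambda>_. 0) has_derivative (\<lambda>_. 0)) (at x)" by simp
  then have "(F has_derivative (\<lambda>_. 0)) (at x)"
    by (rule has_derivative_transform_within_open[where s = "- K"])
      (use assms in \<open>auto simp: open_Compl\<close>)
  then show ?thesis by (rule dir_deriv_eq)
qed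

lemma test_formsD:
  assumes "\<phi> \<in> test_forms \<Omega> m"
  shows "smooth \<phi>" "\<phi> x \<in> ext_power m"
    "\<exists>K. compact K \<and> K \<subseteq> \<Omega> \<and> (\<forall>x. x \<notin> K \<longrightarrow> \<phi> x = 0)"
  using assms by (auto simp: test_forms_def)

lemma test_formsI:
  assumes "smooth \<phi>" "\<And>x. \<phi> x \<in> ext_power m" "compact K" "K \<subseteq> \<Omega>" "\<And>x. x \<notin> K \<Longrightarrow> \<phi> x = 0"
  shows "\<phi> \<in> test_forms \<Omega> m"
  using assms by (auto simp: test_forms_def)

lemma ext_d_outside:
  assumes "smooth F" "closed K" "\<And>x. x \<notin> K \<Longrightarrow> F x = 0" "x \<notin> K" shows "ext_d \<alpha> F x = 0"
  using assms by (simp add: ext_d_fun dir_deriv_outside)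

lemma test_forms_ext_d:
  fixes \<Omega> :: "'n::{finite,linorder} hspace set"
  assumes "\<phi> \<in> test_forms \<Omega> m" shows "ext_d \<alpha> \<phi> \<in> test_forms \<Omega> (Suc m)"
proof -
  obtain K where K: "compact K" "K \<subseteq> \<Omega>" "\<And>x. x \<notin> K \<Longrightarrow> \<phi> x = 0"
    using test_formsD(3)[OF assms] by auto
  note s = test_formsD(1)[OF assms]
  show ?thesis
  proof (rule test_formsI[OF smooth_ext_d[OF s] _ K(1,2)])
    show "ext_d \<alpha> \<phi> x \<in> ext_power (Suc m)" for x
      unfolding ext_d_fun[OF s]
      by (intro ext_power_sum ext_power_pullback ext_power_dir_deriv smooth_differentiable s test_formsD(2)[OF assms])
    show "ext_d \<alpha> \<phi> x = 0" if "x \<notin> K" for x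
      by (rule ext_d_outside[OF s compact_imp_closed[OF K(1)] K(3) that])
  qed
qed

lemma test_forms_lap: "\<phi> \<in> test_forms \<Omega> m \<Longrightarrow> lap \<phi> \<in> test_forms \<Omega> (Suc (Suc m))"
  unfolding lap_def by (intro test_forms_ext_d)

lemma test_forms_mult:
  assumes "smooth f" "\<phi> \<in> test_forms \<Omega> m" shows "(\<lambda>x. f x *\<^sub>R \<phi> x) \<in> test_forms \<Omega> m"
proof -
  obtain K where K: "compact K" "K \<subseteq> \<Omega>" "\<And>x. x \<notin> K \<Longrightarrow> \<phi> x = 0"
    using test_formsD(3)[OF assms(2)] by auto
  show ?thesis
    by (rule test_formsI[OF _ _ K(1,2)])
      (auto intro!: smooth_scaleR assms(1) test_formsD[OF assms(2)] ext_power_scaleR simp: K(3))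
qed

lemma test_forms_add:
  assumes "\<phi> \<in> test_forms \<Omega> m" "\<psi> \<in> test_forms \<Omega> m" shows "(\<lambda>x. \<phi> x + \<psi> x) \<in> test_forms \<Omega> m"
proof -
  obtain K where K: "compact K" "K \<subseteq> \<Omega>" "\<And>x. x \<notin> K \<Longrightarrow> \<phi> x = 0"
    using test_formsD(3)[OF assms(1)] by auto
  obtain L where L: "compact L" "L \<subseteq> \<Omega>" "\<And>x. x \<notin> L \<Longrightarrow> \<psi> x = 0"
    using test_formsD(3)[OF assms(2)] by auto
  show ?thesis
  proof (rule test_formsI)
    show "compact (K \<union> L)" "K \<union> L \<subseteq> \<Omega>" using K L by auto
  qed (auto intro!: smooth_add test_formsD[OF assms(1)] test_formsD[OF assms(2)] ext_power_add simp: K(3) L(3))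
qed

lemma smooth_smult: "smooth F \<Longrightarrow> smooth (\<lambda>x. c *s (F x :: complex ^ 'k))"
proof -
  have "bounded_linear (\<lambda>X :: complex ^ 'k. c *s X)"
    unfolding linear_conv_bounded_linear[symmetric]
    by (rule linearI) (simp_all add: vector_add_ldistrib scaleR_eq_smult vector_smult_assoc mult.commute)
  then show "smooth F \<Longrightarrow> smooth (\<lambda>x. c *s (F x :: complex ^ 'k))" by (rule smooth_linear_compose)
qed

lemma test_forms_smult:
  assumes "\<phi> \<in> test_forms \<Omega> m" shows "(\<lambda>x. c *s \<phi> x) \<in> test_forms \<Omega> m"
proof -
  obtain K where K: "compact K" "K \<subseteq> \<Omega>" "\<And>x. x \<notin> K \<Longrightarrow> \<phi> x = 0"
    using test_formsD(3)[OF assms] by auto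
  show ?thesis
    by (rule test_formsI[OF _ _ K(1,2)])
      (auto intro!: smooth_smult test_formsD[OF assms] ext_power_smult simp: K(3))
qed

lemma test_forms_hess_form:
  fixes \<Omega> :: "'n::{finite,linorder} hspace set"
  assumes f: "smooth f" and "\<phi> \<in> test_forms \<Omega> m"
  shows "(\<lambda>x. hess_form (hess f x) (\<phi> x)) \<in> test_forms \<Omega> (Suc (Suc m))"
proof -
  obtain K where K: "compact K" "K \<subseteq> \<Omega>" "\<And>x. x \<notin> K \<Longrightarrow> \<phi> x = 0"
    using test_formsD(3)[OF assms(2)] by auto
  show ?thesis
  proof (rule test_formsI[OF _ _ K(1,2)])
    show "smooth (\<lambda>x. hess_form (hess f x) (\<phi> x))"
      unfolding hess_form_def hess_def
      by (intro smooth_sum smooth_scaleR smooth_wedge smooth_dir_deriv f test_formsD(1)[OF assms(2)])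
    show "hess_form (hess f x) (\<phi> x) \<in> ext_power (Suc (Suc m))" for x
      unfolding hess_form_def
      by (intro ext_power_sum ext_power_scaleR ext_power_pullback test_formsD(2)[OF assms(2)])
    show "hess_form (hess f x) (\<phi> x) = 0" if "x \<notin> K" for x
      using K(3)[OF that] by (simp add: hess_form_def)
  qed
qed

section \<open>Linearity of currents and integration by parts\<close>

lemma current_add:
  assumes "current \<Omega> p (T :: 'n::{finite,linorder} functional)" "p + m = 2 * CARD('n)"
    "\<phi> \<in> test_forms \<Omega> m" "\<psi> \<in> test_forms \<Omega> m"
  shows "T (\<lambda>x. \<phi> x + \<psi> x) = T \<phi> + T \<psi>"
proof -
  have "2 * CARD('n) - p = m" using assms(2) by simp
  then show ?thesis using assms by (simp add: current_def Let_def)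
qed

lemma current_smult:
  assumes "current \<Omega> p (T :: 'n::{finite,linorder} functional)" "p + m = 2 * CARD('n)" "\<phi> \<in> test_forms \<Omega> m"
  shows "T (\<lambda>x. c *s \<phi> x) = c * T \<phi>"
proof -
  have "2 * CARD('n) - p = m" using assms(2) by simp
  then show ?thesis using assms by (simp add: current_def Let_def)
qed

lemma closed_currentD:
  assumes "closed_current \<Omega> p (T :: 'n::{finite,linorder} functional)" "p + Suc m = 2 * CARD('n)"
    "\<phi> \<in> test_forms \<Omega> m"
  shows "T (ext_d \<alpha> \<phi>) = 0"
proof -
  have "d_current \<alpha> T \<phi> = 0"
    using assms unfolding closed_current_def by auto
  then show ?thesis by (simp add: d_current_def)
qed

text \<open>Integration by parts: for smooth \<open>f\<close> this is \<open>\<triangle>(f T) = \<triangle>f \<and> T\<close>.\<close>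

lemma current_mult_lap:
  fixes T :: "'n::{finite,linorder} functional"
  assumes T: "current \<Omega> p T" "closed_current \<Omega> p T" and p: "p + Suc (Suc m) = 2 * CARD('n)"
    and f: "smooth f" and \<phi>: "\<phi> \<in> test_forms \<Omega> m"
  shows "T (\<lambda>x. f x *\<^sub>R lap \<phi> x) = T (\<lambda>x. hess_form (hess f x) (\<phi> x))"
proof -
  note s = test_formsD(1)[OF \<phi>]
  note d = test_forms_ext_d[OF \<phi>]
  note fd = test_forms_mult[OF f d]
  note ad = current_add[OF T(1) p]
  have L: "lap (\<lambda>x. f x *\<^sub>R \<phi> x) \<in> test_forms \<Omega> (Suc (Suc m))"
    by (intro test_forms_lap test_forms_mult f \<phi>)
  have D: "(\<lambda>x. f x *\<^sub>R lap \<phi> x) \<in> test_forms \<Omega> (Suc (Suc m))"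
    by (intro test_forms_lap test_forms_mult f \<phi>)
  note H = test_forms_hess_form[OF f \<phi>]
  have LC: "(\<lambda>x. lap (\<lambda>x. f x *\<^sub>R \<phi> x) x + ext_d 1 (\<lambda>x. f x *\<^sub>R ext_d 0 \<phi> x) x) \<in> test_forms \<Omega> (Suc (Suc m))"
    by (intro test_forms_add L test_forms_ext_d fd)
  have "T (\<lambda>x. hess_form (hess f x) (\<phi> x)) + T (ext_d 0 (\<lambda>x. f x *\<^sub>R ext_d 1 \<phi> x))
     = T (\<lambda>x. hess_form (hess f x) (\<phi> x) + ext_d 0 (\<lambda>x. f x *\<^sub>R ext_d 1 \<phi> x) x)"
    by (rule ad[OF H test_forms_ext_d[OF fd], symmetric])
  also have "\<dots> = T (\<lambda>x. lap (\<lambda>x. f x *\<^sub>R \<phi> x) x + ext_d 1 (\<lambda>x. f x *\<^sub>R ext_d 0 \<phi> x) x + f x *\<^sub>R lap \<phi> x)"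
    by (simp only: lap_mult[OF f s])
  also have "\<dots> = T (lap (\<lambda>x. f x *\<^sub>R \<phi> x)) + T (ext_d 1 (\<lambda>x. f x *\<^sub>R ext_d 0 \<phi> x)) + T (\<lambda>x. f x *\<^sub>R lap \<phi> x)"
    by (simp only: ad[OF LC D] ad[OF L test_forms_ext_d[OF fd]])
  also have "T (lap (\<lambda>x. f x *\<^sub>R \<phi> x)) = 0"
    unfolding lap_def using p
    by (intro closed_currentD[OF T(2), where m = "Suc m"] test_forms_ext_d test_forms_mult f \<phi>) simp
  also have "T (ext_d 1 (\<lambda>x. f x *\<^sub>R ext_d 0 \<phi> x)) = 0"
    using p by (intro closed_currentD[OF T(2), where m = "Suc m"] fd) simp
  finally show ?thesis
    using closed_currentD[OF T(2), where m = "Suc m", OF _ fd, of 0 1] p by simp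
qed

section \<open>Strongly positive forms\<close>

abbreviation elem :: "'n::{finite,linorder} hspace list \<Rightarrow> 'n ext" where
  "elem \<eta>s \<equiv> foldr (\<lambda>\<eta> a. pullback \<eta> 0 \<and>\<^sub>w pullback \<eta> 1 \<and>\<^sub>w a) \<eta>s (\<omega> {})"

text \<open>A one-form passes a pair of pullbacks with two sign changes, hence none; it moves on
  until it meets its own pair and squares to zero.\<close>

lemma pullback_elem_member:
  assumes "\<eta> \<in> set \<eta>s" shows "pullback \<eta> p \<and>\<^sub>w elem \<eta>s = 0"
  using assms
proof (induction \<eta>s)
  case (Cons \<zeta> \<eta>s)
  let ?Y = "elem \<eta>s"
  have *: "pullback \<eta> p \<and>\<^sub>w (pullback \<zeta> 0 \<and>\<^sub>w (pullback \<zeta> 1 \<and>\<^sub>w ?Y))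
     = pullback \<zeta> 0 \<and>\<^sub>w (pullback \<zeta> 1 \<and>\<^sub>w (pullback \<eta> p \<and>\<^sub>w ?Y))"
    by (simp only: pullback_anticomm[of \<eta> p \<zeta>] wedge_minus minus_minus)
  show ?case
  proof (cases "\<eta> \<in> set \<eta>s")
    case True
    then show ?thesis using Cons.IH * by simp
  next
    case False
    then have \<eta>: "\<eta> = \<zeta>" using Cons.prems by simp
    have "p = 0 \<or> p = 1" using exhaust_2[of p] by auto
    then show ?thesis
    proof
      assume "p = 0"
      then show ?thesis by (simp add: \<eta> pullback_same)
    next
      assume "p = 1"
      then show ?thesis using * by (simp add: \<eta> pullback_same)
    qed
  qed
qed simp

text \<open>By \<open>pullback_qmul\<close> a left multiple of a row only mixes its two pullbacks,
  so a quaternionic combination of the rows pulls back to a complex combination of one-forms that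
  already occur in the product.\<close>

lemma pullback_elem_combination:
  assumes "\<And>l. \<eta> $ l = (\<Sum>i<length \<eta>s. qmul (c i) (\<eta>s ! i $ l))"
  shows "pullback \<eta> p \<and>\<^sub>w elem \<eta>s = 0"
proof -
  have "\<eta> = (\<Sum>i<length \<eta>s. \<chi> l. qmul (c i) (\<eta>s ! i $ l))"
    using assms by (simp add: vec_eq_iff)
  then have "pullback \<eta> p = (\<Sum>i<length \<eta>s. pullback (\<chi> l. qmul (c i) (\<eta>s ! i $ l)) p)"
    by (simp only: linear_sum[OF linear_pullback])
  also have "\<dots> = (\<Sum>i<length \<eta>s. \<Sum>r\<in>UNIV. \<tau> (c i) $ p $ r *s pullback (\<eta>s ! i) r)"
    by (simp only: pullback_qmul)
  finally show ?thesis
    by (simp add: wedge_sum_left wedge_smult_left pullback_elem_member)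
qed

lemma bilinear_qmul: "bounded_bilinear qmul"
  unfolding bilinear_conv_bounded_bilinear[symmetric] bilinear_def
  by (auto intro!: linearI simp: qmul_def vec_eq_iff forall_4 algebra_simps)

lemma qmul_assoc: "qmul (qmul a b) c = qmul a (qmul b c)"
  by (simp add: qmul_def vec_eq_iff forall_4 algebra_simps)

lemma inner_quat: "(a :: quat) \<bullet> b = a $ 1 * b $ 1 + a $ 2 * b $ 2 + a $ 3 * b $ 3 + a $ 4 * b $ 4"
  by (simp add: inner_vec_def sum_4)

lemma qmul_qcnj: "qmul (qmul (qcnj a) a) b = (a \<bullet> a) *\<^sub>R b"
  by (simp add: qmul_def qcnj_def inner_quat vec_eq_iff forall_4 algebra_simps)

text \<open>Elementary elements require independent rows. If adding a row destroys independence,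
  that row is a combination of the others and the product vanishes, so multiplication by the pair of
  an arbitrary row still lands in the cone.\<close>

lemma elem_dependent:
  assumes ind: "left_independent \<eta>s" and dep: "\<not> left_independent (\<eta> # \<eta>s)"
  shows "pullback \<eta> p \<and>\<^sub>w elem \<eta>s = 0"
proof -
  interpret q: bounded_bilinear qmul by (rule bilinear_qmul)
  obtain c i where c: "\<And>l. (\<Sum>i<Suc (length \<eta>s). qmul (c i) ((\<eta> # \<eta>s) ! i $ l)) = 0"
    and i: "i < Suc (length \<eta>s)" "c i \<noteq> 0"
    using dep unfolding left_independent_def by auto
  have c': "qmul (c 0) (\<eta> $ l) + (\<Sum>i<length \<eta>s. qmul (c (Suc i)) (\<eta>s ! i $ l)) = 0" for l
    using c[of l] by (simp add: sum.lessThan_Suc_shift del: sum.lessThan_Suc)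
  have c0: "c 0 \<noteq> 0"
  proof
    assume "c 0 = 0"
    then have "\<forall>l. (\<Sum>i<length \<eta>s. qmul (c (Suc i)) (\<eta>s ! i $ l)) = 0"
      using c' by (simp add: q.zero_left)
    then have "\<forall>i<length \<eta>s. c (Suc i) = 0"
      using ind[unfolded left_independent_def, rule_format, of "\<lambda>i. c (Suc i)"] by blast
    then show False using i \<open>c 0 = 0\<close> by (cases i) auto
  qed
  \<comment> \<open>The relation is solved for \<open>\<eta>\<close>: \<open>d i\<close> is minus
    the inverse of \<open>c 0\<close> times \<open>c (Suc i)\<close>, the inverse being the
    conjugate divided by the squared norm.\<close>
  define d where "d i = - ((1 / (c 0 \<bullet> c 0)) *\<^sub>R qmul (qcnj (c 0)) (c (Suc i)))" for i
  have "\<eta> $ l = (\<Sum>i<length \<eta>s. qmul (d i) (\<eta>s ! i $ l))" for l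
  proof -
    let ?S = "\<Sum>i<length \<eta>s. qmul (c (Suc i)) (\<eta>s ! i $ l)"
    have "qmul (c 0) (\<eta> $ l) = - ?S"
      using c'[of l] by (simp add: eq_neg_iff_add_eq_0)
    then have "(c 0 \<bullet> c 0) *\<^sub>R (\<eta> $ l) = qmul (qcnj (c 0)) (- ?S)"
      using qmul_qcnj[of "c 0" "\<eta> $ l"] by (simp add: qmul_assoc)
    moreover have "c 0 \<bullet> c 0 \<noteq> 0" using c0 by simp
    ultimately have "\<eta> $ l = (1 / (c 0 \<bullet> c 0)) *\<^sub>R qmul (qcnj (c 0)) (- ?S)"
      by (metis divide_self_if eq_vector_fraction_iff scaleR_one vector_fraction_eq_iff)
    also have "\<dots> = (\<Sum>i<length \<eta>s. qmul (d i) (\<eta>s ! i $ l))"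
      unfolding d_def
      by (simp add: q.minus_right q.minus_left q.sum_right q.scaleR_left qmul_assoc scaleR_sum_right sum_negf)
    finally show ?thesis .
  qed
  then show ?thesis by (rule pullback_elem_combination)
qed

lemma SP_zero: "0 \<in> SP k"
  by (simp add: SP_def convex_cone_hull_contains_0)

lemma SP_scaleR: "X \<in> SP k \<Longrightarrow> 0 \<le> c \<Longrightarrow> c *\<^sub>R X \<in> SP k"
  by (simp add: SP_def convex_cone_hull_mul)

lemma SP_add: "X \<in> SP k \<Longrightarrow> Y \<in> SP k \<Longrightarrow> X + Y \<in> SP k"
  by (simp add: SP_def convex_cone_hull_add)

lemma SP_pullback:
  fixes X :: "'n::{finite,linorder} ext"
  assumes "X \<in> SP k"
  shows "pullback \<eta> 0 \<and>\<^sub>w (pullback \<eta> 1 \<and>\<^sub>w X) \<in> SP (Suc k)"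
proof -
  let ?E = "\<lambda>X :: 'n ext. pullback \<eta> 0 \<and>\<^sub>w (pullback \<eta> 1 \<and>\<^sub>w X)"
  \<comment> \<open>The preimage of a convex cone under a linear map is a convex cone, so it is
    enough to treat generators.\<close>
  have "SP k \<subseteq> {X. ?E X \<in> SP (Suc k)}"
    unfolding SP_def[of k]
  proof (rule hull_minimal)
    show "elementary_SP k \<subseteq> {X. ?E X \<in> SP (Suc k)}"
    proof clarify
      fix X :: "'n ext" assume "X \<in> elementary_SP k"
      then obtain \<eta>s where \<eta>s: "X = elem \<eta>s" "length \<eta>s = k" "left_independent \<eta>s"
        by (auto simp: elementary_SP_def)
      show "?E X \<in> SP (Suc k)"
      proof (cases "left_independent (\<eta> # \<eta>s)")
        case True
        then have "elem (\<eta> # \<eta>s) \<in> elementary_SP (Suc k)"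
          unfolding elementary_SP_def using \<eta>s(2) by (intro CollectI exI[of _ "\<eta> # \<eta>s"]) simp
        then show ?thesis
          using \<eta>s(1) by (simp add: SP_def hull_inc)
      next
        case False
        then show ?thesis
          using elem_dependent[OF \<eta>s(3) False] \<eta>s(1) by (simp add: SP_def convex_cone_hull_contains_0)
      qed
    qed
    show "convex_cone {X. ?E X \<in> SP (Suc k)}"
      unfolding convex_cone_iff
      by (auto simp: SP_zero wedge_add_right SP_add bounded_bilinear.scaleR_right[OF bilinear_wedge] SP_scaleR)
  qed
  then show ?thesis using assms by auto
qed

lemma SP_sum_list: "(\<And>v. v \<in> set vs \<Longrightarrow> f v \<in> SP k) \<Longrightarrow> (\<Sum>v\<leftarrow>vs. f v) \<in> SP k"
  by (induction vs) (simp_all add: SP_def convex_cone_hull_contains_0 convex_cone_hull_add)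

lemma elem_ext_power: "elem \<eta>s \<in> ext_power (2 * length \<eta>s)"
proof (induction \<eta>s)
  case Nil
  then show ?case by (simp add: ext_power_def \<omega>_def axis_def)
qed (simp add: ext_power_pullback)

lemma SP_ext_power: "SP k \<subseteq> ext_power (2 * k)"
  unfolding SP_def
proof (rule hull_minimal)
  show "elementary_SP k \<subseteq> ext_power (2 * k)"
    using elem_ext_power by (auto simp: elementary_SP_def)
  show "convex_cone (ext_power (2 * k) :: 'a ext set)"
    unfolding convex_cone_iff by (simp add: ext_power_add ext_power_scaleR)
qed

text \<open>Lagrange reduction of a positive semidefinite quadratic form to a sum of squares.\<close>

lemma psd_sum_of_squares:
  fixes H :: "'a::euclidean_space \<Rightarrow> 'a \<Rightarrow> real"
  assumes "finite B" "B \<subseteq> Basis" "\<And>y. linear (\<lambda>x. H x y)" "\<And>x y. H x y = H y x" "\<And>x. 0 \<le> H x x"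
    "\<And>e y. e \<in> Basis - B \<Longrightarrow> H e y = 0"
  shows "\<exists>vs. \<forall>x y. H x y = (\<Sum>v\<leftarrow>vs. (v \<bullet> x) * (v \<bullet> y))"
  using assms
\<comment> \<open>\<open>B\<close> contains the basis vectors that may still lie outside the kernel
  of \<open>H\<close>; each round moves one of them into the kernel.\<close>
proof (induction B arbitrary: H rule: finite_induct)
  case empty
  have "H x y = 0" for x y
  proof -
    have "H x y = H (\<Sum>e\<in>Basis. (x \<bullet> e) *\<^sub>R e) y" by (simp add: euclidean_representation)
    also have "\<dots> = (\<Sum>e\<in>Basis. (x \<bullet> e) *\<^sub>R H e y)"
      by (simp only: linear_sum[OF empty(2)] linear_scale[OF empty(2)])
    finally show ?thesis using empty(5) by simp
  qed
  then show ?case by (intro exI[of _ "[]"]) simp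
next
  case (insert e B)
  note lin = insert(5) and sym = insert(6) and psd = insert(7) and ker = insert(8)
  have add: "H (x + y) z = H x z + H y z" and scale: "H (c *\<^sub>R x) z = c * H x z" for x y z c
    using linear_add[OF lin] linear_scale[OF lin] by auto
  have add': "H z (x + y) = H z x + H z y" and scale': "H z (c *\<^sub>R x) = c * H z x" for x y z c
    using add scale sym by metis+
  show ?case
  proof (cases "H e e = 0")
    case True
    have zero: "H e y = 0" for y
    proof -
      have "0 \<le> H y y + 2 * t * H e y" for t
      proof -
        have "H (y + t *\<^sub>R e) (y + t *\<^sub>R e) = H y y + 2 * t * H e y"
          using True by (simp add: add scale add' scale' sym[of y e])
        then show ?thesis using psd[of "y + t *\<^sub>R e"] by simp
      qed
      \<comment> \<open>For this value of \<open>t\<close> the nonnegative expression would equal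
        \<open>-1\<close> if \<open>H e y\<close> were nonzero.\<close>
      from this[of "- (H y y + 1) / (2 * H e y)"] show ?thesis
        by (cases "H e y = 0") (simp_all add: field_simps)
    qed
    show ?thesis
      using insert(4) zero ker by (intro insert.IH lin sym psd) auto
  next
    case False
    define c where "c = H e e"
    have c: "c > 0" using psd[of e] False by (simp add: c_def)
    \<comment> \<open>Subtracting the square of \<open>\<lambda>x. H x e / sqrt c\<close> puts
      \<open>e\<close> into the kernel; nonnegativity survives because \<open>H' x x\<close> is the
      minimum of the quadratic form on the line \<open>x + t e\<close>.\<close>
    define H' where "H' x y = H x y - H x e * H y e / c" for x y
    have lin': "linear (\<lambda>x. H' x y)" for y
      by (rule linearI) (simp_all add: H'_def add scale algebra_simps add_divide_distrib)
    have sym': "H' x y = H' y x" for x y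
      by (simp add: H'_def sym[of x y])
    have psd': "0 \<le> H' x x" for x
    proof -
      define t where "t = - H x e / c"
      have "H (x + t *\<^sub>R e) (x + t *\<^sub>R e) = H x x + 2 * t * H x e + t\<^sup>2 * c"
        by (simp add: add scale add' scale' sym[of e x] c_def power2_eq_square algebra_simps)
      also have "\<dots> = H' x x"
        unfolding t_def H'_def using c by (simp add: field_simps power2_eq_square)
      finally show ?thesis using psd[of "x + t *\<^sub>R e"] by simp
    qed
    have ker': "H' a y = 0" if "a \<in> Basis - B" for a y
    proof (cases "a = e")
      case True
      then show ?thesis using c by (simp add: H'_def c_def[symmetric] sym[of e y])
    next
      case F: False
      then have "H a y = 0" for y using that ker by auto
      then show ?thesis by (simp add: H'_def)
    qed
    obtain vs where vs: "\<And>x y. H' x y = (\<Sum>v\<leftarrow>vs. (v \<bullet> x) * (v \<bullet> y))"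
      using insert.IH[OF _ lin' sym' psd' ker'] insert(4) by auto
    define w where "w = (\<Sum>b\<in>Basis. (H b e / sqrt c) *\<^sub>R b)"
    have w: "w \<bullet> x = H x e / sqrt c" for x
    proof -
      have "H x e = H (\<Sum>b\<in>Basis. (x \<bullet> b) *\<^sub>R b) e" by (simp add: euclidean_representation)
      also have "\<dots> = (\<Sum>b\<in>Basis. (x \<bullet> b) * H b e)"
        by (simp add: linear_sum[OF lin] linear_scale[OF lin])
      finally show ?thesis
        unfolding w_def inner_sum_left inner_scaleR_left by (simp add: sum_divide_distrib inner_commute mult.commute)
    qed
    have "H x y = (\<Sum>v\<leftarrow>w # vs. (v \<bullet> x) * (v \<bullet> y))" for x y
      using c vs[of x y] by (simp add: w H'_def)
    then show ?thesis by blast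
  qed
qed

lemma bounded_linear_theta_wedge: "bounded_linear (\<lambda>v. theta \<alpha> v \<and>\<^sub>w X)"
  by (rule bounded_linear_compose[OF bounded_bilinear.bounded_linear_left[OF bilinear_wedge]
      linear_theta[unfolded linear_conv_bounded_linear]])

lemma theta_expand: "(\<Sum>a\<in>Basis. (v \<bullet> a) *\<^sub>R (theta \<alpha> a \<and>\<^sub>w X)) = theta \<alpha> v \<and>\<^sub>w X"
proof -
  interpret bounded_linear "\<lambda>v. theta \<alpha> v \<and>\<^sub>w X" by (rule bounded_linear_theta_wedge)
  have "theta \<alpha> v \<and>\<^sub>w X = theta \<alpha> (\<Sum>a\<in>Basis. (v \<bullet> a) *\<^sub>R a) \<and>\<^sub>w X"
    by (simp add: euclidean_representation)
  then show ?thesis by (simp only: sum scaleR)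
qed

lemma theta_expand2:
  "(\<Sum>a\<in>Basis. \<Sum>b\<in>Basis. ((v \<bullet> a) * (w \<bullet> b)) *\<^sub>R (theta \<alpha> a \<and>\<^sub>w (theta \<beta> b \<and>\<^sub>w X)))
    = theta \<alpha> v \<and>\<^sub>w (theta \<beta> w \<and>\<^sub>w X)"
proof -
  interpret w: bounded_bilinear "(\<and>\<^sub>w) :: 'a ext \<Rightarrow> 'a ext \<Rightarrow> 'a ext" by (rule bilinear_wedge)
  show ?thesis
    unfolding theta_expand[of v, symmetric] theta_expand[of w, symmetric]
    by (simp add: wedge_sum_right w.scaleR_right scaleR_sum_right)
qed

lemma sum_scaleR_sum_list:
  "(\<Sum>a\<in>A. \<Sum>b\<in>B. (\<Sum>v\<leftarrow>vs. g v a b) *\<^sub>R (f a b :: 'b::real_vector))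
    = (\<Sum>v\<leftarrow>vs. \<Sum>a\<in>A. \<Sum>b\<in>B. g v a b *\<^sub>R f a b)"
  by (induction vs) (simp_all add: scaleR_add_left sum.distrib)

text \<open>Each square \<open>(v \<bullet> x) * (v \<bullet> y)\<close> in the reduction
  contributes \<open>theta 0 v\<close> times \<open>theta 1 v\<close>, which is the pair of
  pullbacks of the single row \<open>hcnj v\<close>.\<close>

lemma hess_form_psd:
  fixes H :: "'n::{finite,linorder} hspace \<Rightarrow> 'n hspace \<Rightarrow> real"
  assumes "\<And>y. linear (\<lambda>x. H x y)" "\<And>x y. H x y = H y x" "\<And>x. 0 \<le> H x x" and X: "X \<in> SP k"
  shows "hess_form H X \<in> SP (Suc k)"
proof -
  obtain vs where vs: "\<And>x y. H x y = (\<Sum>v\<leftarrow>vs. (v \<bullet> x) * (v \<bullet> y))"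
    using psd_sum_of_squares[of Basis H] assms by auto
  have "hess_form H X = (\<Sum>v\<leftarrow>vs. theta 0 v \<and>\<^sub>w (theta 1 v \<and>\<^sub>w X))"
    by (simp add: hess_form_def vs sum_scaleR_sum_list theta_expand2)
  then show ?thesis using SP_pullback[OF X] by (auto intro: SP_sum_list)
qed

section \<open>Hessian forms and right multiplication by quaternions\<close>

definition hmul :: "'n::finite hspace \<Rightarrow> quat \<Rightarrow> 'n hspace" where
  "hmul b q = (\<chi> l. qmul (b $ l) q)"

lemma right_line_eq: "right_line a b q = a + hmul b q"
  by (simp add: right_line_def hmul_def vec_eq_iff)

lemma bilinear_hmul: "bounded_bilinear hmul"
  unfolding bilinear_conv_bounded_bilinear[symmetric] bilinear_def
  by (auto intro!: linearI simp: hmul_def qmul_def vec_eq_iff forall_4 algebra_simps)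

lemma hmul_adjoint: "hmul x q \<bullet> c = x \<bullet> hmul c (qcnj q)"
  unfolding inner_vec_def[where ?'b = 'a]
  by (intro sum.cong refl) (simp add: hmul_def inner_quat qmul_def qcnj_def algebra_simps)

lemma hcnj_hmul: "hcnj (hmul c (qcnj q)) = (\<chi> l. qmul q (hcnj c $ l))"
  by (simp add: hcnj_def hmul_def qmul_def qcnj_def vec_eq_iff forall_4 algebra_simps)

lemma \<tau>_det: "\<tau> q $ 0 $ 0 * \<tau> q $ 1 $ 1 - \<tau> q $ 0 $ 1 * \<tau> q $ 1 $ 0 = of_real (q \<bullet> q)"
  by (simp add: \<tau>_def inner_quat complex_eq_iff algebra_simps)

lemma bilinear_expand:
  fixes H :: "'a::euclidean_space \<Rightarrow> 'a \<Rightarrow> real"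
  assumes lin: "\<And>y. linear (\<lambda>x. H x y)" and sym: "\<And>x y. H x y = H y x"
  shows "H x y = (\<Sum>c\<in>Basis. \<Sum>d\<in>Basis. (x \<bullet> c) * (y \<bullet> d) * H c d)"
proof -
  have *: "H x y = (\<Sum>c\<in>Basis. (x \<bullet> c) * H c y)" for x y
  proof -
    have "H x y = H (\<Sum>c\<in>Basis. (x \<bullet> c) *\<^sub>R c) y" by (simp add: euclidean_representation)
    then show ?thesis by (simp add: linear_sum[OF lin] linear_scale[OF lin])
  qed
  have "H c y = (\<Sum>d\<in>Basis. (y \<bullet> d) * H c d)" for c
    using *[of y c] sym by simp
  then show ?thesis by (subst *) (simp add: sum_distrib_left mult.assoc)
qed

lemma UNIV_2_eq: "(UNIV :: 2 set) = {0, 1}"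
proof -
  have "x = 0 \<or> x = 1" for x :: 2 using exhaust_2[of x] by auto
  then show ?thesis by blast
qed

lemma sum_swap4:
  "(\<Sum>a\<in>A. \<Sum>b\<in>B. \<Sum>c\<in>C. \<Sum>d\<in>D. f a b c d) = (\<Sum>c\<in>C. \<Sum>d\<in>D. \<Sum>a\<in>A. \<Sum>b\<in>B. f a b c d)"
proof -
  have "(\<Sum>a\<in>A. \<Sum>b\<in>B. \<Sum>c\<in>C. \<Sum>d\<in>D. f a b c d) = (\<Sum>a\<in>A. \<Sum>c\<in>C. \<Sum>b\<in>B. \<Sum>d\<in>D. f a b c d)"
    by (intro sum.cong refl sum.swap)
  also have "\<dots> = (\<Sum>c\<in>C. \<Sum>a\<in>A. \<Sum>b\<in>B. \<Sum>d\<in>D. f a b c d)"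
    by (rule sum.swap)
  also have "\<dots> = (\<Sum>c\<in>C. \<Sum>a\<in>A. \<Sum>d\<in>D. \<Sum>b\<in>B. f a b c d)"
    by (intro sum.cong refl sum.swap)
  also have "\<dots> = (\<Sum>c\<in>C. \<Sum>d\<in>D. \<Sum>a\<in>A. \<Sum>b\<in>B. f a b c d)"
    by (intro sum.cong refl sum.swap)
  finally show ?thesis .
qed

text \<open>Right multiplication by \<open>q\<close> acts on the pair \<open>theta 0\<close>,
  \<open>theta 1\<close> through the matrix \<open>\<tau> q\<close>. Symmetry of \<open>H\<close>
  and anticommutation make \<open>S r s\<close> antisymmetric, so of the products of matrix entries
  only the determinant survives.\<close>

lemma hess_form_hmul:
  fixes H :: "'n::{finite,linorder} hspace \<Rightarrow> 'n hspace \<Rightarrow> real"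
  assumes lin: "\<And>y. linear (\<lambda>x. H x y)" and sym: "\<And>x y. H x y = H y x"
  shows "hess_form (\<lambda>x y. H (hmul x q) (hmul y q)) X = (q \<bullet> q) *\<^sub>R hess_form H X"
proof -
  interpret w: bounded_bilinear "(\<and>\<^sub>w) :: 'n ext \<Rightarrow> 'n ext \<Rightarrow> 'n ext" by (rule bilinear_wedge)
  define S where "S r s = (\<Sum>c\<in>Basis. \<Sum>d\<in>Basis. H c d *\<^sub>R (theta r c \<and>\<^sub>w (theta s d \<and>\<^sub>w X)))" for r s
  define t where "t c = hmul c (qcnj q)" for c :: "'n hspace"
  have theta_t: "theta \<alpha> (t c) = (\<Sum>r\<in>UNIV. \<tau> q $ \<alpha> $ r *s theta r c)" for \<alpha> c
    unfolding t_def hcnj_hmul by (rule pullback_qmul)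
  have S_anti: "S r s = - S s r" for r s
  proof -
    have "S r s = (\<Sum>c\<in>Basis. \<Sum>d\<in>Basis. - (H c d *\<^sub>R (theta s d \<and>\<^sub>w (theta r c \<and>\<^sub>w X))))"
      unfolding S_def by (intro sum.cong refl) (subst pullback_anticomm, simp)
    also have "\<dots> = - (\<Sum>d\<in>Basis. \<Sum>c\<in>Basis. H d c *\<^sub>R (theta s d \<and>\<^sub>w (theta r c \<and>\<^sub>w X)))"
      by (subst sum.swap) (simp add: sum_negf sym)
    finally show ?thesis by (simp add: S_def)
  qed
  have S_diag: "S r r = 0" for r by (rule eq_minus_self_imp_zero[OF S_anti])
  have "hess_form (\<lambda>x y. H (hmul x q) (hmul y q)) X
      = (\<Sum>a\<in>Basis. \<Sum>b\<in>Basis. \<Sum>c\<in>Basis. \<Sum>d\<in>Basis.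
          H c d *\<^sub>R (((t c \<bullet> a) * (t d \<bullet> b)) *\<^sub>R (theta 0 a \<and>\<^sub>w (theta 1 b \<and>\<^sub>w X))))"
    unfolding hess_form_def bilinear_expand[OF lin sym, of "hmul _ q"] hmul_adjoint t_def[symmetric]
    by (simp add: scaleR_sum_left inner_commute mult_ac)
  also have "\<dots> = (\<Sum>c\<in>Basis. \<Sum>d\<in>Basis. \<Sum>a\<in>Basis. \<Sum>b\<in>Basis.
          H c d *\<^sub>R (((t c \<bullet> a) * (t d \<bullet> b)) *\<^sub>R (theta 0 a \<and>\<^sub>w (theta 1 b \<and>\<^sub>w X))))"
    by (rule sum_swap4)
  also have "\<dots> = (\<Sum>c\<in>Basis. \<Sum>d\<in>Basis. H c d *\<^sub>R (theta 0 (t c) \<and>\<^sub>w (theta 1 (t d) \<and>\<^sub>w X)))"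
    unfolding scaleR_sum_right[symmetric] theta_expand2 ..
  also have "\<dots> = (\<Sum>c\<in>Basis. \<Sum>d\<in>Basis. \<Sum>r\<in>UNIV. \<Sum>s\<in>UNIV.
      (\<tau> q $ 0 $ r * \<tau> q $ 1 $ s) *s (H c d *\<^sub>R (theta r c \<and>\<^sub>w (theta s d \<and>\<^sub>w X))))"
    unfolding theta_t
    by (simp add: wedge_sum_left wedge_sum_right wedge_smult_left wedge_smult_right scaleR_eq_smult
        smult_sum_right vector_smult_assoc mult_ac)
      (rule sum.cong[OF refl], rule sum.cong[OF refl], rule sum.swap)
  also have "\<dots> = (\<Sum>r\<in>UNIV. \<Sum>s\<in>UNIV. (\<tau> q $ 0 $ r * \<tau> q $ 1 $ s) *s S r s)"
    unfolding S_def smult_sum_right by (rule sum_swap4)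
  also have "\<dots> = (q \<bullet> q) *\<^sub>R S 0 1"
  proof -
    have e: "(UNIV :: 2 set) = {0, 1}" by (rule UNIV_2_eq)
    have "(\<Sum>r\<in>UNIV. \<Sum>s\<in>UNIV. (\<tau> q $ 0 $ r * \<tau> q $ 1 $ s) *s S r s)
       = (\<tau> q $ 0 $ 0 * \<tau> q $ 1 $ 1) *s S 0 1 + (\<tau> q $ 0 $ 1 * \<tau> q $ 1 $ 0) *s S 1 0"
      unfolding e by (simp add: S_diag)
    also have "\<dots> = (\<tau> q $ 0 $ 0 * \<tau> q $ 1 $ 1 - \<tau> q $ 0 $ 1 * \<tau> q $ 1 $ 0) *s S 0 1"
      by (subst S_anti[of 1 0]) (simp add: vector_sub_rdistrib vector_smult_rneg)
    finally show ?thesis by (simp only: \<tau>_det scaleR_eq_smult)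
  qed
  finally show ?thesis by (simp add: S_def hess_form_def)
qed

text \<open>Volume averages over the ball, rather than the sphere, match the mean values in
  \<open>subharmonic_on\<close>.\<close>

definition unif :: "quat measure" where
  "unif = uniform_measure lborel (cball 0 1)"

lemma emeasure_cball_quat: "emeasure lborel (cball (0::quat) 1) \<noteq> 0" "emeasure lborel (cball (0::quat) 1) \<noteq> \<infinity>"
proof -
  show "emeasure lborel (cball (0::quat) 1) \<noteq> 0"
    using content_cball_pos[of 1 "0 :: quat"] by (auto simp: measure_def)
  show "emeasure lborel (cball (0::quat) 1) \<noteq> \<infinity>"
    using emeasure_lborel_cball_finite[of "0::quat" 1] by simp
qed

lemma sets_unif [simp, measurable_cong]: "sets unif = sets borel"
  by (simp add: unif_def)

lemma space_unif [simp]: "space unif = UNIV"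
  by (simp add: unif_def)

lemma emeasure_unif_UNIV: "emeasure unif UNIV = 1"
proof -
  have "emeasure unif UNIV = emeasure lborel (cball (0::quat) 1) / emeasure lborel (cball (0::quat) 1)"
    by (simp add: unif_def)
  then show ?thesis
    using emeasure_cball_quat by (simp add: ennreal_divide_self top.not_eq_extremum)
qed

lemma finite_measure_unif: "finite_measure unif"
  by (rule finite_measureI) (simp add: emeasure_unif_UNIV)

lemma AE_unif: "AE q in unif. norm q \<le> 1"
  unfolding unif_def by (rule AE_uniform_measureI) auto

lemma integrable_unif:
  fixes f :: "quat \<Rightarrow> 'b::{banach, second_countable_topology}"
  assumes "f \<in> borel_measurable borel" "\<And>q. norm q \<le> 1 \<Longrightarrow> norm (f q) \<le> B"
  shows "integrable unif f"
  by (rule finite_measure.integrable_const_bound[OF finite_measure_unif, of _ B])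
    (use assms AE_unif in \<open>auto elim!: eventually_mono simp: measurable_cong_sets[OF sets_unif refl]\<close>)

lemma integrable_unif_continuous:
  fixes f :: "quat \<Rightarrow> 'b::euclidean_space"
  assumes "continuous_on UNIV f" shows "integrable unif f"
proof -
  have "bounded (f ` cball 0 1)"
    by (intro compact_imp_bounded compact_continuous_image continuous_on_subset[OF assms]) auto
  then obtain B where B: "\<forall>y \<in> f ` cball 0 1. norm y \<le> B"
    unfolding bounded_iff by blast
  have "norm (f q) \<le> B" if "norm q \<le> 1" for q
    using bspec[OF B, of "f q"] that by simp
  then show ?thesis
    by (intro integrable_unif borel_measurable_continuous_onI assms)
qed

text \<open>This second moment is the factor by which averaging over the lines scales
  \<open>hess_form\<close>; being positive, it can be divided out.\<close>

lemma integral_unif_norm_pos: "(LINT q|unif. q \<bullet> q) > 0"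
proof -
  have int: "integrable unif (\<lambda>q. q \<bullet> q)"
    by (intro integrable_unif_continuous continuous_intros)
  have "(LINT q|unif. q \<bullet> q) \<noteq> 0"
  proof
    assume "(LINT q|unif. q \<bullet> q) = 0"
    then have "AE q in unif. q \<bullet> q = 0"
      using integral_nonneg_eq_0_iff_AE[OF int] by simp
    then have "AE q in lborel. q \<in> cball (0::quat) 1 \<longrightarrow> q = 0"
      unfolding unif_def using emeasure_cball_quat by (subst (asm) AE_uniform_measure) (auto simp: top.not_eq_extremum)
    moreover have "AE q in lborel. q \<noteq> (0::quat)" by (rule AE_lborel_singleton)
    ultimately have "AE q in lborel. q \<notin> cball (0::quat) 1" by eventually_elim auto
    then have "emeasure lborel (cball (0::quat) 1) = 0"
      by (subst (asm) AE_iff_measurable[of "cball 0 1"]) auto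
    then show False using emeasure_cball_quat by simp
  qed
  moreover have "(LINT q|unif. q \<bullet> q) \<ge> 0" by (rule Bochner_Integration.integral_nonneg) simp
  ultimately show ?thesis by linarith
qed

text \<open>
  Averaging over the quaternionic line through \<open>b\<close> turns the Hessian of a plurisubharmonic
  function into a positive semidefinite form, and changes \<open>hess_form\<close> only by a factor.
\<close>

lemma hess_form_SP:
  fixes H :: "'n::{finite,linorder} hspace \<Rightarrow> 'n hspace \<Rightarrow> real"
  assumes lin: "\<And>y. linear (\<lambda>x. H x y)" and sym: "\<And>x y. H x y = H y x"
    and pos: "\<And>b. 0 \<le> (LINT q|unif. H (hmul b q) (hmul b q))" and X: "X \<in> SP k"
  shows "hess_form H X \<in> SP (Suc k)"
proof -
  interpret h: bounded_bilinear "hmul :: 'n hspace \<Rightarrow> _" by (rule bilinear_hmul)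
  have bil: "bounded_bilinear H"
  proof -
    have "linear (H x)" for x
    proof -
      have "H x = (\<lambda>y. H y x)" by (intro ext sym)
      then show ?thesis using lin by simp
    qed
    then show ?thesis
      unfolding bilinear_conv_bounded_bilinear[symmetric] bilinear_def using lin by blast
  qed
  have cont: "continuous_on UNIV (\<lambda>q. H (hmul a q) (hmul b q))" for a b
    by (intro bounded_bilinear.continuous_on[OF bil] h.continuous_on continuous_intros)
  note int = integrable_unif_continuous[OF cont]
  \<comment> \<open>The diagonal value \<open>A x x\<close> is an average over the line through
    \<open>x\<close>, so the hypothesis \<open>pos\<close> for all \<open>b\<close> is
    semidefiniteness of \<open>A\<close> on the whole real space.\<close>
  define A where "A x y = (LINT q|unif. H (hmul x q) (hmul y q))" for x y
  define m where "m = (LINT q|unif. q \<bullet> (q :: quat))"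
  have "hess_form A X = (LINT q|unif. hess_form (\<lambda>x y. H (hmul x q) (hmul y q)) X)"
    unfolding hess_form_def A_def using int by (simp add: integral_scaleR_left)
  also have "\<dots> = m *\<^sub>R hess_form H X"
    unfolding hess_form_hmul[OF lin sym] m_def
    by (intro integral_scaleR_left integrable_unif_continuous continuous_intros)
  finally have eq: "hess_form H X = (1 / m) *\<^sub>R hess_form A X"
    using integral_unif_norm_pos by (simp add: m_def)
  have "hess_form A X \<in> SP (Suc k)"
  proof (rule hess_form_psd[OF _ _ _ X])
    show "linear (\<lambda>x. A x y)" for y
    proof (rule linearI)
      show "A (u + v) y = A u y + A v y" for u v
        unfolding A_def h.add_left linear_add[OF lin]
        by (rule Bochner_Integration.integral_add[OF int int])
      show "A (c *\<^sub>R u) y = c *\<^sub>R A u y" for c u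
        unfolding A_def h.scaleR_left linear_scale[OF lin] by (simp add: int)
    qed
    show "A x y = A y x" for x y unfolding A_def by (simp add: sym)
    show "0 \<le> A x x" for x unfolding A_def by (rule pos)
  qed
  then show ?thesis
    unfolding eq by (rule SP_scaleR) (use integral_unif_norm_pos in \<open>simp add: m_def\<close>)
qed

section \<open>The complex span of the strongly positive elements\<close>

abbreviation spSP :: "nat \<Rightarrow> 'n::{finite,linorder} ext set" where
  "spSP k \<equiv> vec.span (SP k)"

text \<open>The cone directly contains the products in which both factors come from one row, with
  indices \<open>0\<close> and \<open>1\<close>. Real polarization gives the symmetric part for two
  rows, and left multiplication by the quaternion \<open>i\<close>, which multiplies the two
  pullbacks of a row by opposite imaginary units, gives the antisymmetric part.\<close>

lemma pullback_pair_span_SP: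
  fixes X :: "'n::{finite,linorder} ext"
  assumes X: "X \<in> SP k" shows "pullback \<eta> p \<and>\<^sub>w (pullback \<zeta> q \<and>\<^sub>w X) \<in> spSP (Suc k)"
proof -
  let ?P = "\<lambda>p q \<eta> \<zeta>. pullback \<eta> p \<and>\<^sub>w (pullback \<zeta> q \<and>\<^sub>w X)"
  define qi qj :: quat where "qi = vector [0, 1, 0, 0]" and "qj = vector [0, 0, 1, 0]"
  have e: "(UNIV :: 2 set) = {0, 1}" by (rule UNIV_2_eq)
  have i: "pullback (\<chi> l. qmul qi (\<eta> $ l)) 0 = - \<i> *s pullback \<eta> 0"
    "pullback (\<chi> l. qmul qi (\<eta> $ l)) 1 = \<i> *s pullback \<eta> 1" for \<eta> :: "'n hspace"
    unfolding pullback_qmul e by (simp_all add: \<tau>_def qi_def vec_eq_iff complex_eq_iff)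
  have j: "pullback (\<chi> l. qmul qj (\<eta> $ l)) 0 = - pullback \<eta> 1"
    "pullback (\<chi> l. qmul qj (\<eta> $ l)) 1 = pullback \<eta> 0" for \<eta> :: "'n hspace"
    unfolding pullback_qmul e by (simp_all add: \<tau>_def qj_def vec_eq_iff complex_eq_iff)
  have base: "?P 0 1 \<eta> \<eta> \<in> spSP (Suc k)" for \<eta>
    by (intro vec.span_base SP_pullback X)
  have pol: "?P 0 1 \<eta> \<zeta> + ?P 0 1 \<zeta> \<eta> \<in> spSP (Suc k)" for \<eta> \<zeta>
  proof -
    have "?P 0 1 \<eta> \<zeta> + ?P 0 1 \<zeta> \<eta> = ?P 0 1 (\<eta> + \<zeta>) (\<eta> + \<zeta>) - ?P 0 1 \<eta> \<eta> - ?P 0 1 \<zeta> \<zeta>"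
      by (simp add: linear_add[OF linear_pullback] wedge_add_left wedge_add_right)
    then show ?thesis using base by (simp add: vec.span_diff)
  qed
  have P01: "?P 0 1 \<eta> \<zeta> \<in> spSP (Suc k)" for \<eta> \<zeta>
  proof -
    let ?i = "\<chi> l. qmul qi (\<eta> $ l)"
    \<comment> \<open>The second bracket equals \<open>-\<i>\<close> times the difference of
      \<open>?P 0 1 \<eta> \<zeta>\<close> and \<open>?P 0 1 \<zeta> \<eta>\<close>; added with the
      factor \<open>\<i>\<close> it cancels the transposed term.\<close>
    have "?P 0 1 \<eta> \<zeta> = (1 / 2) *s ((?P 0 1 \<eta> \<zeta> + ?P 0 1 \<zeta> \<eta>) + \<i> *s (?P 0 1 ?i \<zeta> + ?P 0 1 \<zeta> ?i))"
      unfolding i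
      by (simp add: wedge_smult_left wedge_smult_right wedge_minus vector_add_ldistrib vector_smult_assoc
          vec_eq_iff algebra_simps)
    then show ?thesis by (metis pol vec.span_add vec.span_scale)
  qed
  \<comment> \<open>Left multiplication by the quaternion \<open>j\<close> exchanges the two
    pullbacks up to sign, so every pair of indices reduces to \<open>0\<close> and
    \<open>1\<close>.\<close>
  have flip: "\<exists>\<eta>' c. pullback \<eta> p = c *s pullback \<eta>' p'" for \<eta> :: "'n hspace" and p p'
  proof -
    have p: "p = 0 \<or> p = 1" "p' = 0 \<or> p' = 1" using exhaust_2[of p] exhaust_2[of p'] by auto
    have "pullback \<eta> 1 = (- 1) *s pullback (\<chi> l. qmul qj (\<eta> $ l)) 0"
      by (simp add: j vec_eq_iff)
    moreover have "pullback \<eta> 0 = 1 *s pullback (\<chi> l. qmul qj (\<eta> $ l)) 1"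
      by (simp add: j vec_eq_iff)
    moreover have "pullback \<eta> p = 1 *s pullback \<eta> p" by (simp add: vec_eq_iff)
    ultimately show ?thesis using p by metis
  qed
  obtain \<eta>' c where \<eta>': "pullback \<eta> p = c *s pullback \<eta>' 0" using flip by blast
  obtain \<zeta>' d where \<zeta>': "pullback \<zeta> q = d *s pullback \<zeta>' 1" using flip by blast
  have "?P p q \<eta> \<zeta> = (c * d) *s ?P 0 1 \<eta>' \<zeta>'"
    unfolding \<eta>' \<zeta>' by (simp add: wedge_smult_left wedge_smult_right vector_smult_assoc)
  then show ?thesis using P01 vec.span_scale by metis
qed

lemma pullback_pair_span:
  assumes "X \<in> spSP k" shows "pullback \<eta> p \<and>\<^sub>w (pullback \<zeta> q \<and>\<^sub>w X) \<in> spSP (Suc k)"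
proof (rule vec.span_induct[OF assms])
  show "vec.subspace {X. pullback \<eta> p \<and>\<^sub>w (pullback \<zeta> q \<and>\<^sub>w X) \<in> spSP (Suc k)}"
    unfolding vec.subspace_def
    by (auto simp: wedge_add_right wedge_smult_right intro: vec.span_add vec.span_scale vec.span_zero)
qed (rule pullback_pair_span_SP)

lemma \<omega>_pullback: "\<omega> {j} = pullback (axis (fst j) (vector [1, 0, 0, 0])) (snd j)"
proof -
  have "\<tau> (axis (fst j) (vector [1, 0, 0, 0]) $ fst k) $ snd j $ snd k = (if k = j then 1 else 0)" for k
  proof -
    have "snd j = 0 \<or> snd j = 1" "snd k = 0 \<or> snd k = 1"
      using exhaust_2[of "snd j"] exhaust_2[of "snd k"] by auto
    then show ?thesis
      by (cases "fst k = fst j") (auto simp: axis_def \<tau>_def prod_eq_iff complex_eq_iff)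
  qed
  then have "pullback (axis (fst j) (vector [1, 0, 0, 0])) (snd j) = (\<Sum>k\<in>UNIV. (if k = j then 1 else 0) *s \<omega> {k})"
    by (simp add: pullback_def)
  also have "\<dots> = (\<Sum>k\<in>UNIV. if k = j then \<omega> {k} else 0)"
    by (intro sum.cong) auto
  finally show ?thesis by simp
qed

lemma \<omega>_insert:
  assumes "j \<notin> J" shows "\<omega> (insert j J) = ins_sign j J *s (\<omega> {j} \<and>\<^sub>w \<omega> J)"
proof -
  have sq: "ins_sign j J * ins_sign j J = 1"
    by (simp add: ins_sign_def flip: power_add power_mult_distrib)
  have ins: "ins_sign j (insert j J) = ins_sign j J"
    using ins_sign_Diff[of j "insert j J"] assms by simp
  show ?thesis
    unfolding vec_eq_iff
  proof
    fix K
    show "\<omega> (insert j J) $ K = (ins_sign j J *s (\<omega> {j} \<and>\<^sub>w \<omega> J)) $ K"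
    proof (cases "K = insert j J")
      case True
      moreover have "insert j J - {j} = J" using assms by simp
      ultimately show ?thesis
        by (simp add: wedge_basis_nth ins mult.assoc[symmetric] sq) (simp add: \<omega>_def axis_def)
    next
      case False
      then have "\<not> (j \<in> K \<and> K - {j} = J)" by blast
      then have "(\<omega> {j} \<and>\<^sub>w \<omega> J) $ K = 0"
        unfolding wedge_basis_nth by (simp add: \<omega>_def axis_def)
      then show ?thesis using False by (simp add: \<omega>_def axis_def)
    qed
  qed
qed

text \<open>Two indices are removed at a time, because a pair of pullbacks leads from one span to
  the next. In this way every coefficient of a current becomes a finite complex combination of its
  values on strongly positive forms.\<close>

lemma \<omega>_span: "card I = 2 * k \<Longrightarrow> \<omega> I \<in> spSP k"
proof (induction k arbitrary: I)
  case 0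
  then have "I = {}" by simp
  have "left_independent ([] :: 'a hspace list)" by (simp add: left_independent_def)
  then have "\<omega> {} \<in> (elementary_SP 0 :: 'a ext set)" unfolding elementary_SP_def
    by (intro CollectI exI[of _ "[]"]) simp
  then show ?case unfolding \<open>I = {}\<close> SP_def by (intro vec.span_base hull_inc)
next
  case (Suc k)
  then have "I \<noteq> {}" by auto
  then obtain i where i: "i \<in> I" by blast
  have c1: "card (I - {i}) = Suc (2 * k)" using Suc.prems i by simp
  then have "I - {i} \<noteq> {}" by force
  then obtain j where j: "j \<in> I - {i}" by blast
  define J where "J = I - {i} - {j}"
  have J: "card J = 2 * k" using c1 j unfolding J_def by (simp add: card_Diff_singleton_if)
  have "\<omega> I = ins_sign i (insert j J) *s (\<omega> {i} \<and>\<^sub>w \<omega> (insert j J))"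
  proof -
    have "insert j J = I - {i}" using j by (auto simp: J_def)
    then have "i \<notin> insert j J" "insert i (insert j J) = I" using i by auto
    then show ?thesis using \<omega>_insert[of i "insert j J"] by simp
  qed
  also have "\<omega> (insert j J) = ins_sign j J *s (\<omega> {j} \<and>\<^sub>w \<omega> J)"
    by (rule \<omega>_insert) (simp add: J_def)
  finally have "\<omega> I = (ins_sign i (insert j J) * ins_sign j J) *s (\<omega> {i} \<and>\<^sub>w (\<omega> {j} \<and>\<^sub>w \<omega> J))"
    by (simp add: wedge_smult_right vector_smult_assoc)
  moreover have "\<omega> {i} \<and>\<^sub>w (\<omega> {j} \<and>\<^sub>w \<omega> J) \<in> spSP (Suc k)"
    unfolding \<omega>_pullback[of i] \<omega>_pullback[of j] by (rule pullback_pair_span[OF Suc.IH[OF J]])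
  ultimately show ?case by (metis vec.span_scale)
qed

section \<open>Positive functionals on test functions\<close>

definition test_funs :: "'a::euclidean_space set \<Rightarrow> ('a \<Rightarrow> real) set" where
  "test_funs \<Omega> = {f. smooth f \<and> (\<exists>K. compact K \<and> K \<subseteq> \<Omega> \<and> (\<forall>x. x \<notin> K \<longrightarrow> f x = 0))}"

lemma test_funsI:
  "smooth f \<Longrightarrow> compact K \<Longrightarrow> K \<subseteq> \<Omega> \<Longrightarrow> (\<And>x. x \<notin> K \<Longrightarrow> f x = 0) \<Longrightarrow> f \<in> test_funs \<Omega>"
  by (auto simp: test_funs_def)

lemma test_funs_smooth: "f \<in> test_funs \<Omega> \<Longrightarrow> smooth f"
  by (simp add: test_funs_def)

lemma test_funs_support:
  assumes "f \<in> test_funs \<Omega>"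
  obtains K where "compact K" "K \<subseteq> \<Omega>" "\<And>x. x \<notin> K \<Longrightarrow> f x = 0"
  using assms by (auto simp: test_funs_def)

lemma test_funs_mult:
  assumes "smooth f" "g \<in> test_funs \<Omega>" shows "(\<lambda>x. f x * g x) \<in> test_funs \<Omega>"
proof -
  obtain K where "compact K" "K \<subseteq> \<Omega>" "\<And>x. x \<notin> K \<Longrightarrow> g x = 0"
    by (rule test_funs_support[OF assms(2)]) (rule that)
  then show ?thesis
    by (intro test_funsI[of _ K] smooth_mult assms test_funs_smooth[OF assms(2)]) auto
qed

lemma test_funs_scale: "g \<in> test_funs \<Omega> \<Longrightarrow> (\<lambda>x. c * g x) \<in> test_funs \<Omega>"
  by (rule test_funs_mult[OF smooth_const])

lemma test_funs_add:
  assumes "f \<in> test_funs \<Omega>" "g \<in> test_funs \<Omega>" shows "(\<lambda>x. f x + g x) \<in> test_funs \<Omega>"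
proof -
  obtain K where K: "compact K" "K \<subseteq> \<Omega>" "\<And>x. x \<notin> K \<Longrightarrow> f x = 0"
    by (rule test_funs_support[OF assms(1)]) (rule that)
  obtain L where L: "compact L" "L \<subseteq> \<Omega>" "\<And>x. x \<notin> L \<Longrightarrow> g x = 0"
    by (rule test_funs_support[OF assms(2)]) (rule that)
  show ?thesis
  proof (rule test_funsI)
    show "compact (K \<union> L)" "K \<union> L \<subseteq> \<Omega>" using K L by auto
    show "smooth (\<lambda>x. f x + g x)" by (intro smooth_add test_funs_smooth[OF assms(1)] test_funs_smooth[OF assms(2)])
  qed (simp add: K(3) L(3))
qed

lemma test_funs_zero: "(\<lambda>x. 0) \<in> test_funs \<Omega>"
  by (rule test_funsI[of _ "{}"]) auto

lemma test_funs_sum: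
  "(\<And>i. i \<in> I \<Longrightarrow> f i \<in> test_funs \<Omega>) \<Longrightarrow> (\<lambda>x. \<Sum>i\<in>I. f i x) \<in> test_funs \<Omega>"
  by (induction I rule: infinite_finite_induct) (simp_all add: test_funs_zero test_funs_add)

lemma test_funs_compose:
  assumes S: "smooth S" "S 0 = (0::real)" and f: "f \<in> test_funs \<Omega>" shows "(\<lambda>x. S (f x)) \<in> test_funs \<Omega>"
proof -
  obtain K where "compact K" "K \<subseteq> \<Omega>" "\<And>x. x \<notin> K \<Longrightarrow> f x = 0"
    by (rule test_funs_support[OF f]) (rule that)
  then show ?thesis
    by (intro test_funsI[of _ K] smooth_compose[OF S(1)] test_funs_smooth[OF f]) (auto simp: S(2))
qed

section \<open>The outer measure generated by a positive functional\<close>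

locale positive_functional =
  fixes \<Omega> :: "'a::euclidean_space set" and \<Lambda> :: "('a \<Rightarrow> real) \<Rightarrow> real"
  assumes open_\<Omega>: "open \<Omega>"
    and add: "\<And>f g. f \<in> test_funs \<Omega> \<Longrightarrow> g \<in> test_funs \<Omega> \<Longrightarrow> \<Lambda> (\<lambda>x. f x + g x) = \<Lambda> f + \<Lambda> g"
    and scale: "\<And>f c. f \<in> test_funs \<Omega> \<Longrightarrow> \<Lambda> (\<lambda>x. c * f x) = c * \<Lambda> f"
    and pos: "\<And>f. f \<in> test_funs \<Omega> \<Longrightarrow> (\<And>x. 0 \<le> f x) \<Longrightarrow> 0 \<le> \<Lambda> f"
begin

abbreviation "D \<equiv> test_funs \<Omega>"

lemma zero: "\<Lambda> (\<lambda>x. 0) = 0"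
  using scale[OF test_funs_zero, of 0] by simp

lemma mono: 
  assumes "f \<in> D" "g \<in> D" "\<And>x. f x \<le> g x" shows "\<Lambda> f \<le> \<Lambda> g"
proof -
  have m: "(\<lambda>x. (- 1) * f x) \<in> D" by (rule test_funs_scale[OF assms(1)])
  have "0 \<le> \<Lambda> (\<lambda>x. g x + (- 1) * f x)"
    by (rule pos[OF test_funs_add[OF assms(2) m]]) (simp add: assms(3))
  also have "\<dots> = \<Lambda> g + (- 1) * \<Lambda> f"
    using add[OF assms(2) m] scale[OF assms(1), of "- 1"] by simp
  finally show ?thesis by simp
qed

lemma sum: "finite I \<Longrightarrow> (\<And>i. i \<in> I \<Longrightarrow> f i \<in> D) \<Longrightarrow> \<Lambda> (\<lambda>x. \<Sum>i\<in>I. f i x) = (\<Sum>i\<in>I. \<Lambda> (f i))"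
  by (induction I rule: finite_induct) (simp_all add: zero add test_funs_sum)

text \<open>Sets are covered by sequences of nonnegative test functions rather than by open sets, so
  the functional can be applied to a cover at once. Summing in \<open>ennreal\<close> removes
  convergence questions, and merging a sequence of covers into one gives countable
  subadditivity.\<close>

definition covers :: "'a set \<Rightarrow> (nat \<Rightarrow> 'a \<Rightarrow> real) set" where
  "covers E = {g. (\<forall>n. g n \<in> D) \<and> (\<forall>n x. 0 \<le> g n x) \<and> (\<forall>x\<in>E. 1 \<le> (\<Sum>n. ennreal (g n x)))}"

definition outer :: "'a set \<Rightarrow> ennreal" where
  "outer E = (INF g\<in>covers E. \<Sum>n. ennreal (\<Lambda> (g n)))"

lemma coversD:
  assumes "g \<in> covers E"
  shows "g n \<in> D" "0 \<le> g n x" "x \<in> E \<Longrightarrow> 1 \<le> (\<Sum>n. ennreal (g n x))" "0 \<le> \<Lambda> (g n)"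
  using assms pos[of "g n"] by (auto simp: covers_def)

lemma outer_le: "g \<in> covers E \<Longrightarrow> outer E \<le> (\<Sum>n. ennreal (\<Lambda> (g n)))"
  unfolding outer_def by (rule INF_lower)

lemma outer_mono: "A \<subseteq> B \<Longrightarrow> outer A \<le> outer B"
  unfolding outer_def by (rule INF_superset_mono) (auto simp: covers_def)

lemma outer_le_double:
  assumes "\<And>m n. h m n \<in> D" "\<And>m n x. 0 \<le> h m n x"
    and "\<And>x. x \<in> E \<Longrightarrow> 1 \<le> (\<Sum>m. \<Sum>n. ennreal (h m n x))"
  shows "outer E \<le> (\<Sum>m. \<Sum>n. ennreal (\<Lambda> (h m n)))"
proof -
  let ?g = "\<lambda>k. h (fst (prod_decode k)) (snd (prod_decode k))"
  have eq: "(\<Sum>k. ennreal (F (?g k))) = (\<Sum>m. \<Sum>n. ennreal (F (h m n)))" for F :: "('a \<Rightarrow> real) \<Rightarrow> real"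
    using suminf_ennreal_2dimen[of "\<lambda>m. \<Sum>n. ennreal (F (h m n))" "\<lambda>(m, n). ennreal (F (h m n))"]
    by (simp add: case_prod_beta)
  have "?g \<in> covers E"
    using assms eq[of "\<lambda>g. g x" for x] by (auto simp: covers_def)
  from outer_le[OF this] show ?thesis unfolding eq .
qed

lemma outer_approx:
  assumes "outer E \<noteq> \<infinity>" "0 < e"
  obtains g where "g \<in> covers E" "(\<Sum>n. ennreal (\<Lambda> (g n))) < outer E + ennreal e"
proof -
  have "\<exists>g\<in>covers E. (\<Sum>n. ennreal (\<Lambda> (g n))) < outer E + ennreal e"
    by (rule INF_approx_ennreal) (use assms in \<open>auto simp: outer_def\<close>)
  then show ?thesis using that by blast
qed

lemma outer_measure_space_outer: "outer_measure_space (Pow \<Omega>) outer"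
  unfolding outer_measure_space_def
proof (intro conjI)
  have "(\<lambda>n x. 0) \<in> covers {}" by (simp add: covers_def test_funs_zero)
  from outer_le[OF this] show "positive (Pow \<Omega>) outer" by (simp add: positive_def zero)
  show "increasing (Pow \<Omega>) outer" by (simp add: increasing_def outer_mono)
  show "countably_subadditive (Pow \<Omega>) outer"
    unfolding countably_subadditive_def
  proof (intro allI impI)
    fix A :: "nat \<Rightarrow> 'a set"
    show "outer (\<Union> (range A)) \<le> (\<Sum>n. outer (A n))"
    proof (rule ennreal_le_epsilon)
      fix e :: real
      assume fin: "(\<Sum>n. outer (A n)) < top" and e: "0 < e"
      have finA: "outer (A n) \<noteq> \<infinity>" for n
        using ennreal_suminf_lessD[OF fin, of n] by (simp add: less_top)
      have "\<exists>g. g \<in> covers (A n) \<and> (\<Sum>k. ennreal (\<Lambda> (g k))) < outer (A n) + ennreal (e * (1/2) ^ Suc n)" for n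
      proof -
        have "0 < e * (1/2) ^ Suc n" using e by simp
        then show ?thesis by (rule outer_approx[OF finA]) blast
      qed
      then obtain g where g: "\<And>n. g n \<in> covers (A n)"
        "\<And>n. (\<Sum>k. ennreal (\<Lambda> (g n k))) < outer (A n) + ennreal (e * (1/2) ^ Suc n)" by metis
      have "outer (\<Union> (range A)) \<le> (\<Sum>n. \<Sum>k. ennreal (\<Lambda> (g n k)))"
      proof (rule outer_le_double)
        show "g m n \<in> D" "0 \<le> g m n x" for m n x using coversD[OF g(1)] by auto
        fix x assume "x \<in> \<Union> (range A)"
        then obtain i where "x \<in> A i" by blast
        then have "1 \<le> (\<Sum>k. ennreal (g i k x))" using coversD(3)[OF g(1)] by blast
        also have "\<dots> \<le> (\<Sum>n. \<Sum>k. ennreal (g n k x))"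
          using sum_le_suminf[of "\<lambda>n. \<Sum>k. ennreal (g n k x)" "{i}"] by simp
        finally show "1 \<le> (\<Sum>n. \<Sum>k. ennreal (g n k x))" .
      qed
      also have "\<dots> \<le> (\<Sum>n. outer (A n) + ennreal (e * (1/2) ^ Suc n))"
        by (intro suminf_le less_imp_le g(2)) auto
      also have "\<dots> = (\<Sum>n. outer (A n)) + (\<Sum>n. ennreal (e * (1/2) ^ Suc n))"
        by (intro suminf_add[symmetric]) auto
      also have "(\<Sum>n. ennreal (e * (1/2) ^ Suc n)) = ennreal e"
        using sums_mult[OF power_half_series, of e] e by (intro suminf_ennreal_eq) auto
      finally show "outer (\<Union> (range A)) \<le> (\<Sum>n. outer (A n)) + ennreal e" .
    qed
  qed
qed

definition "meas_sets = lambda_system \<Omega> (Pow \<Omega>) outer"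

lemma measure_space_outer: "measure_space \<Omega> meas_sets outer"
  unfolding meas_sets_def
  by (rule sigma_algebra.caratheodory_lemma[OF sigma_algebra_Pow outer_measure_space_outer])

text \<open>Caratheodory's condition is obtained by splitting a cover \<open>g\<close> of
  \<open>E\<close> along bumps that increase to the indicator of the ball. For every
  \<open>M\<close> the functions \<open>(1 - \<phi> M) g\<close> cover the part of \<open>E\<close>
  outside the ball, while the increments of the bumps times \<open>g\<close> together cover the part
  inside. The first \<open>M\<close> increments and the remainder add up to \<open>g\<close>;
  letting \<open>M\<close> grow gives the inequality.\<close>

lemma ball_meas_sets:
  assumes r: "r > 0" shows "\<Omega> \<inter> ball c r \<in> meas_sets"
proof -
  let ?A = "\<Omega> \<inter> ball c r"
  define \<phi> where "\<phi> m = ball_bump c r (real m)" for m :: nat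
  define \<psi> where "\<psi> m x = \<phi> (Suc m) x - \<phi> m x" for m x
  have \<phi>: "smooth (\<phi> m)" "0 \<le> \<phi> m x" "\<phi> m x \<le> 1" for m x
    by (simp_all add: \<phi>_def smooth_ball_bump ball_bump_bounds)
  have \<phi>0: "\<phi> 0 x = 0" for x by (simp add: \<phi>_def ball_bump_def smooth_step)
  have \<psi>: "smooth (\<psi> m)" "0 \<le> \<psi> m x" for m x
    using r by (auto simp: \<psi>_def[abs_def] \<phi>(1) intro!: smooth_diff) (simp add: \<phi>_def ball_bump_mono)
  have \<psi>_sum: "(\<Sum>m<M. \<psi> m x) = \<phi> M x" for M x
    unfolding \<psi>_def by (subst sum_lessThan_telescope) (simp add: \<phi>0)
  have \<psi>_suminf: "(\<Sum>m. ennreal (\<psi> m x)) = 1" if "x \<in> ball c r" for x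
  proof -
    have "(\<lambda>m. \<psi> m x) sums 1"
      unfolding sums_def \<psi>_sum using ball_bump_tendsto[OF r, of c x] that by (simp add: \<phi>_def)
    then have "(\<Sum>m. ennreal (\<psi> m x)) = ennreal 1"
      using \<psi>(2) by (intro suminf_ennreal_eq)
    then show ?thesis by simp
  qed
  have ineq: "outer (?A \<inter> E) + outer ((\<Omega> - ?A) \<inter> E) \<le> outer E" if E: "E \<subseteq> \<Omega>" for E
    unfolding outer_def[of E]
  proof (rule INF_greatest)
    fix g assume g: "g \<in> covers E"
    have gD: "(\<lambda>x. f x * g n x) \<in> D" if "smooth f" for f n
      by (rule test_funs_mult[OF that coversD(1)[OF g]])
    have A: "outer (?A \<inter> E) \<le> (\<Sum>m. \<Sum>n. ennreal (\<Lambda> (\<lambda>x. \<psi> m x * g n x)))"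
    proof (rule outer_le_double)
      show "(\<lambda>x. \<psi> m x * g n x) \<in> D" for m n by (rule gD[OF \<psi>(1)])
      show "0 \<le> \<psi> m x * g n x" for m n x using \<psi>(2) coversD(2)[OF g] by simp
      fix x assume x: "x \<in> ?A \<inter> E"
      have "(\<Sum>m. \<Sum>n. ennreal (\<psi> m x * g n x)) = (\<Sum>m. ennreal (\<psi> m x) * (\<Sum>n. ennreal (g n x)))"
        using \<psi>(2) coversD(2)[OF g] by (simp add: ennreal_mult ennreal_suminf_cmult)
      also have "\<dots> = (\<Sum>m. ennreal (\<psi> m x)) * (\<Sum>n. ennreal (g n x))"
        by (rule ennreal_suminf_multc)
      also have "\<dots> \<ge> 1"
        using x coversD(3)[OF g] by (simp add: \<psi>_suminf)
      finally show "1 \<le> (\<Sum>m. \<Sum>n. ennreal (\<psi> m x * g n x))" .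
    qed
    have B: "(\<Sum>m<M. \<Sum>n. ennreal (\<Lambda> (\<lambda>x. \<psi> m x * g n x))) + outer ((\<Omega> - ?A) \<inter> E)
        \<le> (\<Sum>n. ennreal (\<Lambda> (g n)))" for M
    proof -
      have pos1: "0 \<le> \<Lambda> (\<lambda>x. \<psi> m x * g n x)" for m n
        by (rule pos[OF gD[OF \<psi>(1)]]) (simp add: \<psi>(2) coversD(2)[OF g])
      have pos2: "0 \<le> \<Lambda> (\<lambda>x. \<phi> M x * g n x)" for n
        by (rule pos[OF gD[OF \<phi>(1)]]) (simp add: \<phi>(2) coversD(2)[OF g])
      have s1: "smooth (\<lambda>x. 1 - \<phi> M x)" by (intro smooth_diff smooth_const \<phi>(1))
      have pos3: "0 \<le> \<Lambda> (\<lambda>x. (1 - \<phi> M x) * g n x)" for n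
        by (rule pos[OF gD[OF s1]]) (simp add: \<phi>(3) coversD(2)[OF g])
      have "(\<Sum>m<M. \<Sum>n. ennreal (\<Lambda> (\<lambda>x. \<psi> m x * g n x)))
          = (\<Sum>n. \<Sum>m<M. ennreal (\<Lambda> (\<lambda>x. \<psi> m x * g n x)))"
        by (rule suminf_sum[symmetric]) auto
      also have "\<dots> = (\<Sum>n. ennreal (\<Lambda> (\<lambda>x. \<phi> M x * g n x)))"
      proof (rule suminf_cong)
        fix n
        have "(\<Sum>m<M. ennreal (\<Lambda> (\<lambda>x. \<psi> m x * g n x))) = ennreal (\<Sum>m<M. \<Lambda> (\<lambda>x. \<psi> m x * g n x))"
          by (rule sum_ennreal) (rule pos1)
        also have "(\<Sum>m<M. \<Lambda> (\<lambda>x. \<psi> m x * g n x)) = \<Lambda> (\<lambda>x. \<Sum>m<M. \<psi> m x * g n x)"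
          by (rule sum[symmetric]) (simp_all add: gD \<psi>(1))
        also have "\<dots> = \<Lambda> (\<lambda>x. \<phi> M x * g n x)"
          by (simp only: sum_distrib_right[symmetric] \<psi>_sum)
        finally show "(\<Sum>m<M. ennreal (\<Lambda> (\<lambda>x. \<psi> m x * g n x))) = ennreal (\<Lambda> (\<lambda>x. \<phi> M x * g n x))" .
      qed
      finally have e1: "(\<Sum>m<M. \<Sum>n. ennreal (\<Lambda> (\<lambda>x. \<psi> m x * g n x)))
        = (\<Sum>n. ennreal (\<Lambda> (\<lambda>x. \<phi> M x * g n x)))" .
      have "(\<lambda>n x. (1 - \<phi> M x) * g n x) \<in> covers ((\<Omega> - ?A) \<inter> E)"
      proof -
        have "\<phi> M x = 0" if "x \<in> (\<Omega> - ?A) \<inter> E" for x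
          using that r unfolding \<phi>_def by (intro ball_bump_outside) auto
        then show ?thesis
          using coversD[OF g] \<phi>(3) gD[OF s1] by (simp add: covers_def)
      qed
      from outer_le[OF this] have "outer ((\<Omega> - ?A) \<inter> E) \<le> (\<Sum>n. ennreal (\<Lambda> (\<lambda>x. (1 - \<phi> M x) * g n x)))" .
      then have "(\<Sum>m<M. \<Sum>n. ennreal (\<Lambda> (\<lambda>x. \<psi> m x * g n x))) + outer ((\<Omega> - ?A) \<inter> E)
        \<le> (\<Sum>n. ennreal (\<Lambda> (\<lambda>x. \<phi> M x * g n x))) + (\<Sum>n. ennreal (\<Lambda> (\<lambda>x. (1 - \<phi> M x) * g n x)))"
        unfolding e1 by (rule add_left_mono)
      also have "\<dots> = (\<Sum>n. ennreal (\<Lambda> (\<lambda>x. \<phi> M x * g n x)) + ennreal (\<Lambda> (\<lambda>x. (1 - \<phi> M x) * g n x)))"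
        by (rule suminf_add) auto
      also have "\<dots> = (\<Sum>n. ennreal (\<Lambda> (g n)))"
      proof (rule suminf_cong)
        fix n
        have "\<Lambda> (g n) = \<Lambda> (\<lambda>x. \<phi> M x * g n x + (1 - \<phi> M x) * g n x)"
          by (simp add: algebra_simps)
        also have "\<dots> = \<Lambda> (\<lambda>x. \<phi> M x * g n x) + \<Lambda> (\<lambda>x. (1 - \<phi> M x) * g n x)"
          by (rule add[OF gD[OF \<phi>(1)] gD[OF s1]])
        finally show "ennreal (\<Lambda> (\<lambda>x. \<phi> M x * g n x)) + ennreal (\<Lambda> (\<lambda>x. (1 - \<phi> M x) * g n x)) = ennreal (\<Lambda> (g n))"
          using pos2 pos3 by simp
      qed
      finally show ?thesis .
    qed
    have "outer (?A \<inter> E) + outer ((\<Omega> - ?A) \<inter> E)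
      \<le> (\<Sum>m. \<Sum>n. ennreal (\<Lambda> (\<lambda>x. \<psi> m x * g n x))) + outer ((\<Omega> - ?A) \<inter> E)"
      by (rule add_right_mono[OF A])
    also have "\<dots> \<le> (\<Sum>n. ennreal (\<Lambda> (g n)))"
      by (rule ennreal_suminf_bound_add[OF B])
    finally show "outer (?A \<inter> E) + outer ((\<Omega> - ?A) \<inter> E) \<le> (\<Sum>n. ennreal (\<Lambda> (g n)))" .
  qed
  have sub: "outer E \<le> outer (?A \<inter> E) + outer ((\<Omega> - ?A) \<inter> E)" if E: "E \<subseteq> \<Omega>" for E
  proof -
    interpret ring_of_sets \<Omega> "Pow \<Omega>" by (rule ring_of_sets_Pow)
    have sa: "subadditive (Pow \<Omega>) outer"
      using outer_measure_space_outer countably_subadditive_subadditive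
      unfolding outer_measure_space_def by blast
    have "outer ((?A \<inter> E) \<union> ((\<Omega> - ?A) \<inter> E)) \<le> outer (?A \<inter> E) + outer ((\<Omega> - ?A) \<inter> E)"
      by (rule sa[unfolded subadditive_def, rule_format]) auto
    moreover have "(?A \<inter> E) \<union> ((\<Omega> - ?A) \<inter> E) = E" using E by blast
    ultimately show ?thesis by simp
  qed
  show ?thesis
    unfolding meas_sets_def lambda_system_def
    using ineq sub by (auto intro!: antisym)
qed

text \<open>Balls suffice: by the Lindelof property an open set is a countable union of balls
  contained in it.\<close>

lemma borel_meas_sets: "sets (restrict_space borel \<Omega>) \<subseteq> meas_sets"
proof -
  interpret sigma_algebra \<Omega> meas_sets
    using measure_space_outer by (simp add: measure_space_def)
  have open_sets: "\<Omega> \<inter> S \<in> meas_sets" if S: "open S" for S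
  proof -
    define F where "F = {ball c r | c r. r > 0 \<and> ball c r \<subseteq> S}"
    have "\<Union>F = S"
    proof
      show "S \<subseteq> \<Union>F"
      proof
        fix x assume "x \<in> S"
        then obtain e where "e > 0" "ball x e \<subseteq> S" using S open_contains_ball by blast
        then have "ball x e \<in> F" "x \<in> ball x e" by (auto simp: F_def)
        then show "x \<in> \<Union>F" by blast
      qed
    qed (auto simp: F_def)
    moreover obtain F' where F': "F' \<subseteq> F" "countable F'" "\<Union>F' = \<Union>F"
      by (rule Lindelof[of F]) (auto simp: F_def)
    ultimately have "\<Omega> \<inter> S = (\<Union>B\<in>F'. \<Omega> \<inter> B)" by auto
    moreover have "(\<Union>B\<in>F'. \<Omega> \<inter> B) \<in> meas_sets"
    proof (rule countable_UN''[OF F'(2)])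
      fix B assume "B \<in> F'"
      then obtain c r where "r > 0" "B = ball c r" using F'(1) by (auto simp: F_def)
      then show "\<Omega> \<inter> B \<in> meas_sets" using ball_meas_sets by simp
    qed
    ultimately show ?thesis by simp
  qed
  have sets: "sets (sigma \<Omega> meas_sets) = meas_sets" "space (sigma \<Omega> meas_sets) = \<Omega>"
    using sets_measure_of_eq space_measure_of_eq by auto
  have "(\<lambda>x. x) \<in> borel_measurable (sigma \<Omega> meas_sets)"
  proof (rule borel_measurableI)
    fix S :: "'a set" assume "open S"
    then have "\<Omega> \<inter> S \<in> meas_sets" by (rule open_sets)
    then show "(\<lambda>x. x) -` S \<inter> space (sigma \<Omega> meas_sets) \<in> sets (sigma \<Omega> meas_sets)"
      by (simp add: sets Int_commute)
  qed
  then have "(\<lambda>x. x) -` B \<inter> space (sigma \<Omega> meas_sets) \<in> sets (sigma \<Omega> meas_sets)" if "B \<in> sets borel" for B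
    using that by (rule measurable_sets)
  then show ?thesis
    by (auto simp: sets sets_restrict_space Int_commute)
qed

definition rmeas :: "'a measure" where
  "rmeas = measure_of \<Omega> (sets (restrict_space borel \<Omega>)) outer"

lemma sigma_algebra_restrict: "sigma_algebra \<Omega> (sets (restrict_space borel \<Omega>))"
proof -
  have "space (restrict_space borel \<Omega>) = \<Omega>" by (simp add: space_restrict_space)
  then show ?thesis using sets.sigma_algebra_axioms[of "restrict_space borel \<Omega>"] by simp
qed

lemma sets_rmeas [simp]: "sets rmeas = sets (restrict_space borel \<Omega>)"
  unfolding rmeas_def by (rule sigma_algebra.sets_measure_of_eq[OF sigma_algebra_restrict])

lemma space_rmeas [simp]: "space rmeas = \<Omega>"
  unfolding rmeas_def by (rule sigma_algebra.space_measure_of_eq[OF sigma_algebra_restrict])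

lemma emeasure_rmeas:
  assumes A: "A \<in> sets (restrict_space borel \<Omega>)" shows "emeasure rmeas A = outer A"
proof -
  have "measure_space \<Omega> (sets (restrict_space borel \<Omega>)) outer"
    by (rule measure_down[OF measure_space_outer sigma_algebra_restrict borel_meas_sets])
  then have "positive (sets (restrict_space borel \<Omega>)) outer"
    "countably_additive (sets (restrict_space borel \<Omega>)) outer"
    by (auto simp: measure_space_def)
  then show ?thesis
    unfolding rmeas_def by (rule emeasure_measure_of_sigma[OF sigma_algebra_restrict _ _ A])
qed

end

context positive_functional
begin

text \<open>Dini's theorem makes \<open>\<Lambda>\<close> countably subadditive.\<close>

lemma functional_le_suminf:
  assumes h: "h \<in> D" "\<And>x. 0 \<le> h x" and g: "\<And>n. g n \<in> D" "\<And>n x. 0 \<le> g n x"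
    and le: "\<And>x. ennreal (h x) \<le> (\<Sum>n. ennreal (g n x))"
  shows "ennreal (\<Lambda> h) \<le> (\<Sum>n. ennreal (\<Lambda> (g n)))"
proof -
  obtain K where K: "compact K" "K \<subseteq> \<Omega>" "\<And>x. x \<notin> K \<Longrightarrow> h x = 0"
    by (rule test_funs_support[OF h(1)]) (rule that)
  obtain \<psi> L where \<psi>: "smooth \<psi>" "compact L" "L \<subseteq> \<Omega>" "\<And>x. x \<notin> L \<Longrightarrow> \<psi> x = (0::real)"
    "\<And>x. 0 \<le> \<psi> x" "\<And>x. \<psi> x \<le> 1" "\<And>x. x \<in> K \<Longrightarrow> \<psi> x = 1"
    by (rule smooth_cutoff[OF K(1) open_\<Omega> K(2)]) (rule that)
  have \<psi>D: "\<psi> \<in> D" by (rule test_funsI[OF \<psi>(1-4)])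
  have \<Lambda>\<psi>: "0 \<le> \<Lambda> \<psi>" by (rule pos[OF \<psi>D \<psi>(5)])
  have \<Lambda>g: "0 \<le> \<Lambda> (g n)" for n by (rule pos[OF g])
  show ?thesis
  proof (rule ennreal_le_epsilon)
    fix e :: real assume "0 < e"
    \<comment> \<open>The error is absorbed by \<open>\<delta> * \<psi>\<close>, whose value
      \<open>\<delta> * \<Lambda> \<psi>\<close> is at most \<open>e\<close>; the \<open>+ 1\<close>
      guards against \<open>\<Lambda> \<psi> = 0\<close>.\<close>
    define \<delta> where "\<delta> = e / (\<Lambda> \<psi> + 1)"
    have \<delta>: "\<delta> > 0" "\<delta> * \<Lambda> \<psi> \<le> e"
      using \<open>0 < e\<close> \<Lambda>\<psi> by (auto simp: \<delta>_def field_simps)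
    \<comment> \<open>These open sets increase with \<open>N\<close> and exhaust the compact
      support, so one of them contains it and a single partial sum exceeds
      \<open>h - \<delta>\<close> there.\<close>
    define U where "U N = {x. h x - \<delta> < (\<Sum>n<N. g n x)}" for N
    have opU: "open (U N)" for N
      unfolding U_def
      by (intro open_Collect_less continuous_intros smooth_continuous_on test_funs_smooth[OF h(1)]
          test_funs_smooth[OF g(1)])
    have monoU: "U M \<subseteq> U N" if "M \<le> N" for M N
    proof -
      have "(\<Sum>n<M. g n x) \<le> (\<Sum>n<N. g n x)" for x
        using that g(2) by (intro sum_mono2) auto
      then show ?thesis unfolding U_def by (force intro: less_le_trans)
    qed
    have "\<exists>N. x \<in> U N" for x
    proof (rule ccontr)
      assume "\<nexists>N. x \<in> U N"
      then have le': "(\<Sum>n<N. g n x) \<le> h x - \<delta>" for N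
        unfolding U_def by (simp add: not_less)
      have "(\<Sum>n. ennreal (g n x)) \<le> ennreal (h x - \<delta>)"
      proof (rule suminf_le_const)
        show "(\<Sum>n<N. ennreal (g n x)) \<le> ennreal (h x - \<delta>)" for N
          using le'[of N] g(2) by (simp add: ennreal_leI)
      qed simp
      then have "ennreal (h x) \<le> ennreal (h x - \<delta>)" using le order_trans by blast
      moreover have "0 \<le> h x - \<delta>" using le'[of 0] by simp
      ultimately show False using \<delta>(1) h(2)[of x] by (simp add: ennreal_le_iff)
    qed
    then have KU: "K \<subseteq> (\<Union>N\<in>UNIV. U N)" by blast
    obtain C where C: "C \<subseteq> UNIV" "finite C" "K \<subseteq> (\<Union>N\<in>C. U N)"
      by (rule compactE_image[OF K(1) opU KU]) (rule that)
    define N where "N = Max (insert 0 C)"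
    have "K \<subseteq> U N"
    proof
      fix x assume "x \<in> K"
      then obtain M where "M \<in> C" "x \<in> U M" using C by blast
      moreover have "M \<le> N" using \<open>M \<in> C\<close> C(2) by (simp add: N_def)
      ultimately show "x \<in> U N" using monoU by blast
    qed
    have sD: "(\<lambda>x. \<Sum>n<N. g n x) \<in> D" by (rule test_funs_sum[OF g(1)])
    have dD: "(\<lambda>x. \<delta> * \<psi> x) \<in> D" by (rule test_funs_scale[OF \<psi>D])
    have "\<Lambda> h \<le> \<Lambda> (\<lambda>x. \<delta> * \<psi> x + (\<Sum>n<N. g n x))"
    proof (rule mono[OF h(1) test_funs_add[OF dD sD]])
      fix x
      have "0 \<le> (\<Sum>n<N. g n x)" using g(2) by (intro sum_nonneg)
      moreover have "h x - \<delta> < (\<Sum>n<N. g n x)" if "x \<in> K"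
        using that \<open>K \<subseteq> U N\<close> by (auto simp: U_def)
      ultimately show "h x \<le> \<delta> * \<psi> x + (\<Sum>n<N. g n x)"
        using \<psi>(5,7)[of x] \<delta>(1) K(3)[of x] by (cases "x \<in> K") auto
    qed
    also have "\<dots> = \<delta> * \<Lambda> \<psi> + (\<Sum>n<N. \<Lambda> (g n))"
      using add[OF dD sD] scale[OF \<psi>D] sum[of "{..<N}" g] g(1) by simp
    also have "\<dots> \<le> e + (\<Sum>n<N. \<Lambda> (g n))" using \<delta>(2) by simp
    finally have "ennreal (\<Lambda> h) \<le> ennreal (e + (\<Sum>n<N. \<Lambda> (g n)))" by (rule ennreal_leI)
    also have "\<dots> = ennreal e + (\<Sum>n<N. ennreal (\<Lambda> (g n)))"
      using \<open>0 < e\<close> \<Lambda>g by (simp add: ennreal_plus sum_nonneg sum_ennreal)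
    also have "\<dots> \<le> ennreal e + (\<Sum>n. ennreal (\<Lambda> (g n)))"
      by (intro add_left_mono sum_le_suminf) auto
    finally show "ennreal (\<Lambda> h) \<le> (\<Sum>n. ennreal (\<Lambda> (g n))) + ennreal e" by (simp add: add.commute)
  qed
qed

text \<open>Together with \<open>outer_le_functional\<close> this traps the value of a test function
  with values in the unit interval between the outer measures of the sets where it equals one and
  where it is nonzero.\<close>

lemma functional_le_outer:
  assumes h: "h \<in> D" "\<And>x. 0 \<le> h x" "\<And>x. h x \<le> 1" "\<And>x. x \<notin> E \<Longrightarrow> h x = 0"
  shows "ennreal (\<Lambda> h) \<le> outer E"
  unfolding outer_def
proof (rule INF_greatest)
  fix g assume g: "g \<in> covers E"
  show "ennreal (\<Lambda> h) \<le> (\<Sum>n. ennreal (\<Lambda> (g n)))"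
  proof (rule functional_le_suminf[OF h(1,2)])
    show "ennreal (h x) \<le> (\<Sum>n. ennreal (g n x))" for x
    proof (cases "x \<in> E")
      case True
      have "ennreal (h x) \<le> 1" using ennreal_leI[OF h(3)] by simp
      also have "\<dots> \<le> (\<Sum>n. ennreal (g n x))" by (rule coversD(3)[OF g True])
      finally show ?thesis .
    qed (simp add: h(4))
  qed (use coversD[OF g] in auto)
qed

lemma outer_le_functional:
  assumes h: "h \<in> D" "\<And>x. 0 \<le> h x" "\<And>x. x \<in> E \<Longrightarrow> 1 \<le> h x"
  shows "outer E \<le> ennreal (\<Lambda> h)"
proof -
  let ?g = "\<lambda>n x. if n = (0::nat) then h x else 0"
  have e: "(\<Sum>n. ennreal (if n = (0::nat) then c else 0)) = ennreal c" for c
    by (subst suminf_finite[of "{0}"]) auto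
  have gD: "?g n \<in> D" for n by (cases "n = 0") (simp_all add: h(1) test_funs_zero)
  have "?g \<in> covers E"
    using h gD ennreal_leI[OF h(3)] by (auto simp: covers_def e)
  moreover have "\<Lambda> (?g n) = (if n = 0 then \<Lambda> h else 0)" for n
    by (cases "n = 0") (simp_all add: zero)
  ultimately show ?thesis using outer_le[of ?g E] by (simp add: e)
qed

lemma outer_compact_finite:
  assumes "compact K" "K \<subseteq> \<Omega>" shows "outer K < \<infinity>"
proof -
  obtain \<psi> L where \<psi>: "smooth \<psi>" "compact L" "L \<subseteq> \<Omega>" "\<And>x. x \<notin> L \<Longrightarrow> \<psi> x = (0::real)"
    "\<And>x. 0 \<le> \<psi> x" "\<And>x. \<psi> x \<le> 1" "\<And>x. x \<in> K \<Longrightarrow> \<psi> x = 1"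
    by (rule smooth_cutoff[OF assms(1) open_\<Omega> assms(2)]) (rule that)
  have "\<psi> \<in> D" by (rule test_funsI[OF \<psi>(1-4)])
  then have "outer K \<le> ennreal (\<Lambda> \<psi>)"
    by (rule outer_le_functional[OF _ \<psi>(5)]) (simp add: \<psi>(7))
  then show ?thesis by (simp add: le_less_trans)
qed

lemma radon_rmeas: "radon_measure_on \<Omega> rmeas"
  unfolding radon_measure_on_def
proof (intro conjI allI impI)
  fix K assume K: "compact K \<and> K \<subseteq> \<Omega>"
  then have "K \<in> sets (restrict_space borel \<Omega>)"
    by (auto simp: sets_restrict_space borel_compact intro!: image_eqI[of _ _ K])
  then show "emeasure rmeas K < \<infinity>"
    using K outer_compact_finite by (simp add: emeasure_rmeas)
qed simp

end

section \<open>Layer-cake comparison of the functional with the integral\<close>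

lemma count_less_bounds:
  fixes t :: real assumes "0 \<le> t"
  shows "min (real J) t \<le> (\<Sum>j<J. if real j < t then 1 else 0)"
    "(\<Sum>j<J. if real j < t then 1 else 0) \<le> min (real J) (t + 1)"
  by (induction J) (use assms in \<open>auto simp: min_def split: if_splits\<close>)

lemma count_le_lower:
  fixes t :: real assumes "0 \<le> t"
  shows "min (real J) (t - 1) \<le> (\<Sum>j<J. if real j + 1 \<le> t then 1 else 0)"
  by (induction J) (use assms in \<open>auto simp: min_def split: if_splits\<close>)

lemma eq_if_close:
  fixes a b C :: real
  assumes "\<And>N. N > 0 \<Longrightarrow> \<bar>a - b\<bar> \<le> C / real N" shows "a = b"
proof (rule ccontr)
  assume "a \<noteq> b"
  then obtain N :: nat where N: "C < real N * \<bar>a - b\<bar>"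
    using reals_Archimedean3[of "\<bar>a - b\<bar>"] by auto
  have "\<bar>a - b\<bar> \<le> C / real (Suc N)" by (rule assms) simp
  then have "real (Suc N) * \<bar>a - b\<bar> \<le> C" by (simp add: field_simps)
  moreover have "real N * \<bar>a - b\<bar> \<le> real (Suc N) * \<bar>a - b\<bar>" by (intro mult_right_mono) auto
  ultimately show False using N by simp
qed

context positive_functional
begin

lemma rmeas_borel_measurable:
  fixes f :: "'a \<Rightarrow> real"
  assumes "f \<in> borel_measurable borel" shows "f \<in> borel_measurable rmeas"
proof -
  have "f \<in> borel_measurable (restrict_space borel \<Omega>)"
    by (rule measurable_restrict_space1[OF assms])
  then show ?thesis by (simp cong: measurable_cong_sets)
qed

text \<open>Layer cake at resolution \<open>1 / real N\<close>: the smooth functions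
  \<open>s j\<close> lie between the indicators of \<open>Y j\<close> and \<open>X j\<close>, so
  their values lie between the measures of these level sets, and summing over \<open>j\<close>
  recovers \<open>real N * f\<close> up to one unit on the support. The functional and the integral,
  both scaled by \<open>N\<close>, thus differ by a bound independent of \<open>N\<close>; dividing
  by \<open>N\<close> removes it.\<close>

lemma functional_eq_integral_nonneg:
  assumes f: "f \<in> D" "\<And>x. 0 \<le> f x"
  shows "integrable rmeas f \<and> \<Lambda> f = (LINT x|rmeas. f x)"
proof -
  obtain K where K: "compact K" "K \<subseteq> \<Omega>" "\<And>x. x \<notin> K \<Longrightarrow> f x = 0"
    by (rule test_funs_support[OF f(1)]) (rule that)
  obtain \<psi> L where \<psi>: "smooth \<psi>" "compact L" "L \<subseteq> \<Omega>" "\<And>x. x \<notin> L \<Longrightarrow> \<psi> x = (0::real)"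
    "\<And>x. 0 \<le> \<psi> x" "\<And>x. \<psi> x \<le> 1" "\<And>x. x \<in> K \<Longrightarrow> \<psi> x = 1"
    by (rule smooth_cutoff[OF K(1) open_\<Omega> K(2)]) (rule that)
  have \<psi>D: "\<psi> \<in> D" by (rule test_funsI[OF \<psi>(1-4)])
  have fm: "f \<in> borel_measurable borel"
    by (intro borel_measurable_continuous_onI smooth_continuous_on test_funs_smooth[OF f(1)])
  have Ks: "K \<in> sets rmeas"
    using K by (auto simp: sets_restrict_space borel_compact intro!: image_eqI[of _ _ K])
  have Kfin: "emeasure rmeas K < \<infinity>"
    using radon_rmeas K by (simp add: radon_measure_on_def)
  have "bounded (f ` K)"
    by (intro compact_imp_bounded compact_continuous_image smooth_continuous_on test_funs_smooth[OF f(1)] K)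
  then obtain B where B: "\<And>x. x \<in> K \<Longrightarrow> f x \<le> B"
    unfolding bounded_iff by (metis abs_le_D1 image_eqI real_norm_def)
  have B': "f x \<le> max B 0" for x
    using B[of x] K(3)[of x] by (cases "x \<in> K") auto
  have sub: "A \<in> sets rmeas \<and> emeasure rmeas A < \<infinity>" if "A \<in> sets borel" "A \<subseteq> K" for A
  proof -
    have "A \<in> sets rmeas"
      using that K(2) by (auto simp: sets_restrict_space intro!: image_eqI[of _ _ A])
    moreover have "emeasure rmeas A \<le> emeasure rmeas K" by (rule emeasure_mono[OF that(2) Ks])
    ultimately show ?thesis using Kfin by (auto simp: le_less_trans)
  qed
  have ind: "integrable rmeas (indicator A :: 'a \<Rightarrow> real) \<and> (LINT x|rmeas. indicator A x) = measure rmeas A"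
    if A: "A \<in> sets borel" "A \<subseteq> K" for A
  proof -
    have "A \<inter> \<Omega> = A" using A(2) K(2) by blast
    then show ?thesis using sub[OF A] by (simp add: integrable_indicator_iff)
  qed
  have Kb: "K \<in> sets borel" using K(1) by (rule borel_compact)
  note indK = conjunct1[OF ind[OF Kb order_refl]]
  have int: "integrable rmeas f"
  proof (rule Bochner_Integration.integrable_bound[of _ "\<lambda>x. max B 0 * indicator K x"])
    show "integrable rmeas (\<lambda>x. max B 0 * indicator K x)" using indK by simp
    show "f \<in> borel_measurable rmeas" by (rule rmeas_borel_measurable[OF fm])
    show "AE x in rmeas. norm (f x) \<le> norm (max B 0 * indicator K x)"
      using B' K(3) f(2) by (intro AE_I2) (auto simp: indicator_def)
  qed
  have close: "\<bar>(LINT x|rmeas. f x) - \<Lambda> f\<bar> \<le> (\<Lambda> \<psi> + measure rmeas K) / real N" if N: "N > 0" for N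
  proof -
    \<comment> \<open>\<open>J\<close> levels reach above the maximum of \<open>real N * f\<close>,
      so the truncation at \<open>real J\<close> in the counting lemmas is harmless.\<close>
    obtain J :: nat where J: "real N * max B 0 \<le> real J" using real_arch_simple by blast
    have tJ: "real N * f x \<le> real J" for x
      using mult_left_mono[OF B'[of x], of "real N"] J by simp
    have t0: "0 \<le> real N * f x" for x using f(2) by simp
    \<comment> \<open>\<open>s j\<close> climbs from zero to one while \<open>real N * f\<close>
      goes from \<open>j\<close> to \<open>j + 1\<close>: it vanishes off \<open>X j\<close> and
      equals one on \<open>Y j\<close>.\<close>
    define X where "X j = {x. real j < real N * f x}" for j :: nat
    define Y where "Y j = {x. real j + 1 \<le> real N * f x}" for j :: nat
    have Xb: "X j \<in> sets borel" "Y j \<in> sets borel" for j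
      unfolding X_def Y_def using fm by measurable
    have XK: "X j \<subseteq> K" "Y j \<subseteq> K" for j
      unfolding X_def Y_def using K(3) by force+
    define s where "s j x = smooth_step (real N * f x - real j)" for j x
    have s0: "0 \<le> s j x" "s j x \<le> 1" for j x by (simp_all add: s_def smooth_step_bounds)
    have sD: "s j \<in> D" for j
      unfolding s_def
    proof (rule test_funs_compose[OF _ _ f(1), of "\<lambda>t. smooth_step (real N * t - real j)"])
      show "smooth (\<lambda>t. smooth_step (real N * t - real j))"
        by (intro smooth_compose[OF smooth_step(1)] smooth_diff smooth_mult smooth_const
            smooth_linear bounded_linear_ident)
    qed (simp add: smooth_step)
    have sX: "s j x = 0" if "x \<notin> X j" for j x
      using that by (simp add: s_def X_def smooth_step)
    have sY: "1 \<le> s j x" if "x \<in> Y j" for j x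
      using that by (simp add: s_def Y_def smooth_step)
    have \<Lambda>s0: "0 \<le> \<Lambda> (s j)" for j by (rule pos[OF sD s0(1)])
    have mX: "\<Lambda> (s j) \<le> measure rmeas (X j)" for j
    proof -
      have "ennreal (\<Lambda> (s j)) \<le> emeasure rmeas (X j)"
        using functional_le_outer[OF sD s0 sX] sub[OF Xb(1) XK(1)] by (simp add: emeasure_rmeas)
      then show ?thesis
        using sub[OF Xb(1) XK(1), of j] \<Lambda>s0 by (simp add: emeasure_eq_ennreal_measure less_top)
    qed
    have mY: "measure rmeas (Y j) \<le> \<Lambda> (s j)" for j
    proof -
      have "emeasure rmeas (Y j) \<le> ennreal (\<Lambda> (s j))"
        using outer_le_functional[OF sD s0(1) sY] sub[OF Xb(2) XK(2)] by (simp add: emeasure_rmeas)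
      then show ?thesis
        using sub[OF Xb(2) XK(2), of j] \<Lambda>s0 by (simp add: emeasure_eq_ennreal_measure less_top)
    qed
    have iX: "integrable rmeas (indicator (X j) :: 'a \<Rightarrow> real)" "integrable rmeas (indicator (Y j) :: 'a \<Rightarrow> real)" for j
      using ind[OF Xb(1) XK(1)] ind[OF Xb(2) XK(2)] by auto
    have sX_le: "s j x \<le> indicator (X j) x" "indicator (Y j) x \<le> s j x" for j x
      using sX[of x j] sY[of x j] s0[of j x] by (auto simp: indicator_def)
    have Ysum: "(\<Sum>j<J. indicator (Y j) x) = (\<Sum>j<J. if real j + 1 \<le> real N * f x then 1 else (0::real))" for x
      by (rule sum.cong[OF refl]) (simp add: indicator_def Y_def)
    have Xsum: "(\<Sum>j<J. indicator (X j) x) = (\<Sum>j<J. if real j < real N * f x then 1 else (0::real))" for x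
      by (rule sum.cong[OF refl]) (simp add: indicator_def X_def)
    have up: "real N * f x \<le> (\<Sum>j<J. indicator (Y j) x) + indicator K x" for x
    proof (cases "x \<in> K")
      case True
      have "min (real J) (real N * f x - 1) = real N * f x - 1" using tJ[of x] by simp
      then show ?thesis
        using count_le_lower[OF t0, of J x] True unfolding Ysum by (simp only: indicator_simps; linarith)
    next
      case False
      have "0 \<le> (\<Sum>j<J. indicator (Y j) x :: real)" by (rule sum_nonneg) simp
      then show ?thesis using False K(3)[OF False] by simp
    qed
    have lo: "(\<Sum>j<J. indicator (X j) x) - indicator K x \<le> real N * f x" for x
    proof (cases "x \<in> K")
      case True
      then show ?thesis
        using count_less_bounds(2)[OF t0[of x], of J] unfolding Xsum by (simp only: indicator_simps; linarith)
    next
      case False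
      then have "x \<notin> X j" for j using XK(1) by blast
      then show ?thesis using False t0[of x] by (simp add: indicator_def)
    qed
    have sum_up: "real N * f x - \<psi> x \<le> (\<Sum>j<J. s j x)" for x
    proof -
      have "(\<Sum>j<J. indicator (Y j) x) \<le> (\<Sum>j<J. s j x)" by (intro sum_mono sX_le)
      moreover have "indicator K x \<le> \<psi> x" using \<psi>(5,7)[of x] by (auto simp: indicator_def)
      ultimately show ?thesis using up[of x] by linarith
    qed
    have sum_lo: "(\<Sum>j<J. s j x) \<le> real N * f x + \<psi> x" for x
    proof -
      have "(\<Sum>j<J. s j x) \<le> (\<Sum>j<J. indicator (X j) x)" by (intro sum_mono sX_le)
      moreover have "indicator K x \<le> \<psi> x" using \<psi>(5,7)[of x] by (auto simp: indicator_def)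
      ultimately show ?thesis using lo[of x] by linarith
    qed
    have ND: "(\<lambda>x. real N * f x) \<in> D" by (rule test_funs_scale[OF f(1)])
    have sumD: "(\<lambda>x. \<Sum>j<J. s j x) \<in> D" by (rule test_funs_sum[OF sD])
    have \<Lambda>sum: "\<Lambda> (\<lambda>x. \<Sum>j<J. s j x) = (\<Sum>j<J. \<Lambda> (s j))" by (rule sum) (simp_all add: sD)
    have \<Lambda>1: "(\<Sum>j<J. \<Lambda> (s j)) \<le> real N * \<Lambda> f + \<Lambda> \<psi>"
      using mono[OF sumD test_funs_add[OF ND \<psi>D] sum_lo] add[OF ND \<psi>D] scale[OF f(1)] \<Lambda>sum by simp
    have \<Lambda>2: "real N * \<Lambda> f \<le> (\<Sum>j<J. \<Lambda> (s j)) + \<Lambda> \<psi>"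
    proof -
      have "\<Lambda> (\<lambda>x. real N * f x) \<le> \<Lambda> (\<lambda>x. (\<Sum>j<J. s j x) + \<psi> x)"
        by (rule mono[OF ND test_funs_add[OF sumD \<psi>D]]) (use sum_up in \<open>simp add: diff_le_eq\<close>)
      then show ?thesis using add[OF sumD \<psi>D] scale[OF f(1)] \<Lambda>sum by simp
    qed
    have I1: "real N * (LINT x|rmeas. f x) \<le> (\<Sum>j<J. measure rmeas (Y j)) + measure rmeas K"
    proof -
      have "(LINT x|rmeas. real N * f x) \<le> (LINT x|rmeas. (\<Sum>j<J. indicator (Y j) x) + indicator K x)"
        by (intro integral_mono up) (use int iX indK in auto)
      also have "\<dots> = (\<Sum>j<J. measure rmeas (Y j)) + measure rmeas K"
        using iX indK ind[OF Xb(2) XK(2)] ind[OF Kb order_refl] by simp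
      finally show ?thesis by simp
    qed
    have I2: "(\<Sum>j<J. measure rmeas (X j)) - measure rmeas K \<le> real N * (LINT x|rmeas. f x)"
    proof -
      have "(LINT x|rmeas. (\<Sum>j<J. indicator (X j) x) - indicator K x) \<le> (LINT x|rmeas. real N * f x)"
        by (intro integral_mono lo) (use int iX indK in auto)
      moreover have "(LINT x|rmeas. (\<Sum>j<J. indicator (X j) x) - indicator K x)
          = (\<Sum>j<J. measure rmeas (X j)) - measure rmeas K"
        using iX indK ind[OF Xb(1) XK(1)] ind[OF Kb order_refl] by simp
      ultimately show ?thesis by simp
    qed
    have "(\<Sum>j<J. measure rmeas (Y j)) \<le> (\<Sum>j<J. \<Lambda> (s j))" "(\<Sum>j<J. \<Lambda> (s j)) \<le> (\<Sum>j<J. measure rmeas (X j))"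
      by (intro sum_mono mX mY)+
    then have "\<bar>real N * ((LINT x|rmeas. f x) - \<Lambda> f)\<bar> \<le> \<Lambda> \<psi> + measure rmeas K"
      using I1 I2 \<Lambda>1 \<Lambda>2 unfolding right_diff_distrib abs_le_iff by linarith
    then have "real N * \<bar>(LINT x|rmeas. f x) - \<Lambda> f\<bar> \<le> \<Lambda> \<psi> + measure rmeas K"
      by (simp only: abs_mult abs_of_nat)
    then show ?thesis using N by (simp add: pos_le_divide_eq mult.commute)
  qed
  have "(LINT x|rmeas. f x) = \<Lambda> f" by (rule eq_if_close[OF close])
  then show ?thesis using int by simp
qed

text \<open>Adding a multiple of a cutoff makes \<open>f\<close> nonnegative; the formulas for the
  sum and for the multiple are then subtracted.\<close>

lemma functional_eq_integral:
  assumes f: "f \<in> D"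
  shows "integrable rmeas f \<and> \<Lambda> f = (LINT x|rmeas. f x)"
proof -
  obtain K where K: "compact K" "K \<subseteq> \<Omega>" "\<And>x. x \<notin> K \<Longrightarrow> f x = 0"
    by (rule test_funs_support[OF f(1)]) (rule that)
  obtain \<psi> L where \<psi>: "smooth \<psi>" "compact L" "L \<subseteq> \<Omega>" "\<And>x. x \<notin> L \<Longrightarrow> \<psi> x = (0::real)"
    "\<And>x. 0 \<le> \<psi> x" "\<And>x. \<psi> x \<le> 1" "\<And>x. x \<in> K \<Longrightarrow> \<psi> x = 1"
    by (rule smooth_cutoff[OF K(1) open_\<Omega> K(2)]) (rule that)
  have \<psi>D: "\<psi> \<in> D" by (rule test_funsI[OF \<psi>(1-4)])
  have "bounded (f ` K)"
    by (intro compact_imp_bounded compact_continuous_image smooth_continuous_on test_funs_smooth[OF f(1)] K)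
  then obtain B where B: "\<And>x. x \<in> K \<Longrightarrow> \<bar>f x\<bar> \<le> B"
    unfolding bounded_iff by (metis image_eqI real_norm_def)
  define C where "C = max B 0"
  have pos1: "0 \<le> f x + C * \<psi> x" for x
    using B[of x] K(3)[of x] \<psi>(5,7)[of x] by (cases "x \<in> K") (auto simp: C_def max_def)
  have cD: "(\<lambda>x. C * \<psi> x) \<in> D" by (rule test_funs_scale[OF \<psi>D])
  have pos2: "0 \<le> C * \<psi> x" for x by (simp add: C_def \<psi>(5))
  note 1 = functional_eq_integral_nonneg[OF test_funs_add[OF f cD] pos1]
  note 2 = functional_eq_integral_nonneg[OF cD pos2]
  have e: "f = (\<lambda>x. (f x + C * \<psi> x) - C * \<psi> x)" by simp
  have "integrable rmeas (\<lambda>x. (f x + C * \<psi> x) - C * \<psi> x)"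
    using 1 2 by (intro Bochner_Integration.integrable_diff) auto
  then have int: "integrable rmeas f" by simp
  have "\<Lambda> f = (LINT x|rmeas. f x + C * \<psi> x) - (LINT x|rmeas. C * \<psi> x)"
    using 1 2 add[OF f cD] by simp
  also have "\<dots> = (LINT x|rmeas. f x)"
    using int 2 by (subst Bochner_Integration.integral_add) auto
  finally show ?thesis using int by simp
qed

end

theorem riesz_smooth:
  assumes "positive_functional \<Omega> \<Lambda>"
  obtains \<mu> where "radon_measure_on \<Omega> \<mu>" "\<And>f. f \<in> test_funs \<Omega> \<Longrightarrow> integrable \<mu> f"
    "\<And>f. f \<in> test_funs \<Omega> \<Longrightarrow> \<Lambda> f = (LINT x|\<mu>. f x)"
  using positive_functional.radon_rmeas[OF assms] positive_functional.functional_eq_integral[OF assms] that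
  by blast

section \<open>Coefficients of positive currents\<close>

lemma current_zero:
  assumes "current \<Omega> p (T :: 'n::{finite,linorder} functional)" "p + m = 2 * CARD('n)"
  shows "T (\<lambda>x. 0) = 0"
proof -
  have "(\<lambda>x. 0) \<in> test_forms \<Omega> m"
    by (rule test_formsI[of _ _ "{}"]) auto
  from current_smult[OF assms this, of 0] show ?thesis by simp
qed

lemma test_forms_sum:
  "(\<And>i. i \<in> A \<Longrightarrow> \<phi> i \<in> test_forms \<Omega> m) \<Longrightarrow> (\<lambda>x. \<Sum>i\<in>A. \<phi> i x) \<in> test_forms \<Omega> m"
proof (induction A rule: infinite_finite_induct)
  case (insert i A)
  then show ?case using test_forms_add[of "\<phi> i" \<Omega> m "\<lambda>x. \<Sum>i\<in>A. \<phi> i x"] by simp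
qed (auto intro: test_formsI[of _ _ "{}"])

lemma current_sum:
  assumes T: "current \<Omega> p (T :: 'n::{finite,linorder} functional)" "p + m = 2 * CARD('n)"
    and "finite A" "\<And>i. i \<in> A \<Longrightarrow> \<phi> i \<in> test_forms \<Omega> m"
  shows "T (\<lambda>x. \<Sum>i\<in>A. \<phi> i x) = (\<Sum>i\<in>A. T (\<phi> i))"
  using assms(3,4)
proof (induction A rule: finite_induct)
  case (insert i A)
  then show ?case
    using current_add[OF T, of "\<phi> i" "\<lambda>x. \<Sum>i\<in>A. \<phi> i x"] test_forms_sum[of A \<phi> \<Omega> m] by simp
qed (simp add: current_zero[OF T])

lemma test_forms_scaleR_const:
  assumes "f \<in> test_funs \<Omega>" "X \<in> ext_power m" shows "(\<lambda>x. f x *\<^sub>R X) \<in> test_forms \<Omega> m"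
proof -
  obtain K where "compact K" "K \<subseteq> \<Omega>" "\<And>x. x \<notin> K \<Longrightarrow> f x = 0"
    by (rule test_funs_support[OF assms(1)]) (rule that)
  then show ?thesis
    using assms(2)
    by (intro test_formsI[of _ _ K] smooth_scaleR test_funs_smooth[OF assms(1)] smooth_const ext_power_scaleR) auto
qed

lemma positive_currentD:
  assumes "positive_current \<Omega> k (T :: 'n::{finite,linorder} functional)" "2 * CARD('n) - 2 * k = m"
    "\<phi> \<in> test_forms \<Omega> m" "\<And>x. \<phi> x \<in> SP (CARD('n) - k)"
  shows "T \<phi> \<in> nonneg_Reals"
  using assms by (auto simp: positive_current_def)

lemma shuffle_sign_square: "shuffle_sign I J * shuffle_sign I J = 1"
  by (simp add: shuffle_sign_def flip: power_add power_mult_distrib)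

text \<open>Since \<open>\<omega> (- I)\<close> is a complex combination of strongly positive
  elements \<open>a\<close>, the coefficient is a combination of the positive functionals
  \<open>f \<mapsto> T (f a)\<close>. The positive and negative parts of the real and imaginary
  parts of the weights give four positive functionals and hence four Radon measures. The test
  function is written as \<open>f + \<i> g\<close> because the representation theorem concerns real
  functions.\<close>

lemma coefficient_measure:
  fixes T :: "'n::{finite,linorder} functional"
  assumes op: "open \<Omega>" and T: "current \<Omega> (2 * k) T" "positive_current \<Omega> k T" and I: "card I = 2 * k"
  shows "\<exists>\<mu>. complex_radon_measure_on \<Omega> \<mu> \<and> (\<forall>f\<in>test_funs \<Omega>. \<forall>g\<in>test_funs \<Omega>.
     shuffle_sign I (- I) * cmeasure_integral \<mu> (\<lambda>x. of_real (f x) + \<i> * of_real (g x))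
       = T (\<lambda>x. f x *\<^sub>R \<omega> (- I)) + \<i> * T (\<lambda>x. g x *\<^sub>R \<omega> (- I)))"
proof -
  define m where "m = CARD('n) - k"
  have k: "2 * k \<le> 2 * CARD('n)" using T(1) by (simp add: current_def Let_def)
  then have km: "2 * k + 2 * m = 2 * CARD('n)" by (simp add: m_def)
  have km': "2 * CARD('n) - 2 * k = 2 * m" by (simp add: m_def)
  have "card (- I) = 2 * m"
    using km' I by (simp add: Compl_eq_Diff_UNIV card_Diff_subset)
  then have "\<omega> (- I) \<in> spSP m" by (rule \<omega>_span)
  then obtain t u where t: "finite t" "t \<subseteq> SP m" "\<omega> (- I) = (\<Sum>a\<in>t. u a *s a)"
    unfolding vec.span_explicit by blast
  define s where "s = shuffle_sign I (- I)"
  have s: "s * s = 1" by (simp add: s_def shuffle_sign_square)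
  have form: "(\<lambda>x. f x *\<^sub>R a) \<in> test_forms \<Omega> (2 * m)" if "f \<in> test_funs \<Omega>" "a \<in> t" for f a
    using that t(2) SP_ext_power by (intro test_forms_scaleR_const) auto
  \<comment> \<open>\<open>f\<close> is the difference of the nonnegative test functions
    \<open>f + C \<psi>\<close> and \<open>C \<psi>\<close>, and on the products of both with
    \<open>a\<close> the current has nonnegative real values.\<close>
  have real: "T (\<lambda>x. f x *\<^sub>R a) \<in> \<real>" if fD: "f \<in> test_funs \<Omega>" and a: "a \<in> t" for f a
  proof -
    obtain K where K: "compact K" "K \<subseteq> \<Omega>" "\<And>x. x \<notin> K \<Longrightarrow> f x = 0"
      by (rule test_funs_support[OF fD]) (rule that)
    obtain \<psi> L where \<psi>: "smooth \<psi>" "compact L" "L \<subseteq> \<Omega>" "\<And>x. x \<notin> L \<Longrightarrow> \<psi> x = (0::real)"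
      "\<And>x. 0 \<le> \<psi> x" "\<And>x. \<psi> x \<le> 1" "\<And>x. x \<in> K \<Longrightarrow> \<psi> x = 1"
      by (rule smooth_cutoff[OF K(1) op K(2)]) (rule that)
    have \<psi>D: "\<psi> \<in> test_funs \<Omega>" by (rule test_funsI[OF \<psi>(1-4)])
    have "bounded (f ` K)"
      by (intro compact_imp_bounded compact_continuous_image smooth_continuous_on test_funs_smooth[OF fD] K)
    then obtain B where B: "\<forall>y\<in>f ` K. norm y \<le> B" unfolding bounded_iff by blast
    define C where "C = max B 0"
    have p1: "0 \<le> f x + C * \<psi> x" for x
      using B K(3)[of x] \<psi>(5,7)[of x] by (cases "x \<in> K") (force simp: C_def max_def)+
    have cD: "(\<lambda>x. C * \<psi> x) \<in> test_funs \<Omega>" by (rule test_funs_scale[OF \<psi>D])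
    have fcD: "(\<lambda>x. f x + C * \<psi> x) \<in> test_funs \<Omega>" by (rule test_funs_add[OF fD cD])
    have nn: "T (\<lambda>x. h x *\<^sub>R a) \<in> nonneg_Reals" if "h \<in> test_funs \<Omega>" "\<And>x. 0 \<le> h x" for h
    proof -
      have "h x *\<^sub>R a \<in> SP (CARD('n) - k)" for x
        using that(2) t(2) a unfolding m_def by (intro SP_scaleR) auto
      then show ?thesis
        by (rule positive_currentD[OF T(2) km' form[OF that(1) a]])
    qed
    have "T (\<lambda>x. f x *\<^sub>R a + (C * \<psi> x) *\<^sub>R a) = T (\<lambda>x. f x *\<^sub>R a) + T (\<lambda>x. (C * \<psi> x) *\<^sub>R a)"
      by (rule current_add[OF T(1) km form[OF fD a] form[OF cD a]])
    then have "T (\<lambda>x. f x *\<^sub>R a) = T (\<lambda>x. (f x + C * \<psi> x) *\<^sub>R a) - T (\<lambda>x. (C * \<psi> x) *\<^sub>R a)"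
      by (simp add: scaleR_add_left)
    moreover have "T (\<lambda>x. (f x + C * \<psi> x) *\<^sub>R a) \<in> \<real>" "T (\<lambda>x. (C * \<psi> x) *\<^sub>R a) \<in> \<real>"
      using nn[OF fcD p1] nn[OF cD] \<psi>(5) nonneg_Reals_subset_Reals by (auto simp: C_def)
    ultimately show ?thesis by simp
  qed
  have T_eq: "T (\<lambda>x. f x *\<^sub>R \<omega> (- I)) = (\<Sum>a\<in>t. u a * T (\<lambda>x. f x *\<^sub>R a))" if f: "f \<in> test_funs \<Omega>" for f
  proof -
    have "(\<lambda>x. f x *\<^sub>R \<omega> (- I)) = (\<lambda>x. \<Sum>a\<in>t. u a *s (f x *\<^sub>R a))"
      unfolding t(3) scaleR_eq_smult by (simp add: smult_sum_right vector_smult_assoc mult.commute)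
    then have "T (\<lambda>x. f x *\<^sub>R \<omega> (- I)) = (\<Sum>a\<in>t. T (\<lambda>x. u a *s (f x *\<^sub>R a)))"
      using current_sum[OF T(1) km t(1), of "\<lambda>a x. u a *s (f x *\<^sub>R a)"] test_forms_smult[OF form[OF f]] by simp
    also have "\<dots> = (\<Sum>a\<in>t. u a * T (\<lambda>x. f x *\<^sub>R a))"
      by (intro sum.cong refl current_smult[OF T(1) km] form[OF f])
    finally show ?thesis .
  qed
  define \<Lambda> where "\<Lambda> r f = (\<Sum>a\<in>t. r a * Re (T (\<lambda>x. f x *\<^sub>R a)))" for r :: "'n ext \<Rightarrow> real" and f
  have pf: "positive_functional \<Omega> (\<Lambda> r)" if r: "\<And>a. 0 \<le> r a" for r
  proof
    show "open \<Omega>" by (rule op)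
    fix f g c assume f: "f \<in> test_funs \<Omega>"
    have "T (\<lambda>x. (c * f x) *\<^sub>R a) = of_real c * T (\<lambda>x. f x *\<^sub>R a)" if "a \<in> t" for a
      using current_smult[OF T(1) km form[OF f that], of "of_real c"]
      by (simp add: scaleR_eq_smult vector_smult_assoc)
    then show "\<Lambda> r (\<lambda>x. c * f x) = c * \<Lambda> r f"
      unfolding \<Lambda>_def sum_distrib_left by (intro sum.cong) (auto simp: mult_ac)
    show "0 \<le> \<Lambda> r f" if "\<And>x. 0 \<le> f x"
    proof -
      have "0 \<le> Re (T (\<lambda>x. f x *\<^sub>R a))" if a: "a \<in> t" for a
      proof -
        have "f x *\<^sub>R a \<in> SP (CARD('n) - k)" for x
          using \<open>\<And>x. 0 \<le> f x\<close> t(2) a unfolding m_def by (intro SP_scaleR) auto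
        then have "T (\<lambda>x. f x *\<^sub>R a) \<in> nonneg_Reals"
          by (rule positive_currentD[OF T(2) km' form[OF f a]])
        then show ?thesis by (auto simp: complex_nonneg_Reals_iff)
      qed
      then show ?thesis unfolding \<Lambda>_def by (intro sum_nonneg mult_nonneg_nonneg r)
    qed
    assume g: "g \<in> test_funs \<Omega>"
    have "T (\<lambda>x. (f x + g x) *\<^sub>R a) = T (\<lambda>x. f x *\<^sub>R a) + T (\<lambda>x. g x *\<^sub>R a)" if "a \<in> t" for a
      using current_add[OF T(1) km form[OF f that] form[OF g that]] by (simp add: scaleR_add_left)
    then show "\<Lambda> r (\<lambda>x. f x + g x) = \<Lambda> r f + \<Lambda> r g"
      unfolding \<Lambda>_def sum.distrib[symmetric] by (intro sum.cong) (auto simp: algebra_simps)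
  qed
  have riesz: "\<exists>\<mu>. radon_measure_on \<Omega> \<mu> \<and> (\<forall>f\<in>test_funs \<Omega>. integrable \<mu> f \<and> \<Lambda> r f = (LINT x|\<mu>. f x))"
    if "\<And>a. 0 \<le> r a" for r
    by (rule riesz_smooth[OF pf[of r, OF that]]) blast
  \<comment> \<open>The shuffle sign \<open>s\<close> is built into the weights. The claimed
    identity multiplies by it once more, and its square is one.\<close>
  define r1 where "r1 a = max (Re (s * u a)) 0" for a
  define r2 where "r2 a = max (- Re (s * u a)) 0" for a
  define r3 where "r3 a = max (Im (s * u a)) 0" for a
  define r4 where "r4 a = max (- Im (s * u a)) 0" for a
  have r_nonneg: "0 \<le> r1 a" "0 \<le> r2 a" "0 \<le> r3 a" "0 \<le> r4 a" for a
    by (simp_all add: r1_def r2_def r3_def r4_def)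
  obtain \<mu>1 where \<mu>1: "radon_measure_on \<Omega> \<mu>1" "\<And>f. f \<in> test_funs \<Omega> \<Longrightarrow> integrable \<mu>1 f \<and> \<Lambda> r1 f = (LINT x|\<mu>1. f x)"
    using riesz[of r1, OF r_nonneg(1)] by blast
  obtain \<mu>2 where \<mu>2: "radon_measure_on \<Omega> \<mu>2" "\<And>f. f \<in> test_funs \<Omega> \<Longrightarrow> integrable \<mu>2 f \<and> \<Lambda> r2 f = (LINT x|\<mu>2. f x)"
    using riesz[of r2, OF r_nonneg(2)] by blast
  obtain \<mu>3 where \<mu>3: "radon_measure_on \<Omega> \<mu>3" "\<And>f. f \<in> test_funs \<Omega> \<Longrightarrow> integrable \<mu>3 f \<and> \<Lambda> r3 f = (LINT x|\<mu>3. f x)"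
    using riesz[of r3, OF r_nonneg(3)] by blast
  obtain \<mu>4 where \<mu>4: "radon_measure_on \<Omega> \<mu>4" "\<And>f. f \<in> test_funs \<Omega> \<Longrightarrow> integrable \<mu>4 f \<and> \<Lambda> r4 f = (LINT x|\<mu>4. f x)"
    using riesz[of r4, OF r_nonneg(4)] by blast
  define \<mu> where "\<mu> = (\<mu>1, \<mu>2, \<mu>3, \<mu>4)"
  define c where "c f = (\<Sum>a\<in>t. s * u a * T (\<lambda>x. f x *\<^sub>R a))" for f
  have c_eq: "of_real (\<Lambda> r1 f) - of_real (\<Lambda> r2 f) + \<i> * (of_real (\<Lambda> r3 f) - of_real (\<Lambda> r4 f)) = c f"
    if f: "f \<in> test_funs \<Omega>" for f
  proof -
    have "r1 a - r2 a = Re (s * u a)" "r3 a - r4 a = Im (s * u a)" for a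
      by (auto simp: r1_def r2_def r3_def r4_def max_def)
    then have d: "\<Lambda> r1 f - \<Lambda> r2 f = \<Lambda> (\<lambda>a. Re (s * u a)) f" "\<Lambda> r3 f - \<Lambda> r4 f = \<Lambda> (\<lambda>a. Im (s * u a)) f"
      unfolding \<Lambda>_def sum_subtractf[symmetric] by (simp_all add: left_diff_distrib[symmetric])
    have "of_real (\<Lambda> (\<lambda>a. Re (s * u a)) f) + \<i> * of_real (\<Lambda> (\<lambda>a. Im (s * u a)) f)
      = (\<Sum>a\<in>t. of_real (Re (s * u a)) * of_real (Re (T (\<lambda>x. f x *\<^sub>R a)))
        + \<i> * of_real (Im (s * u a)) * of_real (Re (T (\<lambda>x. f x *\<^sub>R a))))"
      by (simp add: \<Lambda>_def sum.distrib sum_distrib_left mult.assoc)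
    also have "\<dots> = c f"
      unfolding c_def
    proof (rule sum.cong[OF refl])
      fix a assume a: "a \<in> t"
      have "T (\<lambda>x. f x *\<^sub>R a) = of_real (Re (T (\<lambda>x. f x *\<^sub>R a)))" using real[OF f a] by simp
      moreover have "s * u a = of_real (Re (s * u a)) + \<i> * of_real (Im (s * u a))"
        by (rule complex_eq)
      ultimately show "of_real (Re (s * u a)) * of_real (Re (T (\<lambda>x. f x *\<^sub>R a)))
        + \<i> * of_real (Im (s * u a)) * of_real (Re (T (\<lambda>x. f x *\<^sub>R a))) = s * u a * T (\<lambda>x. f x *\<^sub>R a)"
        by (metis distrib_right)
    qed
    finally show ?thesis using d by (simp flip: of_real_diff)
  qed
  have "s * cmeasure_integral \<mu> (\<lambda>x. of_real (f x) + \<i> * of_real (g x))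
      = T (\<lambda>x. f x *\<^sub>R \<omega> (- I)) + \<i> * T (\<lambda>x. g x *\<^sub>R \<omega> (- I))"
    if f: "f \<in> test_funs \<Omega>" and g: "g \<in> test_funs \<Omega>" for f g
  proof -
    have L: "(LINT x|M. complex_of_real (f x) + \<i> * of_real (g x)) = of_real (LINT x|M. f x) + \<i> * of_real (LINT x|M. g x)"
      if "integrable M f" "integrable M g" for M
      using that by (subst Bochner_Integration.integral_add) (auto intro!: integrable_mult_right)
    have "cmeasure_integral \<mu> (\<lambda>x. of_real (f x) + \<i> * of_real (g x)) = c f + \<i> * c g"
      using \<mu>1(2)[OF f] \<mu>1(2)[OF g] \<mu>2(2)[OF f] \<mu>2(2)[OF g] \<mu>3(2)[OF f] \<mu>3(2)[OF g] \<mu>4(2)[OF f] \<mu>4(2)[OF g]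
      by (simp add: cmeasure_integral_def \<mu>_def L c_eq[OF f, symmetric] c_eq[OF g, symmetric] algebra_simps)
    moreover have "s * c h = T (\<lambda>x. h x *\<^sub>R \<omega> (- I))" if "h \<in> test_funs \<Omega>" for h
      unfolding T_eq[OF that] c_def sum_distrib_left by (simp add: mult.assoc[symmetric] s)
    ultimately show ?thesis using f g by (simp add: distrib_left mult.left_commute)
  qed
  moreover have "complex_radon_measure_on \<Omega> \<mu>"
    using \<mu>1 \<mu>2 \<mu>3 \<mu>4 by (simp add: complex_radon_measure_on_def \<mu>_def)
  ultimately show ?thesis unfolding s_def by blast
qed

lemma test_forms_component:
  assumes "\<phi> \<in> test_forms \<Omega> m"
  shows "(\<lambda>x. Re (\<phi> x $ J)) \<in> test_funs \<Omega>" "(\<lambda>x. Im (\<phi> x $ J)) \<in> test_funs \<Omega>"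
proof -
  obtain K where K: "compact K" "K \<subseteq> \<Omega>" "\<And>x. x \<notin> K \<Longrightarrow> \<phi> x = 0"
    using test_formsD(3)[OF assms] by auto
  have s: "smooth (\<lambda>x. \<phi> x $ J)"
    by (rule smooth_linear_compose[OF bounded_linear_nth test_formsD(1)[OF assms]])
  show "(\<lambda>x. Re (\<phi> x $ J)) \<in> test_funs \<Omega>" "(\<lambda>x. Im (\<phi> x $ J)) \<in> test_funs \<Omega>"
    by (rule test_funsI[OF smooth_linear_compose[OF bounded_linear_Re s] K(1,2)], simp add: K(3))
      (rule test_funsI[OF smooth_linear_compose[OF bounded_linear_Im s] K(1,2)], simp add: K(3))
qed

lemma has_coefficients_exists:
  fixes T :: "'n::{finite,linorder} functional"
  assumes op: "open \<Omega>" and T: "current \<Omega> (2 * k) T" "positive_current \<Omega> k T"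
  shows "\<exists>\<mu>. has_coefficients \<Omega> (2 * k) T \<mu>"
proof -
  define m where "m = 2 * CARD('n) - 2 * k"
  have k: "2 * k \<le> 2 * CARD('n)" using T(1) by (simp add: current_def Let_def)
  then have km: "2 * k + m = 2 * CARD('n)" by (simp add: m_def)
  define P where "P I \<mu> \<longleftrightarrow> complex_radon_measure_on \<Omega> \<mu> \<and> (\<forall>f\<in>test_funs \<Omega>. \<forall>g\<in>test_funs \<Omega>.
     shuffle_sign I (- I) * cmeasure_integral \<mu> (\<lambda>x. of_real (f x) + \<i> * of_real (g x))
       = T (\<lambda>x. f x *\<^sub>R \<omega> (- I)) + \<i> * T (\<lambda>x. g x *\<^sub>R \<omega> (- I)))" for I \<mu>
  define \<mu> where "\<mu> I = (SOME \<mu>. P I \<mu>)" for I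
  have \<mu>: "P I (\<mu> I)" if "card I = 2 * k" for I
    unfolding \<mu>_def using coefficient_measure[OF op T that] unfolding P_def by (rule someI_ex)
  have "T \<phi> = pairing (2 * k) \<mu> \<phi>" if \<phi>: "\<phi> \<in> test_forms \<Omega> m" for \<phi>
  proof -
    define \<CC> where "\<CC> = {J :: 'n idx set. card J = m}"
    let ?f = "\<lambda>J x. Re (\<phi> x $ J)" and ?g = "\<lambda>J x. Im (\<phi> x $ J)"
    have \<omega>: "\<omega> J \<in> ext_power m" if "J \<in> \<CC>" for J
      using that by (auto simp: \<CC>_def ext_power_def \<omega>_def axis_def)
    have form: "(\<lambda>x. h x *\<^sub>R \<omega> J) \<in> test_forms \<Omega> m" if "h \<in> test_funs \<Omega>" "J \<in> \<CC>" for h J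
      by (rule test_forms_scaleR_const[OF that(1) \<omega>[OF that(2)]])
    have "\<phi> x = (\<Sum>J\<in>\<CC>. ?f J x *\<^sub>R \<omega> J + \<i> *s (?g J x *\<^sub>R \<omega> J))" for x
    proof -
      have "\<phi> x = (\<Sum>J\<in>UNIV. (\<phi> x $ J) *s \<omega> J)" by (rule ext_expand[symmetric])
      also have "\<dots> = (\<Sum>J\<in>\<CC>. (\<phi> x $ J) *s \<omega> J)"
      proof (rule sum.mono_neutral_right)
        have "\<phi> x $ J = 0" if "J \<notin> \<CC>" for J
          using test_formsD(2)[OF \<phi>, of x] that by (auto simp: \<CC>_def ext_power_def)
        then show "\<forall>J\<in>UNIV - \<CC>. (\<phi> x $ J) *s \<omega> J = 0" by simp
      qed auto
      also have "\<dots> = (\<Sum>J\<in>\<CC>. ?f J x *\<^sub>R \<omega> J + \<i> *s (?g J x *\<^sub>R \<omega> J))"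
        unfolding scaleR_eq_smult vector_smult_assoc vector_sadd_rdistrib[symmetric] complex_eq[symmetric] ..
      finally show ?thesis .
    qed
    then have "T \<phi> = T (\<lambda>x. \<Sum>J\<in>\<CC>. ?f J x *\<^sub>R \<omega> J + \<i> *s (?g J x *\<^sub>R \<omega> J))"
      by (metis (no_types, lifting) ext)
    also have "\<dots> = (\<Sum>J\<in>\<CC>. T (\<lambda>x. ?f J x *\<^sub>R \<omega> J + \<i> *s (?g J x *\<^sub>R \<omega> J)))"
      by (rule current_sum[OF T(1) km])
        (auto intro!: test_forms_add test_forms_smult form test_forms_component[OF \<phi>])
    also have "\<dots> = (\<Sum>J\<in>\<CC>. T (\<lambda>x. ?f J x *\<^sub>R \<omega> J) + \<i> * T (\<lambda>x. ?g J x *\<^sub>R \<omega> J))"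
    proof (rule sum.cong[OF refl])
      fix J assume J: "J \<in> \<CC>"
      note f = form[OF test_forms_component(1)[OF \<phi>] J] and g = form[OF test_forms_component(2)[OF \<phi>] J]
      show "T (\<lambda>x. ?f J x *\<^sub>R \<omega> J + \<i> *s (?g J x *\<^sub>R \<omega> J)) = T (\<lambda>x. ?f J x *\<^sub>R \<omega> J) + \<i> * T (\<lambda>x. ?g J x *\<^sub>R \<omega> J)"
        using current_add[OF T(1) km f test_forms_smult[OF g]] current_smult[OF T(1) km g] by simp
    qed
    \<comment> \<open>Complementation exchanges the multi-indices of the test form with those of the
      current.\<close>
    also have "\<dots> = (\<Sum>I | card I = 2 * k. T (\<lambda>x. ?f (- I) x *\<^sub>R \<omega> (- I)) + \<i> * T (\<lambda>x. ?g (- I) x *\<^sub>R \<omega> (- I)))"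
    proof (rule sum.reindex_bij_witness[of _ uminus uminus])
      have c: "card (- I) = 2 * CARD('n) - card I" for I :: "'n idx set"
        by (simp add: Compl_eq_Diff_UNIV card_Diff_subset)
      show "- J \<in> {I. card I = 2 * k}" if "J \<in> \<CC>" for J
        using that km by (simp add: \<CC>_def c)
      show "- I \<in> \<CC>" if "I \<in> {I. card I = 2 * k}" for I :: "'n idx set"
        using that by (simp add: \<CC>_def c m_def)
    qed auto
    also have "\<dots> = pairing (2 * k) \<mu> \<phi>"
      unfolding pairing_def
    proof (rule sum.cong[OF refl])
      fix I :: "'n idx set" assume "I \<in> {I. card I = 2 * k}"
      then have "P I (\<mu> I)" using \<mu> by simp
      then have "shuffle_sign I (- I) * cmeasure_integral (\<mu> I) (\<lambda>x. of_real (?f (- I) x) + \<i> * of_real (?g (- I) x))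
        = T (\<lambda>x. ?f (- I) x *\<^sub>R \<omega> (- I)) + \<i> * T (\<lambda>x. ?g (- I) x *\<^sub>R \<omega> (- I))"
        unfolding P_def
        by (rule bspec[OF bspec[OF conjunct2 test_forms_component(1)[OF \<phi>]] test_forms_component(2)[OF \<phi>]])
      then show "T (\<lambda>x. ?f (- I) x *\<^sub>R \<omega> (- I)) + \<i> * T (\<lambda>x. ?g (- I) x *\<^sub>R \<omega> (- I))
        = shuffle_sign I (- I) * cmeasure_integral (\<mu> I) (\<lambda>x. \<phi> x $ (- I))"
        by (simp only: complex_eq[symmetric])
    qed
    finally show ?thesis .
  qed
  then have "has_coefficients \<Omega> (2 * k) T \<mu>"
    unfolding has_coefficients_def m_def[symmetric] using \<mu> by (simp add: P_def)
  then show ?thesis by blast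
qed

section \<open>Averages over quaternionic lines\<close>

definition shift :: "'a::euclidean_space measure \<Rightarrow> ('a \<Rightarrow> real) \<Rightarrow> 'a \<Rightarrow> real" where
  "shift \<nu> f x = (LINT z|\<nu>. f (x + z))"

text \<open>A probability measure carried by the closed ball of radius \<open>R\<close>. The radius
  records how far an average looks, which decides where the sub-mean value inequality may be
  used.\<close>

definition avg_kernel :: "real \<Rightarrow> 'a::euclidean_space measure \<Rightarrow> bool" where
  "avg_kernel R \<nu> \<longleftrightarrow> sets \<nu> = sets borel \<and> emeasure \<nu> UNIV = 1 \<and> (AE z in \<nu>. norm z \<le> R)"

definition bounded_borel :: "real \<Rightarrow> ('a::euclidean_space \<Rightarrow> real) \<Rightarrow> bool" where
  "bounded_borel M f \<longleftrightarrow> f \<in> borel_measurable borel \<and> (\<forall>x. \<bar>f x\<bar> \<le> M)"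

lemma kernelD:
  assumes "avg_kernel R \<nu>"
  shows "sets \<nu> = sets borel" "space \<nu> = UNIV" "emeasure \<nu> UNIV = 1" "AE z in \<nu>. norm z \<le> R"
    "finite_measure \<nu>" "measure \<nu> UNIV = 1"
proof -
  show *: "sets \<nu> = sets borel" "emeasure \<nu> UNIV = 1" "AE z in \<nu>. norm z \<le> R"
    using assms by (auto simp: avg_kernel_def)
  show sp: "space \<nu> = UNIV" using sets_eq_imp_space_eq[OF *(1)] by simp
  show "finite_measure \<nu>" by (rule finite_measureI) (simp add: sp *)
  show "measure \<nu> UNIV = 1" by (simp add: measure_def *)
qed

lemma bounded_borelD:
  assumes "bounded_borel M f" shows "f \<in> borel_measurable borel" "\<bar>f x\<bar> \<le> M"
  using assms by (auto simp: bounded_borel_def)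

lemma shift_integrable:
  assumes \<nu>: "avg_kernel R \<nu>" and f: "bounded_borel M f" shows "integrable \<nu> (\<lambda>z. f (x + z))"
proof (rule finite_measure.integrable_const_bound[OF kernelD(5)[OF \<nu>]])
  have "(\<lambda>z. f (x + z)) \<in> borel_measurable borel"
    using bounded_borelD(1)[OF f] by measurable
  then show "(\<lambda>z. f (x + z)) \<in> borel_measurable \<nu>"
    by (simp add: measurable_cong_sets[OF kernelD(1)[OF \<nu>] refl])
  show "AE z in \<nu>. norm (f (x + z)) \<le> M" using bounded_borelD(2)[OF f] by simp
qed

lemma shift_const:
  assumes "avg_kernel R \<nu>" shows "(LINT z|\<nu>. (c :: real)) = c"
  using kernelD(2,6)[OF assms] by simp

lemma shift_mono:
  assumes \<nu>: "avg_kernel R \<nu>" and f: "bounded_borel M f" and g: "bounded_borel N g"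
    and le: "\<And>z. norm z \<le> R \<Longrightarrow> f (x + z) \<le> g (y + z)"
  shows "shift \<nu> f x \<le> shift \<nu> g y"
  unfolding shift_def
  by (rule integral_mono_AE[OF shift_integrable[OF \<nu> f] shift_integrable[OF \<nu> g]])
    (use kernelD(4)[OF \<nu>] le in \<open>auto elim: eventually_mono\<close>)

lemma shift_le_const:
  assumes \<nu>: "avg_kernel R \<nu>" and f: "bounded_borel M f" and le: "\<And>z. norm z \<le> R \<Longrightarrow> f (x + z) \<le> c"
  shows "shift \<nu> f x \<le> c"
proof -
  have "shift \<nu> f x \<le> (LINT z|\<nu>. c)"
    unfolding shift_def
    by (rule integral_mono_AE[OF shift_integrable[OF \<nu> f] finite_measure.integrable_const[OF kernelD(5)[OF \<nu>]]])
      (use kernelD(4)[OF \<nu>] le in \<open>auto elim: eventually_mono\<close>)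
  then show ?thesis by (simp add: kernelD(2,6)[OF \<nu>])
qed

lemma shift_bound_diff:
  assumes \<nu>: "avg_kernel R \<nu>" and f: "bounded_borel M f"
    and le: "\<And>z. norm z \<le> R \<Longrightarrow> \<bar>f (x + z) - f (y + z)\<bar> \<le> c"
  shows "\<bar>shift \<nu> f x - shift \<nu> f y\<bar> \<le> c"
proof -
  note i = shift_integrable[OF \<nu> f]
  have ic: "integrable \<nu> (\<lambda>z. c)" by (rule finite_measure.integrable_const[OF kernelD(5)[OF \<nu>]])
  have "shift \<nu> f x \<le> (LINT z|\<nu>. f (y + z) + c)"
    unfolding shift_def using kernelD(4)[OF \<nu>]
    by (intro integral_mono_AE i Bochner_Integration.integrable_add ic)
      (auto elim!: eventually_mono dest!: le)
  moreover have "shift \<nu> f y \<le> (LINT z|\<nu>. f (x + z) + c)"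
    unfolding shift_def using kernelD(4)[OF \<nu>]
    by (intro integral_mono_AE i Bochner_Integration.integrable_add ic)
      (auto elim!: eventually_mono dest!: le)
  ultimately show ?thesis
    using i[of x] i[of y] ic by (simp add: shift_def kernelD(2,6)[OF \<nu>] abs_le_iff)
qed

lemma shift_bounded_borel:
  assumes \<nu>: "avg_kernel R \<nu>" and f: "bounded_borel M f" shows "bounded_borel M (shift \<nu> f)"
  unfolding bounded_borel_def
proof (intro conjI allI)
  interpret finite_measure \<nu> by (rule kernelD(5)[OF \<nu>])
  have "case_prod (\<lambda>x z. f (x + z)) \<in> borel_measurable (borel \<Otimes>\<^sub>M borel)"
    using bounded_borelD(1)[OF f] by measurable
  then have "case_prod (\<lambda>x z. f (x + z)) \<in> borel_measurable (borel \<Otimes>\<^sub>M \<nu>)"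
    by (simp add: measurable_cong_sets[OF sets_pair_measure_cong[OF refl kernelD(1)[OF \<nu>]] refl])
  then show "shift \<nu> f \<in> borel_measurable borel"
    unfolding shift_def[abs_def] by (rule borel_measurable_lebesgue_integral)
  fix x
  have "shift \<nu> f x \<le> M"
    by (rule shift_le_const[OF \<nu> f]) (use bounded_borelD(2)[OF f] abs_le_iff in blast)
  moreover have "- M \<le> shift \<nu> f x"
  proof -
    have "(LINT z|\<nu>. - M) \<le> shift \<nu> f x"
      unfolding shift_def
      by (rule integral_mono[OF finite_measure.integrable_const[OF kernelD(5)[OF \<nu>]] shift_integrable[OF \<nu> f]])
        (use bounded_borelD(2)[OF f] abs_le_iff minus_le_iff in blast)
    then show ?thesis by (simp only: shift_const[OF \<nu>])
  qed
  ultimately show "\<bar>shift \<nu> f x\<bar> \<le> M" by simp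
qed

text \<open>Fubini and commutativity of addition. This lets the sub-mean value inequality for one
  line survive averages over other lines and mollification.\<close>

lemma shift_commute:
  assumes \<nu>: "avg_kernel R \<nu>" and \<mu>: "avg_kernel S \<mu>" and f: "bounded_borel M f"
  shows "shift \<nu> (shift \<mu> f) = shift \<mu> (shift \<nu> f)"
proof
  fix x
  interpret A: finite_measure \<nu> by (rule kernelD(5)[OF \<nu>])
  interpret B: finite_measure \<mu> by (rule kernelD(5)[OF \<mu>])
  interpret pair_sigma_finite \<nu> \<mu> ..
  have fin: "finite_measure (\<nu> \<Otimes>\<^sub>M \<mu>)"
    by (rule finite_measure_pair_measure) unfold_locales
  have "case_prod (\<lambda>y z. f (x + y + z)) \<in> borel_measurable (borel \<Otimes>\<^sub>M borel)"
    using bounded_borelD(1)[OF f] by measurable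
  then have "case_prod (\<lambda>y z. f (x + y + z)) \<in> borel_measurable (\<nu> \<Otimes>\<^sub>M \<mu>)"
    by (simp add: measurable_cong_sets[OF sets_pair_measure_cong[OF kernelD(1)[OF \<nu>] kernelD(1)[OF \<mu>]] refl])
  then have "integrable (\<nu> \<Otimes>\<^sub>M \<mu>) (case_prod (\<lambda>y z. f (x + y + z)))"
    by (intro finite_measure.integrable_const_bound[OF fin, of _ M])
      (auto simp: bounded_borelD(2)[OF f])
  from Fubini_integral[OF this]
  have "(LINT z|\<mu>. LINT y|\<nu>. f (x + y + z)) = (LINT y|\<nu>. LINT z|\<mu>. f (x + y + z))" .
  then show "shift \<nu> (shift \<mu> f) x = shift \<mu> (shift \<nu> f) x"
    unfolding shift_def by (simp add: ac_simps)
qed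

lemma shift_support:
  assumes \<nu>: "avg_kernel R \<nu>" and f: "\<And>x. norm x > B \<Longrightarrow> f x = 0" and x: "norm x > B + R"
  shows "shift \<nu> f x = 0"
proof -
  have "AE z in \<nu>. f (x + z) = 0"
    using kernelD(4)[OF \<nu>]
  proof eventually_elim
    case (elim z)
    have "norm x \<le> norm (x + z) + norm z" by (metis add_diff_cancel norm_triangle_ineq4)
    then show ?case using elim x by (intro f) simp
  qed
  then show ?thesis unfolding shift_def by (rule integral_eq_zero_AE)
qed

section \<open>Ball averages along one quaternionic line\<close>

definition line :: "'n::finite hspace \<Rightarrow> 'n hspace measure" where
  "line b = distr unif borel (hmul b)"

lemma hmul_continuous: "continuous_on UNIV (hmul b)"
  by (rule linear_continuous_on[OF bounded_bilinear.bounded_linear_right[OF bilinear_hmul]])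

lemma hmul_measurable [measurable]: "hmul b \<in> borel_measurable borel"
  by (rule borel_measurable_continuous_onI[OF hmul_continuous])

lemma hmul_measurable_unif: "hmul b \<in> unif \<rightarrow>\<^sub>M borel"
  by (simp add: measurable_cong_sets[OF sets_unif refl])

lemma hmul_zero [simp]: "hmul b 0 = 0"
  by (rule bounded_bilinear.zero_right[OF bilinear_hmul])

lemma kernel_line:
  assumes "\<And>q. norm q \<le> 1 \<Longrightarrow> norm (hmul b q) \<le> R" shows "avg_kernel R (line b)"
  unfolding avg_kernel_def
proof (intro conjI)
  show "emeasure (line b) UNIV = 1"
    unfolding line_def by (subst emeasure_distr[OF hmul_measurable_unif]) (simp_all add: emeasure_unif_UNIV)
  show "AE z in line b. norm z \<le> R"
    unfolding line_def
    by (subst AE_distr_iff[OF hmul_measurable_unif]) (use AE_unif assms in \<open>auto elim: eventually_mono\<close>)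
qed (simp add: line_def)

lemma shift_line:
  assumes "f \<in> borel_measurable borel" shows "shift (line b) f x = (LINT q|unif. f (x + hmul b q))"
  unfolding shift_def line_def
  by (rule integral_distr[OF hmul_measurable_unif]) (use assms in measurable)

abbreviation "B1 \<equiv> cball (0::quat) 1"

definition V1 :: real where "V1 = measure lborel B1"

lemma V1_pos: "V1 > 0"
  unfolding V1_def by (rule content_cball_pos) simp

lemma B1_borel [measurable]: "B1 \<in> sets borel"
  by (intro borel_closed closed_cball)

lemma integral_unif:
  fixes f :: "quat \<Rightarrow> real"
  assumes [measurable]: "f \<in> borel_measurable borel"
  shows "(LINT q|unif. f q) = (LINT q|lborel. indicator B1 q * f q) / V1"
proof -
  have e: "emeasure lborel B1 = ennreal V1"
    using emeasure_cball_quat(2) by (simp add: V1_def emeasure_eq_ennreal_measure)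
  have "indicator B1 q / ennreal V1 = ennreal (indicator B1 q / V1)" for q
    using V1_pos divide_ennreal[of 1 V1] by (simp add: indicator_def)
  then have u: "unif = density lborel (\<lambda>q. ennreal (indicator B1 q / V1))"
    unfolding unif_def uniform_measure_def e by simp
  have "(LINT q|unif. f q) = (LINT q|lborel. (indicator B1 q / V1) *\<^sub>R f q)"
  proof -
    have "(\<lambda>q. indicator B1 q / V1) \<in> borel_measurable lborel" by measurable
    then show ?thesis unfolding u by (intro integral_density) (use V1_pos in auto)
  qed
  also have "\<dots> = (LINT q|lborel. indicator B1 q * f q) / V1" by simp
  finally show ?thesis .
qed

lemma lborel_integral_translate:
  fixes f :: "'a::euclidean_space \<Rightarrow> real"
  assumes [measurable]: "f \<in> borel_measurable borel"
  shows "(LINT x|lborel. f (c + x)) = (LINT x|lborel. f x)"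
proof -
  have "(LINT x|lborel. f x) = (LINT x|distr lborel borel ((+) c). f x)"
    by (simp only: lborel_distr_plus)
  also have "\<dots> = (LINT x|lborel. f (c + x))" by (rule integral_distr) auto
  finally show ?thesis ..
qed

lemma lborel_integral_uminus:
  fixes f :: "'a::euclidean_space \<Rightarrow> real"
  assumes [measurable]: "f \<in> borel_measurable borel"
  shows "(LINT x|lborel. f (- x)) = (LINT x|lborel. f x)"
proof -
  have d: "distr lborel borel (\<lambda>x::'a. - x) = lborel"
    using lborel_affine[of "- 1" "0::'a"] by (simp add: density_1)
  have "(LINT x|lborel. f x) = (LINT x|distr lborel borel (\<lambda>x::'a. - x). f x)" by (simp only: d)
  also have "\<dots> = (LINT x|lborel. f (- x))" by (rule integral_distr) auto
  finally show ?thesis ..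
qed

lemma integral_unif_uminus:
  fixes f :: "quat \<Rightarrow> real"
  assumes [measurable]: "f \<in> borel_measurable borel"
  shows "(LINT q|unif. f (- q)) = (LINT q|unif. f q)"
proof -
  have m: "(\<lambda>q. indicator B1 q * f q) \<in> borel_measurable borel" by measurable
  have "indicator B1 (- q) = (indicator B1 q :: real)" for q by (simp add: indicator_def)
  then show ?thesis
    using lborel_integral_uminus[OF m] by (simp add: integral_unif)
qed

text \<open>The normalised volume of the symmetric difference of the unit ball and its translate by
  \<open>h\<close>. Up to a bound for the function, it controls the change of a ball average under
  translation, so averaging produces a continuity that the function itself may lack.\<close>

definition ball_modulus :: "quat \<Rightarrow> real" where
  "ball_modulus h = (LINT q|lborel. \<bar>indicator B1 (q - h) - indicator B1 q\<bar>) / V1"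

lemma integrable_indicator_shift: "integrable lborel (\<lambda>q. indicator B1 (q - h) :: real)"
proof -
  have "(\<lambda>q. indicator B1 (q - h) :: real) = indicator (cball h 1)"
    by (auto simp: indicator_def fun_eq_iff dist_norm norm_minus_commute)
  then show ?thesis
    using emeasure_lborel_cball_finite by (simp add: integrable_indicator_iff)
qed

text \<open>Translation invariance of Lebesgue measure transfers the shift from \<open>G\<close> to
  the indicator of the ball.\<close>

lemma integral_unif_translate:
  fixes G :: "quat \<Rightarrow> real"
  assumes [measurable]: "G \<in> borel_measurable borel" and M: "\<And>q. \<bar>G q\<bar> \<le> M"
  shows "\<bar>(LINT q|unif. G (q + h)) - (LINT q|unif. G q)\<bar> \<le> M * ball_modulus h"
proof -
  have int: "integrable lborel (\<lambda>q. indicator B1 (q - h) * G q)" for h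
    by (rule Bochner_Integration.integrable_bound[OF integrable_mult_right[OF integrable_indicator_shift[of h], of M]])
      (use order_trans[OF M abs_ge_self] in \<open>auto simp: indicator_def\<close>)
  have m: "(\<lambda>q. indicator B1 (q - h) * G q) \<in> borel_measurable borel" by measurable
  have "(LINT q|lborel. indicator B1 q * G (q + h)) = (LINT q|lborel. indicator B1 (q - h) * G q)"
    using lborel_integral_translate[OF m, of h] by (simp add: add.commute)
  then have "(LINT q|unif. G (q + h)) - (LINT q|unif. G q)
      = (LINT q|lborel. indicator B1 (q - h) * G q - indicator B1 q * G q) / V1"
    using int[of h] int[of 0] by (simp add: integral_unif diff_divide_distrib)
  also have "\<bar>\<dots>\<bar> \<le> (LINT q|lborel. M * \<bar>indicator B1 (q - h) - indicator B1 q\<bar>) / V1"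
  proof -
    have "\<bar>LINT q|lborel. indicator B1 (q - h) * G q - indicator B1 q * G q\<bar>
      \<le> (LINT q|lborel. \<bar>indicator B1 (q - h) * G q - indicator B1 q * G q\<bar>)"
      by (rule integral_abs_bound)
    also have "\<dots> \<le> (LINT q|lborel. M * \<bar>indicator B1 (q - h) - indicator B1 q\<bar>)"
    proof (rule integral_mono)
      show "integrable lborel (\<lambda>q. \<bar>indicator B1 (q - h) * G q - indicator B1 q * G q\<bar>)"
        using int[of h] int[of 0] by simp
      show "integrable lborel (\<lambda>q. M * \<bar>indicator B1 (q - h) - indicator B1 q\<bar>)"
        using integrable_indicator_shift[of h] integrable_indicator_shift[of 0] by simp
      show "\<bar>indicator B1 (q - h) * G q - indicator B1 q * G q\<bar> \<le> M * \<bar>indicator B1 (q - h) - indicator B1 q\<bar>" for q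
        using M[of q] by (auto simp: indicator_def)
    qed
    finally show ?thesis using V1_pos by (simp add: divide_right_mono)
  qed
  finally show ?thesis by (simp add: ball_modulus_def)
qed

lemma ball_modulus_small:
  assumes "e > 0" shows "\<exists>d>0. \<forall>h. norm h < d \<longrightarrow> ball_modulus h < e"
proof (rule ccontr)
  assume "\<not> ?thesis"
  then have "\<exists>h. norm h < 1 / real (Suc n) \<and> e \<le> ball_modulus h" for n
    by (metis not_le of_nat_0_less_iff zero_less_Suc zero_less_divide_1_iff)
  then obtain h where h: "\<And>n. norm (h n) < 1 / real (Suc n)" "\<And>n. e \<le> ball_modulus (h n)" by metis
  have h0: "h \<longlonglongrightarrow> 0"
    by (rule tendsto_norm_zero_cancel, rule tendsto_sandwich[OF _ _ tendsto_const LIMSEQ_Suc[OF lim_1_over_n]])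
      (use h(1) in \<open>auto intro!: always_eventually less_imp_le\<close>)
  have "(\<lambda>n. LINT q|lborel. \<bar>indicator B1 (q - h n) - indicator B1 q\<bar>) \<longlonglongrightarrow> (LINT q|(lborel :: quat measure). (0 :: real))"
  proof (rule integral_dominated_convergence[where w = "indicator (cball (0::quat) 2)"])
    show "integrable lborel (indicator (cball (0::quat) 2) :: quat \<Rightarrow> real)"
      using emeasure_lborel_cball_finite by (simp add: integrable_indicator_iff)
    show "AE q in lborel. norm \<bar>indicator B1 (q - h n) - indicator B1 q :: real\<bar> \<le> indicator (cball 0 2) q" for n
    proof (rule AE_I2)
      fix q :: quat
      have hn: "norm (h n) \<le> 1"
        using h(1)[of n] by (rule order_trans[OF less_imp_le]) simp
      have "norm q \<le> norm (q - h n) + norm (h n)" by (rule norm_triangle_sub[of q "h n", simplified add.commute[of "norm (h n)"]])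
      then show "norm \<bar>indicator B1 (q - h n) - indicator B1 q :: real\<bar> \<le> indicator (cball 0 2) q"
        using hn by (auto simp: indicator_def)
    qed
    \<comment> \<open>The translated indicators converge except possibly where
      \<open>norm q = 1\<close>, so the exceptional set is null.\<close>
    have "sphere (0::quat) 1 \<in> null_sets lborel"
      using negligible_sphere[of "0::quat" 1] by (auto simp: null_sets_completion_iff negligible_iff_null_sets)
    then have "AE q in lborel. q \<notin> sphere (0::quat) 1" by (rule AE_not_in)
    then show "AE q in lborel. (\<lambda>n. \<bar>indicator B1 (q - h n) - indicator B1 q :: real\<bar>) \<longlonglongrightarrow> 0"
    proof eventually_elim
      case (elim q)
      have lim: "(\<lambda>n. norm (q - h n)) \<longlonglongrightarrow> norm q"
        using tendsto_norm[OF tendsto_diff[OF tendsto_const h0, of q]] by simp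
      have "\<forall>\<^sub>F n in sequentially. indicator B1 (q - h n) = (indicator B1 q :: real)"
      proof (cases "norm q < 1")
        case True
        from order_tendstoD(2)[OF lim True] show ?thesis
          by eventually_elim (use True in \<open>simp add: indicator_def\<close>)
      next
        case False
        then have "norm q > 1" using elim by simp
        from order_tendstoD(1)[OF lim this] show ?thesis
          by eventually_elim (use \<open>norm q > 1\<close> in \<open>simp add: indicator_def\<close>)
      qed
      then show ?case by (intro tendsto_eventually) (auto elim: eventually_mono)
    qed
  qed auto
  then have "(\<lambda>n. ball_modulus (h n)) \<longlonglongrightarrow> 0"
    unfolding ball_modulus_def using tendsto_divide_zero by fastforce
  then have "e \<le> 0"
    by (rule tendsto_lowerbound) (use h(2) in auto)
  then show False using assms by simp
qed

section \<open>Successive averages over the coordinate lines\<close>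

definition coord :: "real \<Rightarrow> 'n::finite \<Rightarrow> 'n hspace measure" where
  "coord r l = line (axis l (vector [r, 0, 0, 0]))"

lemma hmul_coord: "hmul (axis l (vector [r, 0, 0, 0])) q = axis l (r *\<^sub>R q)"
proof -
  have "qmul (vector [r, 0, 0, 0]) q = r *\<^sub>R q" "qmul 0 q = 0"
    by (simp_all add: qmul_def vec_eq_iff forall_4)
  then show ?thesis by (auto simp: hmul_def vec_eq_iff axis_def)
qed

lemma norm_axis_eq: "norm (axis l (q :: 'b::real_inner)) = norm q"
  by (simp add: norm_eq_sqrt_inner inner_axis)

lemma kernel_coord: "0 \<le> r \<Longrightarrow> avg_kernel r (coord r l)"
  unfolding coord_def by (rule kernel_line) (simp add: hmul_coord norm_axis_eq mult_left_le)

lemma axis_add: "axis l (p + q) = axis l p + axis l (q :: 'a::monoid_add)"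
  by (simp add: vec_eq_iff axis_def)

lemma axis_measurable: "(\<lambda>q :: quat. axis l (r *\<^sub>R q)) \<in> borel_measurable borel"
  using hmul_measurable[of "axis l (vector [r, 0, 0, 0])"] by (simp only: hmul_coord[abs_def])

lemma shift_coord_modulus:
  assumes r: "r > 0" and f: "bounded_borel M f"
  shows "\<bar>shift (coord r l) f (x + axis l h) - shift (coord r l) f x\<bar> \<le> M * ball_modulus ((1 / r) *\<^sub>R h)"
proof -
  define G where "G q = f (x + axis l (r *\<^sub>R q))" for q
  note fm = bounded_borelD(1)[OF f]
  have "G \<in> borel_measurable borel"
    unfolding G_def using fm axis_measurable by measurable
  moreover have "\<bar>G q\<bar> \<le> M" for q unfolding G_def by (rule bounded_borelD(2)[OF f])
  moreover have "shift (coord r l) f (x + axis l h) = (LINT q|unif. G (q + (1 / r) *\<^sub>R h))"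
  proof -
    have "x + axis l h + axis l (r *\<^sub>R q) = x + axis l (r *\<^sub>R (q + (1 / r) *\<^sub>R h))" for q
      using r by (simp add: scaleR_add_right axis_add)
    then show ?thesis unfolding coord_def shift_line[OF fm] hmul_coord G_def by (simp only:)
  qed
  moreover have "shift (coord r l) f x = (LINT q|unif. G q)"
    unfolding coord_def shift_line[OF fm] hmul_coord G_def ..
  ultimately show ?thesis by (simp only: integral_unif_translate)
qed

text \<open>One average of radius \<open>r\<close> for each listed coordinate, so that a list
  containing all of them controls translations in every direction. Each entry displaces a point by
  at most \<open>r\<close>, which explains the bound \<open>r * real (length ls)\<close> in the
  estimates.\<close>

primrec coord_avg :: "real \<Rightarrow> 'n::finite list \<Rightarrow> ('n hspace \<Rightarrow> real) \<Rightarrow> 'n hspace \<Rightarrow> real" where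
  "coord_avg r [] f = f"
| "coord_avg r (l # ls) f = shift (coord r l) (coord_avg r ls f)"

lemma coord_avg_bounded_borel:
  "0 \<le> r \<Longrightarrow> bounded_borel M f \<Longrightarrow> bounded_borel M (coord_avg r ls f)"
  by (induction ls) (auto intro: shift_bounded_borel[OF kernel_coord])

lemma coord_avg_shift:
  assumes "0 \<le> r" "avg_kernel R \<nu>" "bounded_borel M f"
  shows "shift \<nu> (coord_avg r ls f) = coord_avg r ls (shift \<nu> f)"
proof (induction ls)
  case (Cons l ls)
  then show ?case
    using shift_commute[OF assms(2) kernel_coord[OF assms(1), of l] coord_avg_bounded_borel[OF assms(1,3)]]
    by simp
qed simp

lemma coord_avg_mono:
  assumes r: "0 \<le> r" and f: "bounded_borel M f" and g: "bounded_borel N g"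
  shows "(\<And>z. norm z \<le> r * real (length ls) \<Longrightarrow> f (x + z) \<le> g (x + z)) \<Longrightarrow> coord_avg r ls f x \<le> coord_avg r ls g x"
proof (induction ls arbitrary: x)
  case Nil
  from Nil[of 0] show ?case by simp
next
  case (Cons l ls)
  show ?case
    unfolding coord_avg.simps
  proof (rule shift_mono[OF kernel_coord[OF r] coord_avg_bounded_borel[OF r f] coord_avg_bounded_borel[OF r g]])
    fix z :: "'a hspace" assume z: "norm z \<le> r"
    show "coord_avg r ls f (x + z) \<le> coord_avg r ls g (x + z)"
    proof (rule Cons.IH)
      fix y :: "'a hspace" assume "norm y \<le> r * real (length ls)"
      then have "norm (z + y) \<le> r * real (length (l # ls))"
        using z norm_triangle_ineq[of z y] by (simp add: algebra_simps)
      from Cons.prems[OF this] show "f (x + z + y) \<le> g (x + z + y)" by (simp add: add.assoc)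
    qed
  qed
qed

lemma coord_avg_le_const:
  assumes r: "0 \<le> r" and f: "bounded_borel M f"
  shows "(\<And>z. norm z \<le> r * real (length ls) \<Longrightarrow> f (x + z) \<le> c) \<Longrightarrow> coord_avg r ls f x \<le> c"
proof (induction ls arbitrary: x)
  case Nil
  from Nil[of 0] show ?case by simp
next
  case (Cons l ls)
  show ?case
    unfolding coord_avg.simps
  proof (rule shift_le_const[OF kernel_coord[OF r] coord_avg_bounded_borel[OF r f]])
    fix z :: "'a hspace" assume z: "norm z \<le> r"
    show "coord_avg r ls f (x + z) \<le> c"
    proof (rule Cons.IH)
      fix y :: "'a hspace" assume "norm y \<le> r * real (length ls)"
      then have "norm (z + y) \<le> r * real (length (l # ls))"
        using z norm_triangle_ineq[of z y] by (simp add: algebra_simps)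
      from Cons.prems[OF this] show "f (x + z + y) \<le> c" by (simp add: add.assoc)
    qed
  qed
qed

lemma coord_avg_support:
  assumes r: "0 \<le> r" and f: "\<And>x. norm x > B \<Longrightarrow> f x = 0"
  shows "norm x > B + r * real (length ls) \<Longrightarrow> coord_avg r ls f x = 0"
proof (induction ls arbitrary: x)
  case (Cons l ls)
  show ?case
    unfolding coord_avg.simps
  proof (rule shift_support[OF kernel_coord[OF r] Cons.IH])
    show "B + r * real (length ls) + r < norm x"
      using Cons.prems by (simp add: distrib_left)
  qed
qed (simp add: f)

text \<open>The average over the \<open>l\<close>-th line supplies the estimate; averages over other
  lines applied afterwards preserve it, since the bound does not depend on the base point.\<close>

lemma coord_avg_modulus:
  assumes r: "r > 0" and f: "bounded_borel M f" and l: "l \<in> set ls"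
  shows "\<bar>coord_avg r ls f (x + axis l h) - coord_avg r ls f x\<bar> \<le> M * ball_modulus ((1 / r) *\<^sub>R h)"
  using l
proof (induction ls arbitrary: x)
  case (Cons m ls)
  note b = coord_avg_bounded_borel[OF less_imp_le[OF r] f, of ls]
  show ?case
  proof (cases "l = m")
    case True
    then show ?thesis using shift_coord_modulus[OF r b] by simp
  next
    case False
    then have l: "l \<in> set ls" using Cons.prems by simp
    show ?thesis
      unfolding coord_avg.simps
    proof (rule shift_bound_diff[OF kernel_coord[OF less_imp_le[OF r]] b])
      fix z :: "'a hspace"
      show "\<bar>coord_avg r ls f (x + axis l h + z) - coord_avg r ls f (x + z)\<bar> \<le> M * ball_modulus ((1 / r) *\<^sub>R h)"
        using Cons.IH[OF l, of "x + z"] by (simp add: ac_simps)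
    qed
  qed
qed simp

lemma coord_avg_uniform:
  assumes r: "r > 0" and f: "bounded_borel M f" and ls: "set ls = (UNIV :: 'n::finite set)" and e: "e > 0"
  shows "\<exists>d>0. \<forall>x y. norm y < d \<longrightarrow> \<bar>coord_avg r ls f (x + y) - coord_avg r ls f x\<bar> < e"
proof -
  let ?v = "coord_avg r ls f"
  have M0: "0 \<le> M" using bounded_borelD(2)[OF f, of 0] by linarith
  \<comment> \<open>Each of the \<open>CARD('n)\<close> coordinates may contribute
    \<open>M * e'\<close>; with \<open>M + 1\<close> in the denominator the total is
    \<open>M / (M + 1) * e\<close>, strictly below \<open>e\<close>, and \<open>M = 0\<close> is
    covered.\<close>
  define e' where "e' = (e / (M + 1)) / CARD('n)"
  have e': "e' > 0" using e M0 by (simp add: e'_def)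
  obtain d where d: "d > 0" "\<And>h. norm h < d \<Longrightarrow> ball_modulus h < e'"
    using ball_modulus_small[OF e'] by auto
  have step: "\<bar>?v (x + (\<Sum>l\<in>S. axis l (y $ l))) - ?v x\<bar> \<le> (\<Sum>l\<in>S. M * ball_modulus ((1 / r) *\<^sub>R (y $ l)))" for S x y
  proof (induction S rule: infinite_finite_induct)
    case (insert l S)
    have "\<bar>?v ((x + (\<Sum>l\<in>S. axis l (y $ l))) + axis l (y $ l)) - ?v (x + (\<Sum>l\<in>S. axis l (y $ l)))\<bar>
        \<le> M * ball_modulus ((1 / r) *\<^sub>R (y $ l))"
      by (rule coord_avg_modulus[OF r f]) (simp add: ls)
    then show ?case using insert by (simp add: ac_simps)
  qed simp_all
  have "\<bar>?v (x + y) - ?v x\<bar> < e" if y: "norm y < r * d" for x y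
  proof -
    have "y = (\<Sum>l\<in>UNIV. axis l (y $ l))"
      by (simp add: vec_eq_iff axis_def if_distrib[of "\<lambda>v. v $ _"] cong: if_cong)
    then have "\<bar>?v (x + y) - ?v x\<bar> \<le> (\<Sum>l\<in>UNIV. M * ball_modulus ((1 / r) *\<^sub>R (y $ l)))"
      using step[of x y UNIV] by simp
    also have "\<dots> \<le> (\<Sum>l\<in>(UNIV::'n set). M * e')"
    proof (rule sum_mono)
      fix l
      have "norm (y $ l) < r * d" using Finite_Cartesian_Product.norm_nth_le[of y l] y by linarith
      then have "norm ((1 / r) *\<^sub>R (y $ l)) < d" using r by (simp add: pos_divide_less_eq mult.commute)
      from d(2)[OF this] show "M * ball_modulus ((1 / r) *\<^sub>R (y $ l)) \<le> M * e'"
        using M0 by (intro mult_left_mono) auto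
    qed
    also have "\<dots> = (M / (M + 1)) * e" by (simp add: e'_def)
    also have "\<dots> < e" using M0 e by (simp add: field_simps)
    finally show ?thesis .
  qed
  then show ?thesis using d(1) r by (intro exI[of _ "r * d"]) auto
qed

section \<open>Mollification\<close>

lemma smooth_convolution:
  fixes v \<rho> :: "'a::euclidean_space \<Rightarrow> real"
  assumes v: "continuous_on UNIV v" and \<rho>: "smooth \<rho>"
  shows "smooth (\<lambda>x. integral (cbox a b) (\<lambda>y. v y * \<rho> (y - x)))"
proof -
  define I where "I \<rho> x = integral (cbox a b) (\<lambda>y. v y * \<rho> (y - x))" for \<rho> :: "'a \<Rightarrow> real" and x
  have cont: "continuous_on S (\<lambda>y. v y * \<rho> (y - x))" if "smooth \<rho>" for S \<rho> x
    by (intro continuous_intros continuous_on_subset[OF v] continuous_on_compose2[OF smooth_continuous_on[OF that, of UNIV]]) auto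
  \<comment> \<open>Differentiation under the integral moves the derivative onto the kernel, up to
    sign. So the functions \<open>I \<rho>\<close> with smooth \<open>\<rho>\<close> form the class
    for \<open>smooth_coinduct\<close>.\<close>
  have D: "(I \<rho> has_derivative (\<lambda>e. - I (dir_deriv e \<rho>) x)) (at x)" if s: "smooth \<rho>" for \<rho> x
  proof -
    define L where "L x y = Blinfun (\<lambda>e. v y * (- dir_deriv e \<rho> (y - x)))" for x y
    have bl: "bounded_linear (\<lambda>e. v y * (- dir_deriv e \<rho> (y - x)))" for x y
      by (intro bounded_linear_compose[OF bounded_linear_mult_right] bounded_linear_minus
          has_derivative_bounded_linear[OF smooth_has_derivative[OF s]])
    have L: "blinfun_apply (L x y) e = v y * (- dir_deriv e \<rho> (y - x))" for x y e
      unfolding L_def by (simp only: bounded_linear_Blinfun_apply[OF bl])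
    have contL: "continuous_on (UNIV \<times> cbox a b) (\<lambda>(x, y). L x y)"
    proof (rule continuous_on_blinfun_componentwise)
      fix i :: 'a
      show "continuous_on (UNIV \<times> cbox a b) (\<lambda>p. blinfun_apply (case p of (x, y) \<Rightarrow> L x y) i)"
        unfolding case_prod_beta L
        by (intro continuous_intros continuous_on_compose2[OF v]
            continuous_on_compose2[OF smooth_continuous_on[OF smooth_dir_deriv[OF s], of UNIV]]) auto
    qed
    have "((\<lambda>x. integral (cbox a b) ((\<lambda>x y. v y * \<rho> (y - x)) x)) has_derivative
        blinfun_apply (integral (cbox a b) (L x))) (at x within UNIV)"
    proof (rule leibniz_rule[OF _ _ contL])
      fix x t
      have "((\<lambda>x. \<rho> (t - x)) has_derivative (\<lambda>e. dir_deriv (- e) \<rho> (t - x))) (at x)"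
        by (rule has_derivative_compose[of "\<lambda>x. t - x", OF _ smooth_has_derivative[OF s]])
          (auto intro!: derivative_eq_intros)
      moreover have "dir_deriv (- e) \<rho> (t - x) = - dir_deriv e \<rho> (t - x)" for e
        using dir_deriv_scaleR[OF s, of "- 1" e] by simp
      ultimately have "((\<lambda>x. v t * \<rho> (t - x)) has_derivative (\<lambda>e. v t * (- dir_deriv e \<rho> (t - x)))) (at x)"
        by (auto intro!: derivative_eq_intros)
      then show "((\<lambda>x. v t * \<rho> (t - x)) has_derivative blinfun_apply (L x t)) (at x within UNIV)"
        by (simp add: L[abs_def])
    qed (auto intro!: integrable_continuous cont[OF s])
    moreover have "blinfun_apply (integral (cbox a b) (L x)) e = - I (dir_deriv e \<rho>) x" for e
    proof -
      have pair: "continuous_on (cbox a b) (\<lambda>y. (x, y))"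
        by (rule continuous_on_Pair[OF continuous_on_const continuous_on_id])
      have "continuous_on (cbox a b) (L x)"
        using continuous_on_compose2[OF contL pair] by auto
      then have "L x integrable_on cbox a b" by (rule integrable_continuous)
      from integral_linear[OF this blinfun.bounded_linear_left[of e]]
      have "blinfun_apply (integral (cbox a b) (L x)) e = integral (cbox a b) (\<lambda>y. blinfun_apply (L x y) e)"
        by (simp add: o_def)
      then show ?thesis by (simp add: L I_def)
    qed
    then have "blinfun_apply (integral (cbox a b) (L x)) = (\<lambda>e. - I (dir_deriv e \<rho>) x)"
      by (rule ext)
    ultimately show ?thesis by (simp add: I_def[abs_def])
  qed
  have "smooth (I \<rho>)"
  proof (rule smooth_coinduct[where P = "\<lambda>g. \<exists>\<rho>. smooth \<rho> \<and> g = I \<rho>"])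
    show "\<exists>\<rho>'. smooth \<rho>' \<and> I \<rho> = I \<rho>'" using \<rho> by blast
    show "g differentiable (at x)" if g: "\<exists>\<rho>. smooth \<rho> \<and> g = I \<rho>" for g x
      using g D by (auto intro: differentiableI)
    show "\<exists>\<rho>. smooth \<rho> \<and> dir_deriv e g = I \<rho>" if g: "\<exists>\<rho>. smooth \<rho> \<and> g = I \<rho>" for g e
    proof -
      obtain \<rho> where \<rho>: "smooth \<rho>" "g = I \<rho>" using g by (elim exE conjE)
      have "dir_deriv e g = I (\<lambda>x. - dir_deriv e \<rho> x)"
        unfolding \<rho>(2) by (intro ext) (simp add: dir_deriv_eq[OF D[OF \<rho>(1)]] I_def)
      then show ?thesis
        using smooth_minus[OF smooth_dir_deriv[OF \<rho>(1)]] by blast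
    qed
  qed
  then show ?thesis by (simp add: I_def[abs_def])
qed

lemma mollifier_exists:
  assumes \<delta>: "\<delta> > 0"
  obtains \<rho> :: "'a::euclidean_space \<Rightarrow> real" where "smooth \<rho>" "\<And>x. 0 \<le> \<rho> x" "avg_kernel \<delta> (density lborel \<rho>)"
proof -
  \<comment> \<open>With this steepness the bump equals one on the ball of radius
    \<open>\<delta> / 2\<close>, so its integral is positive and can be normalised.\<close>
  define \<beta> where "\<beta> = ball_bump (0::'a) \<delta> (2 / \<delta>\<^sup>2)"
  have \<beta>: "smooth \<beta>" "0 \<le> \<beta> x" "\<beta> x \<le> 1" for x
    by (simp_all add: \<beta>_def smooth_ball_bump ball_bump_bounds)
  have out: "\<beta> x = 0" if "x \<notin> ball 0 \<delta>" for x
    unfolding \<beta>_def using \<delta> that by (intro ball_bump_outside) auto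
  have ins: "\<beta> x = 1" if "x \<in> ball 0 (\<delta> / 2)" for x
    unfolding \<beta>_def
  proof (rule ball_bump_inside)
    have "(norm x)\<^sup>2 \<le> (\<delta> / 2)\<^sup>2" using that by (intro power_mono) auto
    then have "4 * (norm x)\<^sup>2 \<le> \<delta>\<^sup>2" by (simp add: power_divide)
    then have "2 * (norm x)\<^sup>2 \<le> \<delta>\<^sup>2" by (rule order_trans[rotated]) simp
    then have "\<delta>\<^sup>2 \<le> 2 * (\<delta>\<^sup>2 - (norm x)\<^sup>2)" by simp
    then show "1 \<le> 2 / \<delta>\<^sup>2 * (\<delta>\<^sup>2 - (norm (x - 0))\<^sup>2)" using \<delta> by (simp add: field_simps)
  qed
  have meas: "\<beta> \<in> borel_measurable borel"
    by (rule borel_measurable_continuous_onI[OF smooth_continuous_on[OF \<beta>(1)]])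
  have int: "integrable lborel \<beta>"
  proof (rule Bochner_Integration.integrable_bound[of _ "indicator (cball (0::'a) \<delta>) :: _ \<Rightarrow> real"])
    show "integrable lborel (indicator (cball (0::'a) \<delta>) :: _ \<Rightarrow> real)"
      using emeasure_lborel_cball_finite by (simp add: integrable_indicator_iff)
    show "AE x in lborel. norm (\<beta> x) \<le> norm (indicator (cball (0::'a) \<delta>) x :: real)"
    proof (rule AE_I2)
      fix x :: 'a
      show "norm (\<beta> x) \<le> norm (indicator (cball (0::'a) \<delta>) x :: real)"
        using \<beta>(2,3)[of x] out[of x] by (cases "x \<in> cball 0 \<delta>") (auto simp: indicator_def)
    qed
  qed (use meas in simp)
  define c where "c = (LINT x|lborel. \<beta> x)"
  have "measure lborel (ball (0::'a) (\<delta> / 2)) = (LINT x|lborel. indicator (ball (0::'a) (\<delta> / 2)) x)"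
    by simp
  also have "\<dots> \<le> c"
    unfolding c_def
  proof (rule integral_mono[OF _ int])
    show "integrable lborel (indicator (ball (0::'a) (\<delta> / 2)) :: _ \<Rightarrow> real)"
      using emeasure_lborel_ball_finite by (simp add: integrable_indicator_iff)
    show "indicator (ball (0::'a) (\<delta> / 2)) x \<le> \<beta> x" for x
      using ins[of x] \<beta>(2)[of x] by (auto simp: indicator_def)
  qed
  finally have c: "c > 0" using content_ball_pos[of "\<delta> / 2" "0::'a"] \<delta> by linarith
  define \<rho> where "\<rho> x = (1 / c) * \<beta> x" for x
  have \<rho>: "smooth \<rho>" "\<And>x. 0 \<le> \<rho> x"
    unfolding \<rho>_def by (rule smooth_mult[OF smooth_const \<beta>(1)]) (use \<beta>(2) c in simp)
  have \<rho>m: "(\<lambda>x. ennreal (\<rho> x)) \<in> borel_measurable lborel"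
    unfolding \<rho>_def using meas by measurable
  have "integrable lborel \<rho>" unfolding \<rho>_def using int by simp
  then have "(\<integral>\<^sup>+x. ennreal (\<rho> x) \<partial>lborel) = ennreal (LINT x|lborel. \<rho> x)"
    by (rule nn_integral_eq_integral) (simp add: \<rho>(2))
  also have "(LINT x|lborel. \<rho> x) = 1" using c by (simp add: \<rho>_def c_def)
  finally have tot: "(\<integral>\<^sup>+x. ennreal (\<rho> x) \<partial>lborel) = 1" by simp
  have "avg_kernel \<delta> (density lborel \<rho>)"
    unfolding avg_kernel_def
  proof (intro conjI)
    show "emeasure (density lborel \<rho>) UNIV = 1"
      by (subst emeasure_density[OF \<rho>m]) (simp_all add: tot)
    show "AE z in density lborel \<rho>. norm z \<le> \<delta>"
      unfolding AE_density[OF \<rho>m]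
    proof (rule AE_I2, rule impI)
      fix z assume "0 < ennreal (\<rho> z)"
      then have "\<beta> z \<noteq> 0" by (auto simp: \<rho>_def)
      then show "norm z \<le> \<delta>" using out[of z] by fastforce
    qed
  qed simp
  then show ?thesis using that \<rho> by blast
qed

text \<open>The substitution \<open>y = x + z\<close> moves the dependence on \<open>x\<close> from
  \<open>v\<close> to the smooth density, and the bounded support of \<open>v\<close> reduces the
  integral to a box.\<close>

lemma smooth_shift:
  fixes v :: "'a::euclidean_space \<Rightarrow> real"
  assumes v: "continuous_on UNIV v" and supp: "\<And>x. norm x > B \<Longrightarrow> v x = 0"
    and \<rho>: "smooth \<rho>" "\<And>x. 0 \<le> \<rho> x"
  shows "smooth (shift (density lborel \<rho>) v)"
proof -
  obtain a b :: 'a where ab: "cball 0 B \<subseteq> cbox a b"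
    using bounded_subset_cbox_symmetric[OF bounded_cball] by metis
  have \<rho>m: "\<rho> \<in> borel_measurable borel" and vm: "v \<in> borel_measurable borel"
    by (intro borel_measurable_continuous_onI smooth_continuous_on[OF \<rho>(1)] v)+
  have "shift (density lborel \<rho>) v x = integral (cbox a b) (\<lambda>y. v y * \<rho> (y - x))" for x
  proof -
    let ?F = "\<lambda>y. v y * \<rho> (y - x)"
    have Fm: "?F \<in> borel_measurable borel" using \<rho>m vm by measurable
    have "shift (density lborel \<rho>) v x = (LINT z|lborel. \<rho> z *\<^sub>R v (x + z))"
      unfolding shift_def by (rule integral_density) (use \<rho>m vm \<rho>(2) in auto)
    also have "\<dots> = (LINT z|lborel. ?F (x + z))" by (simp add: mult.commute)
    also have "\<dots> = (LINT y|lborel. ?F y)" by (rule lborel_integral_translate[OF Fm])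
    also have "\<dots> = (LINT y|lborel. indicator (cbox a b) y *\<^sub>R ?F y)"
    proof (rule Bochner_Integration.integral_cong[OF refl])
      fix y
      have "v y = 0" if "y \<notin> cbox a b"
      proof (rule supp)
        have "y \<notin> cball 0 B" using that ab by blast
        then show "B < norm y" by simp
      qed
      then show "?F y = indicator (cbox a b) y *\<^sub>R ?F y" by (auto simp: indicator_def)
    qed
    also have "\<dots> = integral (cbox a b) ?F"
    proof -
      have "continuous_on (cbox a b) ?F"
        by (intro continuous_intros continuous_on_subset[OF v] continuous_on_compose2[OF smooth_continuous_on[OF \<rho>(1), of UNIV]]) auto
      then have "set_integrable lborel (cbox a b) ?F"
        unfolding set_integrable_def by (intro borel_integrable_compact compact_cbox)
      from set_borel_integral_eq_integral(2)[OF this] show ?thesis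
        by (simp add: set_lebesgue_integral_def)
    qed
    finally show ?thesis .
  qed
  then have "shift (density lborel \<rho>) v = (\<lambda>x. integral (cbox a b) (\<lambda>y. v y * \<rho> (y - x)))" by blast
  then show ?thesis using smooth_convolution[OF v \<rho>(1)] by simp
qed

section \<open>Plurisubharmonic functions\<close>

lemma hess_linear: "smooth g \<Longrightarrow> linear (\<lambda>x. hess g y x z)"
  unfolding hess_def
  using smooth_has_derivative[OF smooth_dir_deriv] has_derivative_linear by blast

lemma hess_sym: "smooth g \<Longrightarrow> hess g y a b = hess g y b a"
  unfolding hess_def by (rule dir_deriv_commute_real)

lemma hess_expand:
  assumes g: "smooth g"
  shows "hess g y a b = (\<Sum>c\<in>Basis. \<Sum>d\<in>Basis. (a \<bullet> c) * (b \<bullet> d) * hess g y c d)"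
  by (rule bilinear_expand[OF hess_linear[OF g] hess_sym[OF g]])

text \<open>The second-order condition at \<open>s = 0\<close> for the averages of \<open>g\<close> over the balls of radius \<open>s\<close>
  in the line through \<open>b\<close>.\<close>

lemma hess_average_nonneg:
  fixes g :: "'n::finite hspace \<Rightarrow> real"
  assumes g: "smooth g" and s0: "s0 > 0"
    and sub: "\<And>s. 0 < s \<Longrightarrow> s < s0 \<Longrightarrow> g x \<le> (LINT q|unif. g (x + s *\<^sub>R hmul b q))"
  shows "0 \<le> (LINT q|unif. hess g x (hmul b q) (hmul b q))"
proof -
  interpret h: bounded_linear "hmul b"
    by (rule bounded_bilinear.bounded_linear_right[OF bilinear_hmul])
  \<comment> \<open>A null sequence below \<open>s0\<close>, where the hypothesis applies, and at
    most one, which keeps the intermediate points in a fixed compact set.\<close>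
  define s where "s n = min 1 (s0 / 2) / real (Suc n)" for n
  have s: "0 < s n" "s n < s0" "s n \<le> 1" for n
  proof -
    show "0 < s n" using s0 by (simp add: s_def)
    have "s n \<le> min 1 (s0 / 2) / 1" unfolding s_def using s0 by (intro divide_left_mono) auto
    then show "s n < s0" "s n \<le> 1" using s0 by auto
  qed
  have s_lim: "s \<longlonglongrightarrow> 0"
    unfolding s_def using tendsto_mult_right_zero[OF LIMSEQ_Suc[OF lim_1_over_n], of "min 1 (s0 / 2)"] by simp
  \<comment> \<open>The symmetric second difference quotient. As \<open>unif\<close> is invariant
    under \<open>q \<mapsto> - q\<close>, its average is twice the excess of the ball average over
    \<open>g x\<close>, divided by the squared radius.\<close>
  define E where "E n q = (g (x + s n *\<^sub>R hmul b q) + g (x - s n *\<^sub>R hmul b q) - 2 * g x) / (s n)\<^sup>2" for n q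
  have gc: "continuous_on A g" for A by (rule smooth_continuous_on[OF g])
  have cont1: "continuous_on UNIV (\<lambda>q. g (x + t *\<^sub>R hmul b q))" for t
    by (intro continuous_on_compose2[OF gc[of UNIV]] continuous_intros hmul_continuous) auto
  note int = integrable_unif_continuous[OF cont1]
  have E_int: "integrable unif (E n)" for n
    unfolding E_def using int[of "s n"] int[of "- s n"] integrable_unif_continuous[of "\<lambda>_. 2 * g x"]
    by (simp add: finite_measure.integrable_const[OF finite_measure_unif])
  have E_nonneg: "0 \<le> (LINT q|unif. E n q)" for n
  proof -
    have "(LINT q|unif. g (x - s n *\<^sub>R hmul b q)) = (LINT q|unif. g (x + s n *\<^sub>R hmul b q))"
      using integral_unif_uminus[OF borel_measurable_continuous_onI[OF cont1[of "s n"]]]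
      by (simp add: h.neg)
    moreover have "(LINT q|unif. 2 * g x) = 2 * g x"
      by (simp add: measure_def emeasure_unif_UNIV)
    ultimately have "(LINT q|unif. E n q) = (2 * (LINT q|unif. g (x + s n *\<^sub>R hmul b q)) - 2 * g x) / (s n)\<^sup>2"
      unfolding E_def using int[of "s n"] int[of "- s n"]
      by (simp add: finite_measure.integrable_const[OF finite_measure_unif])
    then show ?thesis using sub[OF s(1,2)] by simp
  qed
  \<comment> \<open>\<open>second_difference\<close> is applied at the base point
    \<open>x - s v\<close> with both directions equal to \<open>v\<close>; the intermediate point
    \<open>x + (a + c - s) v\<close> satisfies \<open>\<bar>a + c - s\<bar> < s\<close>.\<close>
  have mean: "\<exists>\<theta>. \<bar>\<theta>\<bar> < s n \<and> E n q = hess g (x + \<theta> *\<^sub>R hmul b q) (hmul b q) (hmul b q)" for n q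
  proof -
    let ?v = "hmul b q" and ?y = "x - s n *\<^sub>R hmul b q"
    obtain a c where ac: "0 < a" "a < s n" "0 < c" "c < s n"
      "g (?y + s n *\<^sub>R ?v + s n *\<^sub>R ?v) - g (?y + s n *\<^sub>R ?v) - g (?y + s n *\<^sub>R ?v) + g ?y
        = (s n)\<^sup>2 * dir_deriv ?v (dir_deriv ?v g) (?y + a *\<^sub>R ?v + c *\<^sub>R ?v)"
      by (rule second_difference[OF g s(1)])
    have "?y + a *\<^sub>R ?v + c *\<^sub>R ?v = x + (a + c - s n) *\<^sub>R ?v" by (simp add: algebra_simps)
    then have "E n q = hess g (x + (a + c - s n) *\<^sub>R ?v) ?v ?v"
      using ac(5) s(1)[of n] by (simp add: E_def hess_def field_simps)
    moreover have "\<bar>a + c - s n\<bar> < s n" using ac(1-4) by linarith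
    ultimately show ?thesis by blast
  qed
  have cd: "continuous_on UNIV (\<lambda>y. hess g y c d)" for c d
    unfolding hess_def by (rule smooth_continuous_on[OF smooth_dir_deriv[OF smooth_dir_deriv[OF g]]])
  have hess_cont: "continuous_on UNIV (\<lambda>p. hess g (fst p) (snd p) (snd p))"
    unfolding hess_expand[OF g, of "fst _" "snd _"]
    by (intro continuous_intros continuous_on_compose2[OF cd]) auto
  have lim: "(\<lambda>n. E n q) \<longlonglongrightarrow> hess g x (hmul b q) (hmul b q)" for q
  proof -
    obtain \<theta> where \<theta>: "\<And>n. \<bar>\<theta> n\<bar> < s n" "\<And>n. E n q = hess g (x + \<theta> n *\<^sub>R hmul b q) (hmul b q) (hmul b q)"
      using mean[of _ q] by metis
    have "\<theta> \<longlonglongrightarrow> 0"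
      by (rule tendsto_rabs_zero_cancel, rule tendsto_sandwich[OF _ _ tendsto_const s_lim])
        (use \<theta>(1) in \<open>auto intro!: always_eventually less_imp_le\<close>)
    then have l: "(\<lambda>n. x + \<theta> n *\<^sub>R hmul b q) \<longlonglongrightarrow> x" by (auto intro!: tendsto_eq_intros)
    have "continuous_on UNIV (\<lambda>y. hess g y (hmul b q) (hmul b q))" by (rule cd)
    then have "(\<lambda>n. hess g (x + \<theta> n *\<^sub>R hmul b q) (hmul b q) (hmul b q)) \<longlonglongrightarrow> hess g x (hmul b q) (hmul b q)"
      using l by (auto simp: continuous_on_eq_continuous_at intro: isCont_tendsto_compose)
    then show ?thesis by (simp only: \<theta>(2)[symmetric])
  qed
  obtain C where C: "C > 0" "\<And>q. norm (hmul b q) \<le> norm q * C" using h.pos_bounded by blast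
  have "compact ((\<lambda>p. hess g (fst p) (snd p) (snd p)) ` (cball x C \<times> cball 0 C))"
    by (intro compact_continuous_image continuous_on_subset[OF hess_cont] compact_Times compact_cball) auto
  from compact_imp_bounded[OF this, unfolded bounded_iff]
  obtain B where B: "\<forall>z\<in>(\<lambda>p. hess g (fst p) (snd p) (snd p)) ` (cball x C \<times> cball 0 C). norm z \<le> B" ..
  have bound: "norm (E n q) \<le> B" if q: "norm q \<le> 1" for n q
  proof -
    obtain \<theta> where \<theta>: "\<bar>\<theta>\<bar> < s n" "E n q = hess g (x + \<theta> *\<^sub>R hmul b q) (hmul b q) (hmul b q)"
      using mean[of n q] by (elim exE conjE)
    have hC: "norm (hmul b q) \<le> C" using C(2)[of q] q C(1) mult_right_mono[OF q, of C] by linarith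
    have "\<bar>\<theta>\<bar> * norm (hmul b q) \<le> 1 * C"
      using \<theta>(1) s(3)[of n] hC by (intro mult_mono) auto
    then have "(x + \<theta> *\<^sub>R hmul b q, hmul b q) \<in> cball x C \<times> cball 0 C"
      using hC by (simp add: dist_norm)
    then have "hess g (fst (x + \<theta> *\<^sub>R hmul b q, hmul b q)) (snd (x + \<theta> *\<^sub>R hmul b q, hmul b q)) (snd (x + \<theta> *\<^sub>R hmul b q, hmul b q))
       \<in> (\<lambda>p. hess g (fst p) (snd p) (snd p)) ` (cball x C \<times> cball 0 C)" by (rule imageI)
    from bspec[OF B this] show ?thesis unfolding \<theta>(2) by simp
  qed
  have "(\<lambda>n. LINT q|unif. E n q) \<longlonglongrightarrow> (LINT q|unif. hess g x (hmul b q) (hmul b q))"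
  proof (rule integral_dominated_convergence[where w = "\<lambda>_. B"])
    show "AE q in unif. norm (E n q) \<le> B" for n
      using AE_unif by eventually_elim (rule bound)
    have "continuous_on UNIV (\<lambda>q. hess g x (hmul b q) (hmul b q))"
      unfolding hess_expand[OF g, of x "hmul b _"] by (intro continuous_intros hmul_continuous)
    then show "(\<lambda>q. hess g x (hmul b q) (hmul b q)) \<in> borel_measurable unif"
      using integrable_unif_continuous borel_measurable_integrable by blast
  qed (use lim E_int borel_measurable_integrable finite_measure.integrable_const[OF finite_measure_unif] in auto)
  then show ?thesis
    by (rule tendsto_lowerbound) (use E_nonneg in auto)
qed

lemma ereal_integral_on_real:
  fixes f :: "'a::euclidean_space \<Rightarrow> real"
  assumes A: "A \<in> sets borel" and f: "integrable lborel (\<lambda>x. indicator A x * f x)"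
  shows "ereal_integral_on A (\<lambda>x. ereal (f x)) = ereal (LINT x|lborel. indicator A x * f x)"
proof -
  let ?F = "\<lambda>x. indicator A x * f x"
  have e: "(\<integral>\<^sup>+x\<in>A. e2ennreal (ereal (f x)) \<partial>lborel) = (\<integral>\<^sup>+x. ennreal (?F x) \<partial>lborel)"
    "(\<integral>\<^sup>+x\<in>A. e2ennreal (- ereal (f x)) \<partial>lborel) = (\<integral>\<^sup>+x. ennreal (- ?F x) \<partial>lborel)"
    by (auto intro!: nn_integral_cong simp: indicator_def)
  have fin: "(\<integral>\<^sup>+x. ennreal (?F x) \<partial>lborel) \<noteq> \<infinity>" "(\<integral>\<^sup>+x. ennreal (- ?F x) \<partial>lborel) \<noteq> \<infinity>"
    using f by (auto simp: real_integrable_def)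
  have "ereal_integral_on A (\<lambda>x. ereal (f x))
      = enn2ereal (ennreal (enn2real (\<integral>\<^sup>+x. ennreal (?F x) \<partial>lborel)))
        - enn2ereal (ennreal (enn2real (\<integral>\<^sup>+x. ennreal (- ?F x) \<partial>lborel)))"
    unfolding ereal_integral_on_def e using fin by (simp add: ennreal_enn2real_if)
  also have "\<dots> = ereal (LINT x|lborel. ?F x)"
    unfolding real_lebesgue_integral_def[OF f] by (simp add: enn2ereal_ennreal)
  finally show ?thesis .
qed

section \<open>Neighbourhoods, local bounds and semicontinuity\<close>

definition nbhd :: "'a::real_normed_vector set \<Rightarrow> real \<Rightarrow> 'a set" where
  "nbhd K s = {x. \<exists>k\<in>K. norm (x - k) \<le> s}"

lemma nbhd_add: "x \<in> nbhd K s \<Longrightarrow> norm z \<le> t \<Longrightarrow> x + z \<in> nbhd K (s + t)"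
proof -
  assume "x \<in> nbhd K s" "norm z \<le> t"
  then obtain k where k: "k \<in> K" "norm (x - k) \<le> s" by (auto simp: nbhd_def)
  have "norm (x + z - k) \<le> norm (x - k) + norm z"
    by (metis add.commute add_diff_eq norm_triangle_ineq)
  then show ?thesis using k \<open>norm z \<le> t\<close> by (force simp: nbhd_def)
qed

lemma nbhd_mono: "s \<le> t \<Longrightarrow> x \<in> nbhd K s \<Longrightarrow> x \<in> nbhd K t"
  by (force simp: nbhd_def)

lemma compact_nbhd:
  fixes K :: "'a::euclidean_space set"
  assumes "compact K" shows "compact (nbhd K s)"
proof -
  have "nbhd K s = {x + y | x y. x \<in> K \<and> y \<in> cball 0 s}"
  proof safe
    fix x assume "x \<in> nbhd K s"
    then obtain k where "k \<in> K" "norm (x - k) \<le> s" by (auto simp: nbhd_def)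
    then show "\<exists>a b. x = a + b \<and> a \<in> K \<and> b \<in> cball 0 s"
      by (intro exI[of _ k] exI[of _ "x - k"]) auto
  next
    fix a b :: 'a assume "a \<in> K" "b \<in> cball 0 s"
    then show "a + b \<in> nbhd K s" by (auto simp: nbhd_def intro!: bexI[of _ a])
  qed
  then show ?thesis by (simp only: compact_sums[OF assms compact_cball])
qed

lemma locally_bounded_compact:
  assumes "locally_bounded_on \<Omega> u" "compact K" "K \<subseteq> \<Omega>"
  obtains M :: real where "\<And>x. x \<in> K \<Longrightarrow> \<bar>u x\<bar> \<le> ereal M"
proof -
  have "\<forall>x\<in>K. \<exists>e. e > 0 \<and> (\<exists>M::real. \<forall>y\<in>\<Omega> \<inter> ball x e. \<bar>u y\<bar> \<le> ereal M)"
    using assms(1,3) by (auto simp: locally_bounded_on_def)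
  from bchoice[OF this] obtain e where
    e: "\<forall>x\<in>K. e x > 0 \<and> (\<exists>M::real. \<forall>y\<in>\<Omega> \<inter> ball x (e x). \<bar>u y\<bar> \<le> ereal M)" ..
  then have "\<forall>x\<in>K. \<exists>M::real. \<forall>y\<in>\<Omega> \<inter> ball x (e x). \<bar>u y\<bar> \<le> ereal M" by blast
  from bchoice[OF this] obtain M :: "_ \<Rightarrow> real" where
    M: "\<forall>x\<in>K. \<forall>y\<in>\<Omega> \<inter> ball x (e x). \<bar>u y\<bar> \<le> ereal (M x)" ..
  have cover: "K \<subseteq> (\<Union>x\<in>K. ball x (e x))" using e by force
  obtain C where C: "C \<subseteq> K" "finite C" "K \<subseteq> (\<Union>x\<in>C. ball x (e x))"
    by (rule compactE_image[OF assms(2) _ cover]) (auto intro: that)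
  have "\<bar>u y\<bar> \<le> ereal (Max (insert 0 (M ` C)))" if "y \<in> K" for y
  proof -
    obtain x where x: "x \<in> C" "y \<in> ball x (e x)" using C(3) \<open>y \<in> K\<close> by blast
    then have "\<bar>u y\<bar> \<le> ereal (M x)" using M C(1) assms(3) \<open>y \<in> K\<close> by blast
    also have "M x \<le> Max (insert 0 (M ` C))" using C(2) x(1) by (intro Max_ge) auto
    finally show ?thesis by simp
  qed
  then show ?thesis by (rule that)
qed

lemma usc_on_open_sublevel:
  assumes "open \<Omega>" "usc_on \<Omega> u" shows "open {x \<in> \<Omega>. u x < c}"
  unfolding open_subopen[of "{x \<in> \<Omega>. u x < c}"]
proof
  fix x assume "x \<in> {x \<in> \<Omega>. u x < c}"
  then have x: "x \<in> \<Omega>" "u x < c" by auto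
  then have "\<forall>\<^sub>F y in at x within \<Omega>. u y < c" using assms(2) by (auto simp: usc_on_def)
  then have "\<forall>\<^sub>F y in at x. u y < c" by (simp only: at_within_open[OF x(1) assms(1)])
  then have "\<exists>S. open S \<and> x \<in> S \<and> (\<forall>y\<in>S. y \<noteq> x \<longrightarrow> u y < c)"
    by (simp only: eventually_at_topological UNIV_I simp_thms)
  then obtain S where S: "open S" "x \<in> S" "\<forall>y\<in>S. y \<noteq> x \<longrightarrow> u y < c"
    by (elim exE conjE)
  have "S \<inter> \<Omega> \<subseteq> {x \<in> \<Omega>. u x < c}" using S(3) x(2) by auto
  then show "\<exists>T. open T \<and> x \<in> T \<and> T \<subseteq> {x \<in> \<Omega>. u x < c}"
    using S(1,2) x(1) assms(1) by (intro exI[of _ "S \<inter> \<Omega>"] conjI open_Int IntI)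
qed

lemma usc_borel:
  assumes "open \<Omega>" "usc_on \<Omega> u" "K \<in> sets borel" "K \<subseteq> \<Omega>" "\<And>x. x \<in> K \<Longrightarrow> \<bar>u x\<bar> \<noteq> \<infinity>"
  shows "(\<lambda>x. indicator K x * real_of_ereal (u x)) \<in> borel_measurable borel"
proof (rule borel_measurableI_less)
  fix a :: real
  have "{x \<in> space borel. indicator K x * real_of_ereal (u x) < a}
      = (K \<inter> {x \<in> \<Omega>. u x < ereal a}) \<union> (if 0 < a then - K else {})"
  proof (intro set_eqI iffI)
    fix x
    have "real_of_ereal (u x) < a \<longleftrightarrow> u x < ereal a" if "x \<in> K"
      using assms(5)[OF that] by (cases "u x") auto
    then show "x \<in> {x \<in> space borel. indicator K x * real_of_ereal (u x) < a} \<Longrightarrow>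
        x \<in> (K \<inter> {x \<in> \<Omega>. u x < ereal a}) \<union> (if 0 < a then - K else {})"
      and "x \<in> (K \<inter> {x \<in> \<Omega>. u x < ereal a}) \<union> (if 0 < a then - K else {}) \<Longrightarrow>
        x \<in> {x \<in> space borel. indicator K x * real_of_ereal (u x) < a}"
      using assms(4) by (cases "x \<in> K"; auto split: if_splits)+
  qed
  moreover have "K \<inter> {x \<in> \<Omega>. u x < ereal a} \<in> sets borel"
    using usc_on_open_sublevel[OF assms(1,2)] assms(3) by auto
  moreover have "- K \<in> sets borel" using assms(3) by auto
  ultimately show "{x \<in> space borel. indicator K x * real_of_ereal (u x) < a} \<in> sets borel" by auto
qed

text \<open>The unit ball is enough because rescaling \<open>b\<close> produces every other radius
  on the same line. For \<open>b = 0\<close>, which \<open>PSH\<close> leaves out, the line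
  degenerates to a point and both sides agree.\<close>

lemma psh_line_submean:
  fixes u :: "'n::finite hspace \<Rightarrow> ereal"
  assumes u: "u \<in> PSH \<Omega>" and K: "K \<subseteq> \<Omega>" and fin: "\<And>x. x \<in> K \<Longrightarrow> \<bar>u x\<bar> \<noteq> \<infinity>"
    and w: "w = (\<lambda>x. indicator K x * real_of_ereal (u x))" "bounded_borel M w"
    and line: "\<And>q. norm q \<le> 1 \<Longrightarrow> x + hmul b q \<in> K"
  shows "w x \<le> shift (line b) w x"
proof (cases "b = 0")
  case True
  have "hmul 0 q = (0 :: 'n hspace)" for q by (rule bounded_bilinear.zero_left[OF bilinear_hmul])
  then show ?thesis
    unfolding shift_line[OF bounded_borelD(1)[OF w(2)]] True by (simp add: measure_def emeasure_unif_UNIV)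
next
  case False
  note wm = bounded_borelD(1)[OF w(2)]
  let ?f = "\<lambda>q. w (x + hmul b q)"
  have wu: "u (x + hmul b q) = ereal (?f q)" if "q \<in> B1" for q
    using line[of q] fin[of "x + hmul b q"] that by (simp add: w(1) ereal_real')
  have sub: "subharmonic_on {q. right_line x b q \<in> \<Omega>} (\<lambda>q. u (right_line x b q))"
    using u False by (simp add: PSH_def)
  have "cball 0 1 \<subseteq> {q. right_line x b q \<in> \<Omega>}"
    using line K by (auto simp: right_line_eq)
  then have "ereal V1 * u (right_line x b 0) \<le> ereal_integral_on B1 (\<lambda>q. u (right_line x b q))"
    using sub unfolding subharmonic_on_def V1_def by (metis zero_less_one)
  also have "ereal_integral_on B1 (\<lambda>q. u (right_line x b q)) = ereal_integral_on B1 (\<lambda>q. ereal (?f q))"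
    unfolding ereal_integral_on_def right_line_eq
    by (intro arg_cong2[where f = minus] arg_cong[where f = enn2ereal] nn_integral_cong)
      (auto simp: indicator_def wu)
  also have "\<dots> = ereal (LINT q|lborel. indicator B1 q * ?f q)"
  proof (rule ereal_integral_on_real)
    show "integrable lborel (\<lambda>q. indicator B1 q * ?f q)"
    proof (rule Bochner_Integration.integrable_bound[OF integrable_mult_right[OF integrable_indicator_shift[of 0], of M]])
      show "AE q in lborel. norm (indicator B1 q * ?f q) \<le> norm (M * indicator B1 (q - 0))"
        using order_trans[OF bounded_borelD(2)[OF w(2)] abs_ge_self] by (auto simp: indicator_def)
    qed (use wm in measurable)
  qed simp
  also have "u (right_line x b 0) = ereal (w x)"
    using wu[of 0] by (simp add: right_line_eq)
  finally have "V1 * w x \<le> (LINT q|lborel. indicator B1 q * ?f q)" by simp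
  moreover have "shift (line b) w x = (LINT q|lborel. indicator B1 q * ?f q) / V1"
    unfolding shift_line[OF wm] by (rule integral_unif) (use wm in measurable)
  ultimately show ?thesis by (simp only: pos_le_divide_eq[OF V1_pos] mult.commute[of "w x"])
qed

lemma shift_ge_const:
  assumes \<nu>: "avg_kernel R \<nu>" and f: "bounded_borel M f" and le: "\<And>z. norm z \<le> R \<Longrightarrow> c \<le> f (x + z)"
  shows "c \<le> shift \<nu> f x"
proof -
  have "(LINT z|\<nu>. c) \<le> shift \<nu> f x"
    unfolding shift_def
    by (rule integral_mono_AE[OF finite_measure.integrable_const[OF kernelD(5)[OF \<nu>]] shift_integrable[OF \<nu> f]])
      (use kernelD(4)[OF \<nu>] le in \<open>auto elim: eventually_mono\<close>)
  then show ?thesis by (simp only: shift_const[OF \<nu>])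
qed

text \<open>Setting \<open>u\<close> to zero outside the closed
  \<open>\<epsilon>\<close>-neighbourhood makes \<open>w\<close> a bounded Borel function on the
  whole space, so all averages exist. The sub-mean value inequality is then used only while
  averaging stays inside this neighbourhood; \<open>\<epsilon>\<close> is a budget from which every
  average deducts its radius.\<close>

locale psh_cutoff =
  fixes \<Omega> K :: "'n::finite hspace set" and u :: "'n hspace \<Rightarrow> ereal" and \<epsilon> M :: real
    and w :: "'n hspace \<Rightarrow> real"
  assumes open_\<Omega>: "open \<Omega>" and psh: "u \<in> PSH \<Omega>" and K: "compact K"
    and \<epsilon>: "\<epsilon> > 0" "nbhd K \<epsilon> \<subseteq> \<Omega>"
    and bound: "\<And>x. x \<in> nbhd K \<epsilon> \<Longrightarrow> \<bar>u x\<bar> \<le> ereal M" and M: "0 \<le> M"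
  defines "w \<equiv> \<lambda>x. indicator (nbhd K \<epsilon>) x * real_of_ereal (u x)"
begin

lemma fin: "x \<in> nbhd K \<epsilon> \<Longrightarrow> \<bar>u x\<bar> \<noteq> \<infinity>"
  using bound[of x] by auto

lemma usc: "usc_on \<Omega> u"
  using psh by (simp add: PSH_def)

lemma w_bounded: "bounded_borel M w"
  unfolding bounded_borel_def
proof (intro conjI allI)
  show "w \<in> borel_measurable borel"
    unfolding w_def
    by (rule usc_borel[OF open_\<Omega> usc borel_compact[OF compact_nbhd[OF K]] \<epsilon>(2) fin])
  fix x
  show "\<bar>w x\<bar> \<le> M"
  proof (cases "x \<in> nbhd K \<epsilon>")
    case True
    then show ?thesis using bound[OF True] by (cases "u x") (auto simp: w_def)
  qed (simp add: w_def M)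
qed

lemma submean:
  assumes "x \<in> nbhd K t" "t + R \<le> \<epsilon>" "\<And>q. norm q \<le> 1 \<Longrightarrow> norm (hmul b q) \<le> R"
  shows "w x \<le> shift (line b) w x"
proof (rule psh_line_submean[OF psh \<epsilon>(2) fin _ w_bounded])
  show "x + hmul b q \<in> nbhd K \<epsilon>" if "norm q \<le> 1" for q
    by (rule nbhd_mono[OF assms(2) nbhd_add[OF assms(1) assms(3)[OF that]]])
qed (auto simp: w_def)

text \<open>Each averaging step uses up a further \<open>r\<close> of the room around
  \<open>K\<close>; \<open>t\<close> records what has been used so far.\<close>

lemma coord_avg_ge:
  assumes r: "0 \<le> r"
  shows "x \<in> nbhd K t \<Longrightarrow> t + r * real (length ls) \<le> \<epsilon> \<Longrightarrow> w x \<le> coord_avg r ls w x"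
proof (induction ls arbitrary: x t)
  case (Cons l ls)
  have len: "t + r + r * real (length ls) \<le> \<epsilon>" using Cons.prems(2) by (simp add: distrib_left)
  moreover have "0 \<le> r * real (length ls)" using r by simp
  ultimately have tr: "t + r \<le> \<epsilon>" by linarith
  have "w x \<le> shift (coord r l) w x"
    unfolding coord_def
    by (rule submean[OF Cons.prems(1) tr]) (simp add: hmul_coord norm_axis_eq r mult_left_le)
  also have "\<dots> \<le> shift (coord r l) (coord_avg r ls w) x"
    by (rule shift_mono[OF kernel_coord[OF r] w_bounded coord_avg_bounded_borel[OF r w_bounded]])
      (rule Cons.IH[OF nbhd_add[OF Cons.prems(1)] len])
  finally show ?case by simp
qed simp

lemma smooth_approx:
  assumes r: "0 < r" and ls: "set ls = (UNIV :: 'n set)" "r * real (length ls) \<le> \<epsilon> / 4" and e: "e > 0"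
  shows "\<exists>g. smooth g \<and> (\<forall>x. \<bar>g x\<bar> \<le> M) \<and> (\<forall>x. \<bar>g x - coord_avg r ls w x\<bar> \<le> e) \<and>
     (\<forall>x\<in>K. \<forall>b. 0 \<le> (LINT q|unif. hess g x (hmul b q) (hmul b q)))"
proof -
  let ?v = "coord_avg r ls w"
  note r' = less_imp_le[OF r]
  note bv = coord_avg_bounded_borel[OF r' w_bounded, of ls]
  have cont: "continuous_on UNIV ?v"
    unfolding continuous_on_iff
  proof (intro ballI allI impI)
    fix x and e :: real assume "0 < e"
    then obtain d where d: "d > 0" "\<forall>x y. norm y < d \<longrightarrow> \<bar>?v (x + y) - ?v x\<bar> < e"
      using coord_avg_uniform[OF r w_bounded ls(1), of e] by blast
    have "dist (?v x') (?v x) < e" if "dist x' x < d" for x'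
      using d(2)[rule_format, of "x' - x" x] that by (simp add: dist_norm)
    then show "\<exists>d>0. \<forall>x'\<in>UNIV. dist x' x < d \<longrightarrow> dist (?v x') (?v x) < e" using d(1) by blast
  qed
  obtain B where B: "\<forall>x\<in>nbhd K \<epsilon>. norm x \<le> B"
    using compact_imp_bounded[OF compact_nbhd[OF K], of \<epsilon>] unfolding bounded_iff by auto
  have w0: "w x = 0" if "norm x > B" for x
  proof -
    have "x \<notin> nbhd K \<epsilon>" using B that by force
    then show ?thesis by (simp add: w_def)
  qed
  have supp: "?v x = 0" if "norm x > B + r * real (length ls)" for x
    by (rule coord_avg_support[OF r' w0 that])
  obtain d where d: "d > 0" "\<And>x y. norm y < d \<Longrightarrow> \<bar>?v (x + y) - ?v x\<bar> < e"
    using coord_avg_uniform[OF r w_bounded ls(1) e] by auto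
  \<comment> \<open>\<open>d / 2\<close> puts the closed ball of radius \<open>\<delta>\<close>
    inside the open ball where the oscillation is below \<open>e\<close>;
    \<open>\<epsilon> / 4\<close> is the mollifier's share of the room.\<close>
  define \<delta> where "\<delta> = min (d / 2) (\<epsilon> / 4)"
  have \<delta>: "\<delta> > 0" "\<delta> < d" "\<delta> \<le> \<epsilon> / 4" using d(1) \<epsilon>(1) by (auto simp: \<delta>_def)
  obtain \<rho> :: "'n hspace \<Rightarrow> real" where \<rho>: "smooth \<rho>" "\<And>x. 0 \<le> \<rho> x" "avg_kernel \<delta> (density lborel \<rho>)"
    by (rule mollifier_exists[OF \<delta>(1)]) (rule that)
  define \<nu> where "\<nu> = density lborel (\<lambda>x. ennreal (\<rho> x))"
  have \<nu>: "avg_kernel \<delta> \<nu>" using \<rho>(3) by (simp add: \<nu>_def)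
  define g where "g = shift \<nu> ?v"
  have gs: "smooth g" unfolding g_def \<nu>_def by (rule smooth_shift[OF cont supp \<rho>(1,2)])
  have bg: "bounded_borel M g" unfolding g_def by (rule shift_bounded_borel[OF \<nu> bv])
  have close: "\<bar>g x - ?v x\<bar> \<le> e" for x
  proof -
    have *: "\<bar>?v (x + z) - ?v x\<bar> \<le> e" if "norm z \<le> \<delta>" for z
      using d(2)[of z x] that \<delta>(2) by linarith
    have "g x \<le> ?v x + e" unfolding g_def by (rule shift_le_const[OF \<nu> bv]) (use * in force)
    moreover have "?v x - e \<le> g x" unfolding g_def by (rule shift_ge_const[OF \<nu> bv]) (use * in force)
    ultimately show ?thesis by linarith
  qed
  have hess: "0 \<le> (LINT q|unif. hess g x (hmul b q) (hmul b q))" if x: "x \<in> K" for x b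
  proof -
    interpret h: bounded_linear "hmul b"
      by (rule bounded_bilinear.bounded_linear_right[OF bilinear_hmul])
    obtain C where C: "C > 0" "\<And>q. norm (hmul b q) \<le> norm q * C" using h.pos_bounded by blast
    show ?thesis
    \<comment> \<open>As \<open>norm (hmul b q) \<le> C\<close> on the unit ball, this bound on
      \<open>s\<close> limits displacements along the line through \<open>b\<close> to
      \<open>\<epsilon> / 4\<close>.\<close>
    proof (rule hess_average_nonneg[OF gs, of "\<epsilon> / (4 * C)"])
      show "0 < \<epsilon> / (4 * C)" using \<epsilon>(1) C(1) by simp
      fix s assume s: "0 < s" "s < \<epsilon> / (4 * C)"
      have sC: "s * C \<le> \<epsilon> / 4" using s C(1) by (simp add: pos_less_divide_eq)
      have hs: "hmul (s *\<^sub>R b) q = s *\<^sub>R hmul b q" for q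
        by (rule bounded_bilinear.scaleR_left[OF bilinear_hmul])
      have hn: "norm (hmul (s *\<^sub>R b) q) \<le> \<epsilon> / 4" if "norm q \<le> 1" for q
      proof -
        have "norm (hmul b q) \<le> C" using C(2)[of q] mult_right_mono[OF that, of C] C(1) by linarith
        then have "s * norm (hmul b q) \<le> s * C" using s(1) by (intro mult_left_mono) auto
        then have "s * norm (hmul b q) \<le> \<epsilon> / 4" using sC by (rule order_trans)
        then show ?thesis unfolding hs using s(1) by simp
      qed
      define L where "L = line (s *\<^sub>R b)"
      have L: "avg_kernel (\<epsilon> / 4) L" unfolding L_def by (rule kernel_line[OF hn])
      note bL = shift_bounded_borel[OF L w_bounded]
      \<comment> \<open>The inequality \<open>w \<le> shift L w\<close> is applied inside the
        smoothing, and then \<open>L\<close> is commuted to the outside. Mollifier and coordinate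
        averages take a quarter of \<open>\<epsilon>\<close> each, so \<open>w\<close> is used in
        the \<open>\<epsilon> / 2\<close>-neighbourhood, and \<open>L\<close> takes one more
        quarter.\<close>
      have "g x \<le> shift \<nu> (coord_avg r ls (shift L w)) x"
        unfolding g_def
      proof (rule shift_mono[OF \<nu> bv coord_avg_bounded_borel[OF r' bL]])
        fix z :: "'n hspace" assume z: "norm z \<le> \<delta>"
        show "?v (x + z) \<le> coord_avg r ls (shift L w) (x + z)"
        proof (rule coord_avg_mono[OF r' w_bounded bL])
          fix y :: "'n hspace" assume y: "norm y \<le> r * real (length ls)"
          have "x \<in> nbhd K 0" using x by (auto simp: nbhd_def)
          from nbhd_add[OF nbhd_add[OF this z] y]
          have "x + z + y \<in> nbhd K (0 + \<delta> + r * real (length ls))" .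
          then have "x + z + y \<in> nbhd K (\<epsilon> / 2)"
            by (rule nbhd_mono[rotated]) (use \<delta>(3) ls(2) in linarith)
          then show "w (x + z + y) \<le> shift L w (x + z + y)"
            unfolding L_def by (rule submean[where R = "\<epsilon> / 4"]) (use \<epsilon>(1) hn in auto)
        qed
      qed
      also have "shift \<nu> (coord_avg r ls (shift L w)) = shift L g"
        unfolding g_def coord_avg_shift[OF r' L w_bounded, symmetric]
        by (rule shift_commute[OF \<nu> L bv])
      also have "shift L g x = (LINT q|unif. g (x + s *\<^sub>R hmul b q))"
        unfolding L_def shift_line[OF bounded_borelD(1)[OF bg]] hs ..
      finally show "g x \<le> (LINT q|unif. g (x + s *\<^sub>R hmul b q))" .
    qed
  qed
  show ?thesis
    using gs bounded_borelD(2)[OF bg] close hess by (intro exI[of _ g]) auto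
qed

text \<open>From below the sub-mean value inequality applies; from above, semicontinuity keeps
  \<open>u\<close> under any \<open>c\<close> larger than \<open>u x\<close> on a ball around
  \<open>x\<close>, and once the averages look no further than this ball they stay under
  \<open>c\<close> as well.\<close>

lemma coord_avg_limit:
  assumes x: "x \<in> K" and r: "\<And>j. 0 < r j" "\<And>j. r j * real (length ls) \<le> \<epsilon> / 4" "r \<longlonglongrightarrow> 0"
  shows "(\<lambda>j. coord_avg (r j) ls w x) \<longlonglongrightarrow> real_of_ereal (u x)"
proof (rule order_tendstoI)
  have x0: "x \<in> nbhd K 0" using x by (auto simp: nbhd_def)
  have x\<epsilon>: "x \<in> nbhd K \<epsilon>" by (rule nbhd_mono[OF less_imp_le[OF \<epsilon>(1)] x0])
  then have wx: "w x = real_of_ereal (u x)" by (simp add: w_def)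
  have ge: "w x \<le> coord_avg (r j) ls w x" for j
  proof (rule coord_avg_ge[OF less_imp_le[OF r(1)] x0])
    show "0 + r j * real (length ls) \<le> \<epsilon>" using r(2)[of j] \<epsilon>(1) by linarith
  qed
  show "\<forall>\<^sub>F j in sequentially. a < coord_avg (r j) ls w x" if "a < real_of_ereal (u x)" for a
    by (rule always_eventually, rule allI, rule less_le_trans[OF _ ge]) (simp add: wx that)
  show "\<forall>\<^sub>F j in sequentially. coord_avg (r j) ls w x < a" if a: "real_of_ereal (u x) < a" for a
  proof -
    obtain c where c: "real_of_ereal (u x) < c" "c < a" using dense[OF a] by blast
    have "u x < ereal c" using c(1) fin[OF x\<epsilon>] by (cases "u x") auto
    then have "x \<in> {y \<in> \<Omega>. u y < ereal c}" using x\<epsilon> \<epsilon>(2) by blast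
    then obtain \<rho> where \<rho>: "\<rho> > 0" "ball x \<rho> \<subseteq> {y \<in> \<Omega>. u y < ereal c}"
      using usc_on_open_sublevel[OF open_\<Omega> usc] unfolding open_contains_ball by meson
    have "(\<lambda>j. r j * real (length ls)) \<longlonglongrightarrow> 0" by (rule tendsto_mult_left_zero[OF r(3)])
    from order_tendstoD(2)[OF this \<rho>(1)]
    show ?thesis
    proof eventually_elim
      case (elim j)
      have "coord_avg (r j) ls w x \<le> c"
      proof (rule coord_avg_le_const[OF less_imp_le[OF r(1)] w_bounded])
        fix z :: "'n hspace" assume z: "norm z \<le> r j * real (length ls)"
        have "u (x + z) < ereal c" using \<rho>(2) z elim by (force simp: dist_norm)
        moreover have in_nbhd: "x + z \<in> nbhd K \<epsilon>"
          by (rule nbhd_mono[OF _ nbhd_add[OF x0 z]]) (use r(2)[of j] \<epsilon>(1) in linarith)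
        ultimately show "w (x + z) \<le> c"
          using fin[OF in_nbhd] by (cases "u (x + z)") (auto simp: w_def)
      qed
      then show ?case using c(2) by simp
    qed
  qed
qed

end

lemma psh_approximation:
  fixes u :: "'n::finite hspace \<Rightarrow> ereal"
  assumes "open \<Omega>" "u \<in> PSH \<Omega>" "locally_bounded_on \<Omega> u" "compact K" "K \<subseteq> \<Omega>"
  obtains g :: "nat \<Rightarrow> 'n hspace \<Rightarrow> real" and M where "\<And>j. smooth (g j)" "\<And>j x. \<bar>g j x\<bar> \<le> M"
    "\<And>x. x \<in> K \<Longrightarrow> (\<lambda>j. g j x) \<longlonglongrightarrow> real_of_ereal (u x)"
    "\<And>j x b. x \<in> K \<Longrightarrow> 0 \<le> (LINT q|unif. hess (g j) x (hmul b q) (hmul b q))"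
proof -
  obtain \<epsilon> where \<epsilon>: "\<epsilon> > 0" "(\<Union>x\<in>K. cball x \<epsilon>) \<subseteq> \<Omega>"
    by (rule compact_subset_open_imp_cball_epsilon_subset[OF assms(4,1,5)]) (rule that)
  have nb: "nbhd K \<epsilon> \<subseteq> \<Omega>"
    using \<epsilon>(2) by (force simp: nbhd_def dist_norm norm_minus_commute)
  obtain M0 where M0: "\<And>x. x \<in> nbhd K \<epsilon> \<Longrightarrow> \<bar>u x\<bar> \<le> ereal M0"
    by (rule locally_bounded_compact[OF assms(3) compact_nbhd[OF assms(4)] nb]) (rule that)
  define M where "M = max M0 0"
  have M: "\<bar>u x\<bar> \<le> ereal M" if "x \<in> nbhd K \<epsilon>" for x
    using M0[OF that] by (rule order_trans) (simp add: M_def)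
  interpret psh_cutoff \<Omega> K u \<epsilon> M "\<lambda>x. indicator (nbhd K \<epsilon>) x * real_of_ereal (u x)"
    by unfold_locales (use assms \<epsilon> nb M in \<open>auto simp: M_def\<close>)
  define w where "w x = indicator (nbhd K \<epsilon>) x * real_of_ereal (u x)" for x
  obtain ls :: "'n list" where ls: "set ls = UNIV" using finite_list[of "UNIV :: 'n set"] by auto
  \<comment> \<open>The first factor keeps the combined displacement of all averages within
    \<open>\<epsilon> / 4\<close> for every \<open>j\<close>; the second tends to zero.\<close>
  define r where "r j = (\<epsilon> / 4 / real (Suc (length ls))) * (1 / real (Suc j))" for j
  have r: "0 < r j" "r j * real (length ls) \<le> \<epsilon> / 4" for j
  proof -
    show "0 < r j" using \<epsilon>(1) by (simp add: r_def)
    have "r j * real (length ls) = \<epsilon> / 4 * ((real (length ls) / real (Suc (length ls))) * (1 / real (Suc j)))"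
      by (simp add: r_def)
    also have "\<dots> \<le> \<epsilon> / 4 * (1 * 1)"
      using \<epsilon>(1) by (intro mult_left_mono mult_mono) auto
    finally show "r j * real (length ls) \<le> \<epsilon> / 4" by simp
  qed
  have inv: "(\<lambda>j. 1 / real (Suc j)) \<longlonglongrightarrow> 0" by (rule LIMSEQ_Suc[OF lim_1_over_n])
  have r_lim: "r \<longlonglongrightarrow> 0"
    unfolding r_def by (rule tendsto_mult_right_zero[OF inv])
  have "\<forall>j. \<exists>g. smooth g \<and> (\<forall>x. \<bar>g x\<bar> \<le> M) \<and> (\<forall>x. \<bar>g x - coord_avg (r j) ls w x\<bar> \<le> 1 / real (Suc j)) \<and>
     (\<forall>x\<in>K. \<forall>b. 0 \<le> (LINT q|unif. hess g x (hmul b q) (hmul b q)))"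
    unfolding w_def by (intro allI smooth_approx[OF r(1) ls r(2)]) simp
  from choice[OF this] obtain g where g: "\<forall>j. smooth (g j) \<and> (\<forall>x. \<bar>g j x\<bar> \<le> M)
     \<and> (\<forall>x. \<bar>g j x - coord_avg (r j) ls w x\<bar> \<le> 1 / real (Suc j)) \<and>
     (\<forall>x\<in>K. \<forall>b. 0 \<le> (LINT q|unif. hess (g j) x (hmul b q) (hmul b q)))" ..
  show ?thesis
  proof (rule that[of g M])
    fix x assume x: "x \<in> K"
    have "(\<lambda>j. coord_avg (r j) ls w x) \<longlonglongrightarrow> real_of_ereal (u x)"
      unfolding w_def by (rule coord_avg_limit[OF x r r_lim])
    moreover have "(\<lambda>j. g j x - coord_avg (r j) ls w x) \<longlonglongrightarrow> 0"
      by (rule Lim_null_comparison[OF _ inv]) (use g in auto)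
    ultimately have "(\<lambda>j. coord_avg (r j) ls w x + (g j x - coord_avg (r j) ls w x)) \<longlonglongrightarrow> real_of_ereal (u x) + 0"
      by (rule tendsto_add)
    then show "(\<lambda>j. g j x) \<longlonglongrightarrow> real_of_ereal (u x)" by simp
  qed (use g in auto)
qed

section \<open>Products with bounded Borel functions\<close>

text \<open>Integrals of non-integrable functions default to zero, so additivity of
  \<open>cmeasure_integral\<close> has to be tied to integrable arguments. Bounded Borel functions
  supported in a compact subset of \<open>\<Omega>\<close> are integrable for all four
  measures.\<close>

definition admissible :: "'a::euclidean_space set \<Rightarrow> real \<Rightarrow> ('a \<Rightarrow> complex) \<Rightarrow> bool" where
  "admissible K B f \<longleftrightarrow> f \<in> borel_measurable borel \<and> (\<forall>x. norm (f x) \<le> B) \<and> (\<forall>x. x \<notin> K \<longrightarrow> f x = 0)"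

lemma radon_measurable:
  fixes f :: "'a::euclidean_space \<Rightarrow> complex"
  assumes "radon_measure_on \<Omega> a" "f \<in> borel_measurable borel" shows "f \<in> borel_measurable a"
proof -
  have "f \<in> borel_measurable (restrict_space borel \<Omega>)" by (rule measurable_restrict_space1[OF assms(2)])
  then show ?thesis
    using assms(1) by (simp add: radon_measure_on_def cong: measurable_cong_sets)
qed

lemma radon_indicator:
  assumes a: "radon_measure_on \<Omega> a" and K: "compact K" "K \<subseteq> \<Omega>"
  shows "integrable a (indicator K :: _ \<Rightarrow> real)" "(LINT x|a. indicator K x) = measure a K"
proof -
  have sp: "space a = \<Omega>"
    using a sets_eq_imp_space_eq[of a "restrict_space borel \<Omega>"] by (simp add: radon_measure_on_def space_restrict_space)
  have "K \<in> sets a"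
    using a K by (auto simp: radon_measure_on_def sets_restrict_space borel_compact intro!: image_eqI[of _ _ K])
  moreover have "K \<inter> \<Omega> = K" using K by blast
  moreover have "emeasure a K < \<infinity>" using a K by (simp add: radon_measure_on_def)
  ultimately show "integrable a (indicator K :: _ \<Rightarrow> real)" "(LINT x|a. indicator K x) = measure a K"
    by (simp_all add: integrable_indicator_iff sp)
qed

lemma radon_integrable:
  assumes a: "radon_measure_on \<Omega> a" and K: "compact K" "K \<subseteq> \<Omega>" and f: "admissible K B f"
  shows "integrable a f" "norm (LINT x|a. f x) \<le> B * measure a K"
proof -
  note ind = radon_indicator[OF a K]
  have le: "norm (f x) \<le> B * indicator K x" for x
    using f by (cases "x \<in> K") (auto simp: admissible_def)
  have iB: "integrable a (\<lambda>x. B * indicator K x)" using ind(1) by simp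
  have fm: "f \<in> borel_measurable borel" using f by (simp add: admissible_def)
  show int: "integrable a f"
  proof (rule Bochner_Integration.integrable_bound[OF iB])
    show "f \<in> borel_measurable a" by (rule radon_measurable[OF a fm])
    show "AE x in a. norm (f x) \<le> norm (B * indicator K x :: real)"
      unfolding real_norm_def by (intro AE_I2 order_trans[OF le abs_ge_self])
  qed
  have "norm (LINT x|a. f x) \<le> (LINT x|a. norm (f x))" by (rule integral_norm_bound)
  also have "\<dots> \<le> (LINT x|a. B * indicator K x)"
    by (rule integral_mono[OF _ iB le]) (use int in simp)
  also have "\<dots> = B * measure a K" using ind(2) by simp
  finally show "norm (LINT x|a. f x) \<le> B * measure a K" .
qed

lemma radon_limit:
  assumes a: "radon_measure_on \<Omega> a" and K: "compact K" "K \<subseteq> \<Omega>" and f: "\<And>j. admissible K B (f j)"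
    and lim: "\<And>x. (\<lambda>j. f j x) \<longlonglongrightarrow> g x" and g: "g \<in> borel_measurable borel"
  shows "(\<lambda>j. LINT x|a. f j x) \<longlonglongrightarrow> (LINT x|a. g x)"
proof (rule integral_dominated_convergence[where w = "\<lambda>x. B * indicator K x"])
  show "integrable a (\<lambda>x. B * indicator K x)" using radon_indicator[OF a K] by simp
  show "g \<in> borel_measurable a" by (rule radon_measurable[OF a g])
  show "f j \<in> borel_measurable a" for j
    using f[of j] by (intro radon_measurable[OF a]) (simp add: admissible_def)
  show "AE x in a. norm (f j x) \<le> B * indicator K x" for j
    using f[of j] by (intro AE_I2) (auto simp: admissible_def indicator_def)
qed (use lim in auto)

lemma cmeasure_integral_linear:
  assumes \<mu>: "complex_radon_measure_on \<Omega> \<mu>" and K: "compact K" "K \<subseteq> \<Omega>"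
    and f: "admissible K B f" and g: "admissible K C g"
  shows "cmeasure_integral \<mu> (\<lambda>x. f x + g x) = cmeasure_integral \<mu> f + cmeasure_integral \<mu> g"
    and "cmeasure_integral \<mu> (\<lambda>x. c * f x) = c * cmeasure_integral \<mu> f"
proof -
  obtain a1 a2 a3 a4 where \<mu>': "\<mu> = (a1, a2, a3, a4)" by (metis prod_cases4)
  have r: "radon_measure_on \<Omega> a1" "radon_measure_on \<Omega> a2" "radon_measure_on \<Omega> a3" "radon_measure_on \<Omega> a4"
    using \<mu> by (simp_all add: complex_radon_measure_on_def \<mu>')
  have add: "(LINT x|a. f x + g x) = (LINT x|a. f x) + (LINT x|a. g x)" if "radon_measure_on \<Omega> a" for a
    using radon_integrable(1)[OF that K f] radon_integrable(1)[OF that K g] by simp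
  show "cmeasure_integral \<mu> (\<lambda>x. f x + g x) = cmeasure_integral \<mu> f + cmeasure_integral \<mu> g"
    by (simp add: cmeasure_integral_def \<mu>' add[OF r(1)] add[OF r(2)] add[OF r(3)] add[OF r(4)] algebra_simps)
  have scale: "(LINT x|a. c * f x) = c * (LINT x|a. f x)" for a by simp
  show "cmeasure_integral \<mu> (\<lambda>x. c * f x) = c * cmeasure_integral \<mu> f"
    unfolding cmeasure_integral_def \<mu>' scale prod.case by (simp add: algebra_simps)
qed

text \<open>The constant is the sum of the four masses of \<open>K\<close>. It does not depend on
  the function, as the continuity of a current on forms supported in \<open>K\<close>
  demands.\<close>

lemma cmeasure_integral_bound:
  assumes \<mu>: "complex_radon_measure_on \<Omega> \<mu>" and K: "compact K" "K \<subseteq> \<Omega>"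
  shows "\<exists>C. \<forall>B f. admissible K B f \<longrightarrow> norm (cmeasure_integral \<mu> f) \<le> C * B"
proof -
  obtain a1 a2 a3 a4 where \<mu>': "\<mu> = (a1, a2, a3, a4)" by (metis prod_cases4)
  have r: "radon_measure_on \<Omega> a1" "radon_measure_on \<Omega> a2" "radon_measure_on \<Omega> a3" "radon_measure_on \<Omega> a4"
    using \<mu> by (simp_all add: complex_radon_measure_on_def \<mu>')
  have "norm (cmeasure_integral \<mu> f) \<le> (measure a1 K + measure a2 K + measure a3 K + measure a4 K) * B"
    if f: "admissible K B f" for B f
  proof -
    note b = radon_integrable(2)[OF _ K f]
    have "norm (cmeasure_integral \<mu> f) \<le> norm ((LINT x|a1. f x) - (LINT x|a2. f x))
        + norm (\<i> * ((LINT x|a3. f x) - (LINT x|a4. f x)))"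
      unfolding cmeasure_integral_def \<mu>' prod.case by (rule norm_triangle_ineq)
    also have "\<dots> \<le> (norm (LINT x|a1. f x) + norm (LINT x|a2. f x)) + (norm (LINT x|a3. f x) + norm (LINT x|a4. f x))"
      by (intro add_mono norm_triangle_ineq4) (simp add: norm_mult norm_triangle_ineq4)
    also have "\<dots> \<le> (B * measure a1 K + B * measure a2 K) + (B * measure a3 K + B * measure a4 K)"
      by (intro add_mono b r)
    finally show ?thesis by (simp add: algebra_simps)
  qed
  then show ?thesis by blast
qed

lemma cmeasure_integral_limit:
  assumes \<mu>: "complex_radon_measure_on \<Omega> \<mu>" and K: "compact K" "K \<subseteq> \<Omega>" and f: "\<And>j. admissible K B (f j)"
    and lim: "\<And>x. (\<lambda>j. f j x) \<longlonglongrightarrow> g x" and g: "g \<in> borel_measurable borel"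
  shows "(\<lambda>j. cmeasure_integral \<mu> (f j)) \<longlonglongrightarrow> cmeasure_integral \<mu> g"
proof -
  obtain a1 a2 a3 a4 where \<mu>': "\<mu> = (a1, a2, a3, a4)" by (metis prod_cases4)
  have r: "radon_measure_on \<Omega> a1" "radon_measure_on \<Omega> a2" "radon_measure_on \<Omega> a3" "radon_measure_on \<Omega> a4"
    using \<mu> by (simp_all add: complex_radon_measure_on_def \<mu>')
  show ?thesis
    unfolding cmeasure_integral_def \<mu>' prod.case
    by (intro tendsto_add tendsto_diff tendsto_mult tendsto_const radon_limit[OF _ K f lim g] r)
qed

definition admissible_form :: "'n hspace set \<Rightarrow> real \<Rightarrow> ('n hspace \<Rightarrow> 'n::{finite,linorder} ext) \<Rightarrow> bool" where
  "admissible_form K B F \<longleftrightarrow> (\<forall>J. admissible K B (\<lambda>x. F x $ J))"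

locale coefficients =
  fixes \<Omega> :: "'n::{finite,linorder} hspace set" and p :: nat and \<mu> :: "'n idx set \<Rightarrow> 'n hspace cmeasure"
  assumes radon: "\<And>I. card I = p \<Longrightarrow> complex_radon_measure_on \<Omega> (\<mu> I)"
begin

lemma pairing_add:
  assumes K: "compact K" "K \<subseteq> \<Omega>" and F: "admissible_form K B F" and G: "admissible_form K C G"
  shows "pairing p \<mu> (\<lambda>x. F x + G x) = pairing p \<mu> F + pairing p \<mu> G"
proof -
  have "cmeasure_integral (\<mu> I) (\<lambda>x. F x $ J + G x $ J)
      = cmeasure_integral (\<mu> I) (\<lambda>x. F x $ J) + cmeasure_integral (\<mu> I) (\<lambda>x. G x $ J)" if "card I = p" for I J
    using F G by (intro cmeasure_integral_linear[OF radon[OF that] K, of B _ C]) (auto simp: admissible_form_def)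
  then show ?thesis
    unfolding pairing_def sum.distrib[symmetric]
    by (intro sum.cong refl) (simp add: distrib_left)
qed

lemma pairing_smult:
  assumes K: "compact K" "K \<subseteq> \<Omega>" and F: "admissible_form K B F"
  shows "pairing p \<mu> (\<lambda>x. c *s F x) = c * pairing p \<mu> F"
proof -
  have "cmeasure_integral (\<mu> I) (\<lambda>x. c * F x $ J) = c * cmeasure_integral (\<mu> I) (\<lambda>x. F x $ J)" if "card I = p" for I J
    using F by (intro cmeasure_integral_linear(2)[OF radon[OF that] K, of B _ B "\<lambda>x. F x $ J"])
      (auto simp: admissible_form_def)
  then show ?thesis
    unfolding pairing_def sum_distrib_left by (intro sum.cong refl) (simp add: mult_ac)
qed

lemma pairing_bound:
  assumes K: "compact K" "K \<subseteq> \<Omega>"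
  shows "\<exists>C. \<forall>B F. admissible_form K B F \<longrightarrow> norm (pairing p \<mu> F) \<le> C * B"
proof -
  have "\<forall>I. \<exists>C. card I = p \<longrightarrow> (\<forall>B f. admissible K B f \<longrightarrow> norm (cmeasure_integral (\<mu> I) f) \<le> C * B)"
    using cmeasure_integral_bound[OF radon K] by blast
  from choice[OF this] obtain C where
    C: "\<forall>I. card I = p \<longrightarrow> (\<forall>B f. admissible K B f \<longrightarrow> norm (cmeasure_integral (\<mu> I) f) \<le> C I * B)" ..
  have "norm (pairing p \<mu> F) \<le> (\<Sum>I | card I = p. C I) * B" if F: "admissible_form K B F" for B F
  proof -
    have "norm (pairing p \<mu> F) \<le> (\<Sum>I | card I = p. norm (shuffle_sign I (- I) * cmeasure_integral (\<mu> I) (\<lambda>x. F x $ (- I))))"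
      unfolding pairing_def by (rule norm_sum)
    also have "\<dots> \<le> (\<Sum>I | card I = p. C I * B)"
    proof (rule sum_mono)
      fix I :: "'n idx set" assume "I \<in> {I. card I = p}"
      then show "norm (shuffle_sign I (- I) * cmeasure_integral (\<mu> I) (\<lambda>x. F x $ (- I))) \<le> C I * B"
        using C F by (simp add: norm_mult shuffle_sign_def norm_power admissible_form_def)
    qed
    finally show ?thesis by (simp add: sum_distrib_right)
  qed
  then show ?thesis by blast
qed

lemma pairing_limit:
  assumes K: "compact K" "K \<subseteq> \<Omega>" and F: "\<And>j. admissible_form K B (F j)"
    and lim: "\<And>x. (\<lambda>j. F j x) \<longlonglongrightarrow> G x" and G: "\<And>J. (\<lambda>x. G x $ J) \<in> borel_measurable borel"
  shows "(\<lambda>j. pairing p \<mu> (F j)) \<longlonglongrightarrow> pairing p \<mu> G"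
  unfolding pairing_def
proof (intro tendsto_sum tendsto_mult tendsto_const)
  fix I :: "'n idx set" assume "I \<in> {I. card I = p}"
  then have c: "card I = p" by simp
  show "(\<lambda>j. cmeasure_integral (\<mu> I) (\<lambda>x. F j x $ (- I))) \<longlonglongrightarrow> cmeasure_integral (\<mu> I) (\<lambda>x. G x $ (- I))"
    by (rule cmeasure_integral_limit[OF radon[OF c] K _ _ G])
      (use F lim in \<open>auto simp: admissible_form_def intro: tendsto_vec_nth\<close>)
qed

end

lemma smooth_admissible_form:
  assumes F: "smooth F" and K: "\<And>x. x \<notin> K \<Longrightarrow> F x = 0" and B: "\<And>x. norm (F x) \<le> B"
  shows "admissible_form K B F"
  unfolding admissible_form_def admissible_def
proof (intro allI conjI impI)
  fix J x
  have "smooth (\<lambda>x. F x $ J)" by (rule smooth_linear_compose[OF bounded_linear_nth F])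
  then show "(\<lambda>x. F x $ J) \<in> borel_measurable borel"
    by (intro borel_measurable_continuous_onI smooth_continuous_on)
  show "norm (F x $ J) \<le> B" using Finite_Cartesian_Product.norm_nth_le[of "F x" J] B[of x] by linarith
  show "F x $ J = 0" if "x \<notin> K" using K[OF that] by simp
qed

lemma compact_support_bounded:
  fixes F :: "'a::euclidean_space \<Rightarrow> 'b::real_normed_vector"
  assumes F: "smooth F" and K: "compact K" "\<And>x. x \<notin> K \<Longrightarrow> F x = 0"
  obtains B where "0 \<le> B" "\<And>x. norm (F x) \<le> B"
proof -
  have "bounded (F ` K)"
    by (intro compact_imp_bounded compact_continuous_image smooth_continuous_on F K)
  from this[unfolded bounded_iff] obtain B where B: "\<forall>y\<in>F ` K. norm y \<le> B" ..
  have "norm (F x) \<le> max B 0" for x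
  proof (cases "x \<in> K")
    case True
    then show ?thesis using bspec[OF B, of "F x"] by simp
  qed (simp add: K(2))
  then show ?thesis using that[of "max B 0"] by simp
qed

lemma admissible_form_mult:
  assumes F: "admissible_form K B F" and h: "h \<in> borel_measurable borel" "\<And>x. \<bar>h x\<bar> \<le> M" and B: "0 \<le> B"
  shows "admissible_form K (M * B) (\<lambda>x. of_real (h x) *s F x)"
  unfolding admissible_form_def admissible_def
proof (intro allI conjI impI)
  fix J x
  have f: "(\<lambda>x. F x $ J) \<in> borel_measurable borel" "norm (F x $ J) \<le> B" "x \<notin> K \<Longrightarrow> F x $ J = 0"
    using F by (auto simp: admissible_form_def admissible_def)
  show "(\<lambda>x. (of_real (h x) *s F x) $ J) \<in> borel_measurable borel"
    using f(1) h(1) by simp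
  have "0 \<le> M" using h(2)[of x] by linarith
  then show "norm ((of_real (h x) *s F x) $ J) \<le> M * B"
    using f(2) h(2)[of x] B by (auto simp: norm_mult intro!: mult_mono)
  show "(of_real (h x) *s F x) $ J = 0" if "x \<notin> K" using f(3)[OF that] by simp
qed

section \<open>Linearity, support and size of the Laplacian of a form\<close>

lemma ext_d_smult:
  assumes "smooth F" shows "ext_d \<alpha> (\<lambda>x. c *s F x) = (\<lambda>x. c *s ext_d \<alpha> F x)"
proof
  fix x
  have bl: "bounded_linear (\<lambda>X :: 'a ext. c *s X)"
    unfolding linear_conv_bounded_linear[symmetric]
    by (rule linearI) (simp_all add: vector_add_ldistrib scaleR_eq_smult vector_smult_assoc mult.commute)
  show "ext_d \<alpha> (\<lambda>x. c *s F x) x = c *s ext_d \<alpha> F x"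
    by (simp add: ext_d_eq smooth_differentiable smooth_smult assms
        dir_deriv_linear_compose[OF bl] wedge_smult_right smult_sum_right)
qed

lemma lap_smult: "smooth F \<Longrightarrow> lap (\<lambda>x. c *s F x) = (\<lambda>x. c *s lap F x)"
  unfolding lap_def by (simp add: ext_d_smult smooth_ext_d)

lemma lap_add:
  assumes "smooth F" "smooth G" shows "lap (\<lambda>x. F x + G x) = (\<lambda>x. lap F x + lap G x)"
proof -
  have "ext_d \<alpha> (\<lambda>x. F x + G x) = (\<lambda>x. ext_d \<alpha> F x + ext_d \<alpha> G x)" if "smooth F" "smooth G" for \<alpha> and F G :: "'a hspace \<Rightarrow> 'a ext"
    by (intro ext ext_d_add smooth_differentiable that)
  then show ?thesis by (simp add: lap_def assms smooth_ext_d)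
qed

lemma lap_outside:
  assumes "smooth F" "closed K" "\<And>x. x \<notin> K \<Longrightarrow> F x = 0" "x \<notin> K" shows "lap F x = 0"
  unfolding lap_def
  by (rule ext_d_outside[OF smooth_ext_d[OF assms(1)] assms(2) _ assms(4)]) (rule ext_d_outside[OF assms(1-3)])

text \<open>\<open>lap\<close> is a second-order operator with constant coefficients, so derivatives
  up to order two control it; \<open>C\<close> collects the operator norms of the wedge products.
  This yields the order \<open>2\<close> in the continuity of
  \<open>\<triangle>(u T)\<close>.\<close>

lemma lap_bound:
  "\<exists>C\<ge>0. \<forall>(F :: 'n::{finite,linorder} hspace \<Rightarrow> 'n ext) M. smooth F \<longrightarrow>
    (\<forall>vs x. set vs \<subseteq> Basis \<and> length vs \<le> 2 \<longrightarrow> norm (iter_deriv vs F x) \<le> M) \<longrightarrow> (\<forall>x. norm (lap F x) \<le> C * M)"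
proof -
  define k where "k a b = onorm (\<lambda>X. theta 0 a \<and>\<^sub>w (theta 1 b \<and>\<^sub>w X))" for a b :: "'n hspace"
  have bl: "bounded_linear (\<lambda>X. theta 0 a \<and>\<^sub>w (theta 1 b \<and>\<^sub>w X))" for a b :: "'n hspace"
    by (rule bounded_linear_compose[OF bounded_linear_wedge bounded_linear_wedge])
  have k0: "0 \<le> k a b" for a b unfolding k_def by (rule onorm_pos_le[OF bl])
  have "norm (lap F x) \<le> (\<Sum>a\<in>Basis. \<Sum>b\<in>Basis. k a b) * M"
    if F: "smooth F" and M: "\<forall>vs x. set vs \<subseteq> Basis \<and> length vs \<le> 2 \<longrightarrow> norm (iter_deriv vs F x) \<le> M"
    for F :: "'n hspace \<Rightarrow> 'n ext" and M x
  proof -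
    have "norm (lap F x) \<le> (\<Sum>a\<in>Basis. norm (\<Sum>b\<in>Basis. theta 0 a \<and>\<^sub>w (theta 1 b \<and>\<^sub>w dir_deriv a (dir_deriv b F) x)))"
      unfolding lap_eq[OF F] by (rule norm_sum)
    also have "\<dots> \<le> (\<Sum>a\<in>Basis. \<Sum>b\<in>Basis. norm (theta 0 a \<and>\<^sub>w (theta 1 b \<and>\<^sub>w dir_deriv a (dir_deriv b F) x)))"
      by (intro sum_mono norm_sum)
    also have "\<dots> \<le> (\<Sum>a\<in>Basis. \<Sum>b\<in>Basis. k a b * M)"
    proof (intro sum_mono)
      fix a b :: "'n hspace" assume ab: "a \<in> Basis" "b \<in> Basis"
      have "norm (iter_deriv [a, b] F x) \<le> M" using M ab by (simp del: iter_deriv_simps)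
      then have d: "norm (dir_deriv a (dir_deriv b F) x) \<le> M" by simp
      have "norm (theta 0 a \<and>\<^sub>w (theta 1 b \<and>\<^sub>w dir_deriv a (dir_deriv b F) x)) \<le> k a b * norm (dir_deriv a (dir_deriv b F) x)"
        unfolding k_def by (rule onorm[OF bl])
      also have "\<dots> \<le> k a b * M" by (rule mult_left_mono[OF d k0])
      finally show "norm (theta 0 a \<and>\<^sub>w (theta 1 b \<and>\<^sub>w dir_deriv a (dir_deriv b F) x)) \<le> k a b * M" .
    qed
    finally show ?thesis by (simp add: sum_distrib_right)
  qed
  moreover have "0 \<le> (\<Sum>a\<in>Basis. \<Sum>b\<in>Basis. k a b)" by (intro sum_nonneg k0)
  ultimately show ?thesis by blast
qed

text \<open>Near \<open>x\<close> the upper bound holds at every point by semicontinuity. For the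
  lower bound, \<open>{u < - M}\<close> is open, so if it met the ball it would contain a set of
  positive Lebesgue measure there, against the almost-everywhere bound.\<close>

lemma Linf_loc_locally_bounded:
  fixes u :: "'n::finite hspace \<Rightarrow> ereal"
  assumes op: "open \<Omega>" and u: "u \<in> PSH \<Omega>" "u \<in> Linf_loc \<Omega>" shows "locally_bounded_on \<Omega> u"
  unfolding locally_bounded_on_def
proof
  fix x assume x: "x \<in> \<Omega>"
  have usc: "usc_on \<Omega> u" and fin: "u x < \<infinity>" using u(1) x by (auto simp: PSH_def)
  obtain e where e: "e > 0" "cball x e \<subseteq> \<Omega>" using op x open_contains_cball by blast
  obtain M where M: "AE y in lebesgue_on (cball x e). \<bar>u y\<bar> \<le> ereal M"
    using u(2) e(2) compact_cball[of x e] unfolding Linf_loc_def mem_Collect_eq by meson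
  obtain N :: real where N: "u x < ereal N" using ereal_dense2[OF fin] by blast
  then have "x \<in> {y \<in> \<Omega>. u y < ereal N}" using x by blast
  then obtain d where d: "d > 0" "ball x d \<subseteq> {y \<in> \<Omega>. u y < ereal N}"
    using usc_on_open_sublevel[OF op usc, of "ereal N"] unfolding open_contains_ball by meson
  have lower: "ereal (- M) \<le> u y" if y: "y \<in> ball x e" for y
  proof (rule ccontr)
    assume "\<not> ereal (- M) \<le> u y"
    then have "y \<in> {z \<in> \<Omega>. u z < ereal (- M)} \<inter> ball x e" using y e(2) by (auto simp: not_le)
    moreover have "open ({z \<in> \<Omega>. u z < ereal (- M)} \<inter> ball x e)"
      by (intro open_Int usc_on_open_sublevel[OF op usc] open_ball)
    ultimately obtain r where r: "r > 0" "ball y r \<subseteq> {z \<in> \<Omega>. u z < ereal (- M)} \<inter> ball x e"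
      unfolding open_contains_ball by meson
    have "AE z in lebesgue. z \<in> cball x e \<longrightarrow> \<bar>u z\<bar> \<le> ereal M"
      using M by (simp add: AE_restrict_space_iff)
    then have "AE z in lebesgue. z \<notin> ball y r"
    proof eventually_elim
      case (elim z)
      show ?case
      proof
        assume "z \<in> ball y r"
        then have z: "u z < ereal (- M)" "z \<in> cball x e" using r(2) by auto
        then have "\<bar>u z\<bar> \<le> ereal M" using elim by blast
        then show False using z(1) by (cases "u z") auto
      qed
    qed
    then have "emeasure lebesgue (ball y r) = 0"
      by (subst (asm) AE_iff_measurable[of "ball y r"]) auto
    then show False using content_ball_pos[OF r(1), of y] by (simp add: measure_def)
  qed
  have "\<forall>y\<in>\<Omega> \<inter> ball x (min d e). \<bar>u y\<bar> \<le> ereal (max \<bar>M\<bar> \<bar>N\<bar>)"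
  proof
    fix y assume "y \<in> \<Omega> \<inter> ball x (min d e)"
    then have y: "y \<in> ball x d" "y \<in> ball x e" by auto
    have "u y < ereal N" "ereal (- M) \<le> u y" using d(2) y(1) lower[OF y(2)] by auto
    then show "\<bar>u y\<bar> \<le> ereal (max \<bar>M\<bar> \<bar>N\<bar>)" by (cases "u y") (auto simp: max_def abs_if)
  qed
  moreover have "0 < min d e" using d(1) e(1) by simp
  ultimately show "\<exists>e>0. \<exists>M::real. \<forall>y\<in>\<Omega> \<inter> ball x e. \<bar>u y\<bar> \<le> ereal M" by meson
qed

section \<open>The current \<open>\<triangle>(u T)\<close>\<close>

locale psh_times_current =
  fixes \<Omega> :: "'n::{finite,linorder} hspace set" and k :: nat and u :: "'n hspace \<Rightarrow> ereal"
    and T :: "'n functional"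
  assumes op: "open \<Omega>" and T: "closed_positive_current \<Omega> k T"
    and u: "u \<in> PSH \<Omega>" "locally_bounded_on \<Omega> u" and k: "k + 1 \<le> CARD('n)"
begin

text \<open>The same choice as in \<open>mult_current\<close>, which makes \<open>S_eq\<close> a
  mere unfolding.\<close>

definition "\<mu> = (SOME \<mu>. has_coefficients \<Omega> (2 * k) T \<mu>)"

lemma current_T: "current \<Omega> (2 * k) T" and closed_T: "closed_current \<Omega> (2 * k) T"
  and positive_T: "positive_current \<Omega> k T"
  using T by (simp_all add: closed_positive_current_def)

lemma coefficients_T: "has_coefficients \<Omega> (2 * k) T \<mu>"
  unfolding \<mu>_def by (rule someI_ex[OF has_coefficients_exists[OF op current_T positive_T]])

sublocale coefficients \<Omega> "2 * k" \<mu>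
  using coefficients_T by unfold_locales (simp add: has_coefficients_def)

lemma T_eq:
  assumes "\<phi> \<in> test_forms \<Omega> m" "2 * k + m = 2 * CARD('n)"
  shows "T \<phi> = pairing (2 * k) \<mu> \<phi>"
proof -
  have "m = 2 * CARD('n) - 2 * k" using assms(2) by simp
  then show ?thesis using coefficients_T assms(1) by (simp add: has_coefficients_def)
qed

abbreviation S :: "'n functional" where "S \<equiv> lap_current (mult_current \<Omega> (2 * k) u T)"

lemma S_eq: "S \<eta> = pairing (2 * k) \<mu> (\<lambda>x. of_real (real_of_ereal (u x)) *s lap \<eta> x)"
  by (simp add: lap_current_def mult_current_def \<mu>_def)

text \<open>The values of \<open>u\<close> outside \<open>\<Omega>\<close> are arbitrary, so
  \<open>u\<close> itself may fail to be Borel measurable or bounded. On the support of a test form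
  it is replaced by a bounded Borel function; off the support the factor \<open>lap \<eta>\<close>
  vanishes.\<close>

lemma cut_off:
  assumes K: "compact K" "K \<subseteq> \<Omega>"
  obtains h M where "h \<in> borel_measurable borel" "\<And>x. \<bar>h x\<bar> \<le> M" "\<forall>x\<in>K. h x = real_of_ereal (u x)"
proof -
  obtain M where M: "\<And>x. x \<in> K \<Longrightarrow> \<bar>u x\<bar> \<le> ereal M"
    by (rule locally_bounded_compact[OF u(2) K]) (rule that)
  have fin: "\<bar>u x\<bar> \<noteq> \<infinity>" if "x \<in> K" for x using M[OF that] by auto
  have usc: "usc_on \<Omega> u" using u(1) by (simp add: PSH_def)
  have b: "\<bar>indicator K x * real_of_ereal (u x)\<bar> \<le> max M 0" for x
    using M[of x] by (cases "x \<in> K"; cases "u x") auto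
  show ?thesis
    by (rule that[of "\<lambda>x. indicator K x * real_of_ereal (u x)", OF usc_borel[OF op usc borel_compact[OF K(1)] K(2) fin] b])
      simp_all
qed

lemma lap_zero:
  assumes "smooth \<eta>" "\<forall>x. x \<notin> K \<longrightarrow> \<eta> x = 0" "compact K" shows "\<forall>x. x \<notin> K \<longrightarrow> lap \<eta> x = 0"
  using assms(2) by (intro allI impI lap_outside[OF assms(1) compact_imp_closed[OF assms(3)]]) simp_all

lemma S_cut_off:
  assumes \<eta>: "smooth \<eta>" "\<forall>x. x \<notin> K \<longrightarrow> \<eta> x = 0" and K: "compact K"
    and h: "\<forall>x\<in>K. h x = real_of_ereal (u x)"
  shows "S \<eta> = pairing (2 * k) \<mu> (\<lambda>x. of_real (h x) *s lap \<eta> x)"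
proof -
  have "of_real (real_of_ereal (u x)) *s lap \<eta> x = of_real (h x) *s lap \<eta> x" for x
    using h lap_zero[OF \<eta> K] by (cases "x \<in> K") simp_all
  then show ?thesis unfolding S_eq by presburger
qed

lemma lap_admissible:
  assumes \<eta>: "smooth \<eta>" "\<forall>x. x \<notin> K \<longrightarrow> \<eta> x = 0" and K: "compact K"
    and h: "h \<in> borel_measurable borel" "\<And>x. \<bar>h x\<bar> \<le> M"
  obtains B where "admissible_form K B (\<lambda>x. of_real (h x) *s lap \<eta> x)"
proof -
  have s: "smooth (lap \<eta>)" by (rule smooth_lap[OF \<eta>(1)])
  note o = lap_zero[OF \<eta> K]
  obtain B where B: "0 \<le> B" "\<And>x. norm (lap \<eta> x) \<le> B"
    by (rule compact_support_bounded[OF s K]) (simp add: o, rule that)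
  have "admissible_form K B (lap \<eta>)" by (rule smooth_admissible_form[OF s _ B(2)]) (simp add: o)
  from admissible_form_mult[OF this h B(1)] show ?thesis by (rule that)
qed

lemma S_add:
  assumes "\<phi> \<in> test_forms \<Omega> m" "\<psi> \<in> test_forms \<Omega> m"
  shows "S (\<lambda>x. \<phi> x + \<psi> x) = S \<phi> + S \<psi>"
proof -
  note s = test_formsD(1)[OF assms(1)] test_formsD(1)[OF assms(2)]
  obtain K where K: "compact K" "K \<subseteq> \<Omega>" "\<And>x. x \<notin> K \<Longrightarrow> \<phi> x = 0"
    using test_formsD(3)[OF assms(1)] by auto
  obtain L where L: "compact L" "L \<subseteq> \<Omega>" "\<And>x. x \<notin> L \<Longrightarrow> \<psi> x = 0"
    using test_formsD(3)[OF assms(2)] by auto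
  have KL: "compact (K \<union> L)" "K \<union> L \<subseteq> \<Omega>" using K L by auto
  have z: "\<forall>x. x \<notin> K \<union> L \<longrightarrow> \<phi> x = 0" "\<forall>x. x \<notin> K \<union> L \<longrightarrow> \<psi> x = 0"
    "\<forall>x. x \<notin> K \<union> L \<longrightarrow> \<phi> x + \<psi> x = 0" using K(3) L(3) by auto
  obtain h M where h: "h \<in> borel_measurable borel" "\<And>x. \<bar>h x\<bar> \<le> M" "\<forall>x\<in>K \<union> L. h x = real_of_ereal (u x)"
    by (rule cut_off[OF KL]) (rule that)
  obtain B where B: "admissible_form (K \<union> L) B (\<lambda>x. of_real (h x) *s lap \<phi> x)"
    by (rule lap_admissible[OF s(1) z(1) KL(1) h(1,2)])
  obtain C where C: "admissible_form (K \<union> L) C (\<lambda>x. of_real (h x) *s lap \<psi> x)"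
    by (rule lap_admissible[OF s(2) z(2) KL(1) h(1,2)])
  show ?thesis
    unfolding S_cut_off[OF s(1) z(1) KL(1) h(3)] S_cut_off[OF s(2) z(2) KL(1) h(3)]
      S_cut_off[OF smooth_add[OF s] z(3) KL(1) h(3)] lap_add[OF s] vector_add_ldistrib
    by (rule pairing_add[OF KL B C])
qed

lemma S_smult:
  assumes "\<phi> \<in> test_forms \<Omega> m" shows "S (\<lambda>x. c *s \<phi> x) = c * S \<phi>"
proof -
  note s = test_formsD(1)[OF assms]
  obtain K where K: "compact K" "K \<subseteq> \<Omega>" "\<forall>x. x \<notin> K \<longrightarrow> \<phi> x = 0"
    using test_formsD(3)[OF assms] by auto
  obtain h M where h: "h \<in> borel_measurable borel" "\<And>x. \<bar>h x\<bar> \<le> M" "\<forall>x\<in>K. h x = real_of_ereal (u x)"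
    by (rule cut_off[OF K(1,2)]) (rule that)
  obtain B where B: "admissible_form K B (\<lambda>x. of_real (h x) *s lap \<phi> x)"
    by (rule lap_admissible[OF s K(3,1) h(1,2)])
  have "(\<lambda>x. of_real (real_of_ereal (u x)) *s lap (\<lambda>x. c *s \<phi> x) x)
      = (\<lambda>x. c *s (of_real (real_of_ereal (u x)) *s lap \<phi> x))"
    by (simp add: lap_smult[OF s] vector_smult_assoc mult.commute)
  then have "S (\<lambda>x. c *s \<phi> x) = pairing (2 * k) \<mu> (\<lambda>x. c *s (of_real (real_of_ereal (u x)) *s lap \<phi> x))"
    by (simp add: S_eq)
  moreover have "of_real (real_of_ereal (u x)) *s lap \<phi> x = of_real (h x) *s lap \<phi> x" for x
    using h(3) lap_zero[OF s K(3,1)] by (cases "x \<in> K") simp_all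
  ultimately have "S (\<lambda>x. c *s \<phi> x) = pairing (2 * k) \<mu> (\<lambda>x. c *s (of_real (h x) *s lap \<phi> x))" by presburger
  also have "\<dots> = c * S \<phi>"
    unfolding S_cut_off[OF s K(3,1) h(3)] by (rule pairing_smult[OF K(1,2) B])
  finally show ?thesis .
qed

lemma S_bound:
  assumes K: "compact K" "K \<subseteq> \<Omega>"
  shows "\<exists>C. \<forall>\<phi>\<in>test_forms \<Omega> m. \<forall>M. (\<forall>x. x \<notin> K \<longrightarrow> \<phi> x = 0) \<and>
    (\<forall>vs x. set vs \<subseteq> Basis \<and> length vs \<le> 2 \<longrightarrow> norm (iter_deriv vs \<phi> x) \<le> M) \<longrightarrow> norm (S \<phi>) \<le> C * M"
proof -
  obtain h M0 where h: "h \<in> borel_measurable borel" "\<And>x. \<bar>h x\<bar> \<le> M0" "\<forall>x\<in>K. h x = real_of_ereal (u x)"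
    by (rule cut_off[OF K]) (rule that)
  obtain C where C: "\<And>B F. admissible_form K B F \<Longrightarrow> norm (pairing (2 * k) \<mu> F) \<le> C * B"
    using pairing_bound[OF K] by metis
  obtain D where D: "0 \<le> D" "\<And>(F :: 'n hspace \<Rightarrow> 'n ext) M x. smooth F \<Longrightarrow>
      \<forall>vs x. set vs \<subseteq> Basis \<and> length vs \<le> 2 \<longrightarrow> norm (iter_deriv vs F x) \<le> M \<Longrightarrow> norm (lap F x) \<le> D * M"
    using lap_bound by meson
  have "norm (S \<phi>) \<le> (C * M0 * D) * M"
    if \<phi>: "\<phi> \<in> test_forms \<Omega> m" and z: "\<forall>x. x \<notin> K \<longrightarrow> \<phi> x = 0"
      and M: "\<forall>vs x. set vs \<subseteq> Basis \<and> length vs \<le> 2 \<longrightarrow> norm (iter_deriv vs \<phi> x) \<le> M" for \<phi> M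
  proof -
    note s = test_formsD(1)[OF \<phi>]
    have s': "smooth (lap \<phi>)" by (rule smooth_lap[OF s])
    have "norm (lap \<phi> 0) \<le> D * M" by (rule D(2)[OF s M])
    then have DM: "0 \<le> D * M" using norm_ge_zero[of "lap \<phi> 0"] by linarith
    have "admissible_form K (D * M) (lap \<phi>)"
      by (rule smooth_admissible_form[OF s' _ D(2)[OF s M]]) (simp add: lap_zero[OF s z K(1)])
    then have "admissible_form K (M0 * (D * M)) (\<lambda>x. of_real (h x) *s lap \<phi> x)"
      by (rule admissible_form_mult[OF _ h(1,2) DM])
    from C[OF this] show ?thesis
      unfolding S_cut_off[OF s z K(1) h(3)] by (simp add: mult_ac)
  qed
  then show ?thesis by meson
qed

lemma current_S: "current \<Omega> (2 * (k + 1)) S"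
  unfolding current_def Let_def
proof (intro conjI ballI allI impI)
  show "2 * (k + 1) \<le> 2 * CARD('n)" using k by simp
next
  fix K assume "compact K \<and> K \<subseteq> \<Omega>"
  then have K: "compact K" "K \<subseteq> \<Omega>" by simp_all
  show "\<exists>C N. \<forall>\<phi>\<in>test_forms \<Omega> (2 * CARD('n) - 2 * (k + 1)). \<forall>M. (\<forall>x. x \<notin> K \<longrightarrow> \<phi> x = 0) \<and>
      (\<forall>vs x. set vs \<subseteq> Basis \<and> length vs \<le> N \<longrightarrow> norm (iter_deriv vs \<phi> x) \<le> M) \<longrightarrow> norm (S \<phi>) \<le> C * M"
    using S_bound[OF K] by (rule ex_forward) (rule exI[of _ 2])
qed (rule S_add S_smult; assumption)+

lemma closed_S: "closed_current \<Omega> (2 * (k + 1)) S"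
  unfolding closed_current_def d_current_def
proof (intro allI impI ballI)
  fix \<alpha> m \<eta> assume \<eta>: "\<eta> \<in> test_forms \<Omega> m"
  have "pairing (2 * k) \<mu> (\<lambda>x. 0) = 0"
    by (simp add: pairing_def cmeasure_integral_def split: prod.split)
  then show "- S (ext_d \<alpha> \<eta>) = 0"
    by (simp add: S_eq lap_ext_d[OF test_formsD(1)[OF \<eta>]])
qed

lemma positive_S: "positive_current \<Omega> (k + 1) S"
  unfolding positive_current_def
proof (intro ballI impI)
  fix \<eta> assume \<eta>: "\<eta> \<in> test_forms \<Omega> (2 * CARD('n) - 2 * (k + 1))"
    and SP: "\<forall>x. \<eta> x \<in> SP (CARD('n) - (k + 1))"
  define m where "m = 2 * CARD('n) - 2 * (k + 1)"
  have m: "2 * k + Suc (Suc m) = 2 * CARD('n)" using k by (simp add: m_def)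
  have \<eta>': "\<eta> \<in> test_forms \<Omega> m" using \<eta> by (simp add: m_def)
  note s = test_formsD(1)[OF \<eta>]
  obtain K where K: "compact K" "K \<subseteq> \<Omega>" "\<forall>x. x \<notin> K \<longrightarrow> \<eta> x = 0"
    using test_formsD(3)[OF \<eta>] by auto
  obtain g :: "nat \<Rightarrow> 'n hspace \<Rightarrow> real" and M where g: "\<And>j. smooth (g j)" "\<And>j x. \<bar>g j x\<bar> \<le> M"
      "\<And>x. x \<in> K \<Longrightarrow> (\<lambda>j. g j x) \<longlonglongrightarrow> real_of_ereal (u x)"
      "\<And>j x b. x \<in> K \<Longrightarrow> 0 \<le> (LINT q|unif. hess (g j) x (hmul b q) (hmul b q))"
    by (rule psh_approximation[OF op u K(1,2)]) (rule that)
  obtain h M' where h: "h \<in> borel_measurable borel" "\<And>x. \<bar>h x\<bar> \<le> M'" "\<forall>x\<in>K. h x = real_of_ereal (u x)"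
    by (rule cut_off[OF K(1,2)]) (rule that)
  have s': "smooth (lap \<eta>)" by (rule smooth_lap[OF s])
  note o = lap_zero[OF s K(3,1)]
  obtain B where B: "0 \<le> B" "\<And>x. norm (lap \<eta> x) \<le> B"
    by (rule compact_support_bounded[OF s' K(1)]) (simp add: o, rule that)
  have "admissible_form K B (lap \<eta>)" by (rule smooth_admissible_form[OF s' _ B(2)]) (simp add: o)
  note ad = admissible_form_mult[OF this _ _ B(1)]
  have gb: "g j \<in> borel_measurable borel" for j
    by (intro borel_measurable_continuous_onI smooth_continuous_on g(1))
  have adh: "admissible_form K (M' * B) (\<lambda>x. of_real (h x) *s lap \<eta> x)" by (rule ad[OF h(1,2)])
  \<comment> \<open>Convergence holds at every point: on \<open>K\<close> by
    \<open>psh_approximation\<close>, off \<open>K\<close> because \<open>lap \<eta>\<close>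
    vanishes there.\<close>
  have "(\<lambda>j. pairing (2 * k) \<mu> (\<lambda>x. of_real (g j x) *s lap \<eta> x)) \<longlonglongrightarrow>
      pairing (2 * k) \<mu> (\<lambda>x. of_real (h x) *s lap \<eta> x)"
  proof (rule pairing_limit[OF K(1,2)])
    show "admissible_form K (M * B) (\<lambda>x. of_real (g j x) *s lap \<eta> x)" for j by (rule ad[OF gb g(2)])
    show "(\<lambda>x. (of_real (h x) *s lap \<eta> x) $ J) \<in> borel_measurable borel" for J
      using adh unfolding admissible_form_def admissible_def by simp
    show "(\<lambda>j. of_real (g j x) *s lap \<eta> x) \<longlonglongrightarrow> of_real (h x) *s lap \<eta> x" for x
    proof (cases "x \<in> K")
      case True
      then show ?thesis unfolding scaleR_eq_smult[symmetric] bspec[OF h(3) True]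
        by (intro tendsto_scaleR g(3) tendsto_const)
    qed (simp add: o)
  qed
  then have lim: "(\<lambda>j. pairing (2 * k) \<mu> (\<lambda>x. of_real (g j x) *s lap \<eta> x)) \<longlonglongrightarrow> S \<eta>"
    by (simp add: S_cut_off[OF s K(3,1) h(3)])
  have pos: "pairing (2 * k) \<mu> (\<lambda>x. of_real (g j x) *s lap \<eta> x) \<in> nonneg_Reals" for j
  proof -
    \<comment> \<open>The condition on the averaged Hessian is available on \<open>K\<close>;
      elsewhere \<open>\<eta>\<close>, and with it the form, is zero.\<close>
    have "hess_form (hess (g j) x) (\<eta> x) \<in> SP (Suc (CARD('n) - (k + 1)))" for x
    proof (cases "x \<in> K")
      case True
      show ?thesis
        by (rule hess_form_SP[OF hess_linear[OF g(1)] hess_sym[OF g(1)] g(4)[OF True] spec[OF SP]])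
    next
      case False
      then have "hess_form (hess (g j) x) (\<eta> x) = 0"
        using K(3) by (simp add: hess_form_def bounded_bilinear.zero_right[OF bilinear_wedge])
      then show ?thesis using SP_zero by simp
    qed
    moreover have "Suc (CARD('n) - (k + 1)) = CARD('n) - k" using k by simp
    ultimately have SP': "hess_form (hess (g j) x) (\<eta> x) \<in> SP (CARD('n) - k)" for x by simp
    \<comment> \<open>Positivity of \<open>T\<close> applies to the Hessian form. Integration by
      parts carries the sign over to \<open>g j\<close> times \<open>lap \<eta>\<close>, where
      \<open>g j\<close> enters without derivatives and the limit in \<open>j\<close> can be
      taken.\<close>
    have "T (\<lambda>x. hess_form (hess (g j) x) (\<eta> x)) \<in> nonneg_Reals"
      by (rule positive_currentD[OF positive_T _ test_forms_hess_form[OF g(1) \<eta>'] SP']) (use m in simp)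
    also have "T (\<lambda>x. hess_form (hess (g j) x) (\<eta> x)) = T (\<lambda>x. g j x *\<^sub>R lap \<eta> x)"
      by (rule current_mult_lap[OF current_T closed_T m g(1) \<eta>', symmetric])
    also have "\<dots> = pairing (2 * k) \<mu> (\<lambda>x. g j x *\<^sub>R lap \<eta> x)"
      by (rule T_eq[OF test_forms_mult[OF g(1) test_forms_lap[OF \<eta>']] m])
    finally show ?thesis by (simp add: scaleR_eq_smult)
  qed
  show "S \<eta> \<in> nonneg_Reals"
    by (rule closed_sequentially[OF closed_nonneg_Reals_complex pos lim])
qed

end

lemma closed_positive_current_lap:
  fixes T :: "'n::{finite,linorder} functional"
  assumes "open \<Omega>" "closed_positive_current \<Omega> k T" "u \<in> PSH \<Omega>" "locally_bounded_on \<Omega> u" "k + 1 \<le> CARD('n)"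
  shows "closed_positive_current \<Omega> (k + 1) (lap_current (mult_current \<Omega> (2 * k) u T))"
proof -
  interpret psh_times_current \<Omega> k u T by unfold_locales (fact assms)+
  show ?thesis unfolding closed_positive_current_def by (intro conjI current_S closed_S positive_S)
qed

theorem proposition3p9:
  fixes \<Omega> :: "'n::{finite,linorder} hspace set"
    and T :: "'n functional"
    and k :: nat
  assumes "open \<Omega>"
    and "closed_positive_current \<Omega> k T"
  shows "(\<forall>u. u \<in> PSH \<Omega> \<and> locally_bounded_on \<Omega> u \<and> k + 1 \<le> CARD('n) \<longrightarrow>
            closed_positive_current \<Omega> (k + 1) (lap_current (mult_current \<Omega> (2 * k) u T))) \<and>
         (\<forall>us. set us \<subseteq> PSH \<Omega> \<inter> Linf_loc \<Omega> \<and> k + length us \<le> CARD('n) \<longrightarrow>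
            closed_positive_current \<Omega> (k + length us) (lap_wedge \<Omega> k us T))"
proof (intro conjI allI impI)
  show "closed_positive_current \<Omega> (k + 1) (lap_current (mult_current \<Omega> (2 * k) u T))"
    if "u \<in> PSH \<Omega> \<and> locally_bounded_on \<Omega> u \<and> k + 1 \<le> CARD('n)" for u
    using that by (intro closed_positive_current_lap assms) simp_all
  show "closed_positive_current \<Omega> (k + length us) (lap_wedge \<Omega> k us T)"
    if "set us \<subseteq> PSH \<Omega> \<inter> Linf_loc \<Omega> \<and> k + length us \<le> CARD('n)" for us
    using that
  \<comment> \<open>The last function of the list acts first, so the induction hypothesis provides
    the closed positive current to which the head is applied; the length bound counts the head and
    therefore leaves room for the next degree.\<close>
  proof (induction us)
    case Nil
    then show ?case using assms(2) by simp
  next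
    case (Cons u us)
    then have u: "u \<in> PSH \<Omega>" "u \<in> Linf_loc \<Omega>" "k + length us + 1 \<le> CARD('n)"
      and IH: "closed_positive_current \<Omega> (k + length us) (lap_wedge \<Omega> k us T)" by simp_all
    show ?case
      using closed_positive_current_lap[OF assms(1) IH u(1) Linf_loc_locally_bounded[OF assms(1) u(1,2)] u(3)]
      by simp
  qed
qed

end
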